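(* Let $(\mathcal{A}_1,\rho_1)$ and $(\mathcal{A}_2,\rho_2)$ be algebraic compact quantum metric spaces and let $r$ be a real number with $r\geq\frac{1}{2}\max(\|\rho_1\|,\|\rho_2\|)$. Then $(\mathcal{A}_1\oplus\mathcal{A}_2,\rho)$ is an algebraic compact quantum metric space, where $$\rho=\rho_1+\rho_2+r1_{\mathcal{A}_1\check{\otimes}\mathcal{A}_2}+r1_{\mathcal{A}_2\check{\otimes}\mathcal{A}_1}\in(\mathcal{A}_1\oplus\mathcal{A}_2)\check{\otimes}(\mathcal{A}_1\oplus\mathcal{A}_2)=\bigoplus_{i,j=1,2}\mathcal{A}_i\check{\otimes}\mathcal{A}_j.$$
   Context: Notation: $\check{\otimes}$ denotes the spatial (minimal) tensor product of C*-algebras. In the formula for $\rho$, each $\rho_i\in\mathcal{A}_i\check{\otimes}\mathcal{A}_i$ and each unit $1_{\mathcal{A}_i\check{\otimes}\mathcal{A}_j}$ is regarded as an element of the direct sum $\bigoplus_{i,j}\mathcal{A}_i\check{\otimes}\mathcal{A}_j$ via the corresponding summand. A unital C*-algebra $\mathcal{A}$ is called a spatially continuous multiplication C*-algebra if its multiplication $m:a\otimes b\mapsto ab$ is continuous with respect to the spatial tensor norm, so that it extends to a bounded linear map $m:\mathcal{A}\check{\otimes}\mathcal{A}\to\mathcal{A}$. Algebraic compact quantum metric space: a pair $(\mathcal{A},\rho)$ where $\mathcal{A}$ is a unital spatially continuous multiplication C*-algebra and $\rho\in\mathcal{A}\check{\otimes}\mathcal{A}$ satisfies (with $\mathfrak{F}:\mathcal{A}\check{\otimes}\mathcal{A}\to\mathcal{A}\check{\otimes}\mathcal{A}$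 the flip $a\otimes b\mapsto b\otimes a$): (i)$'$ $\rho$ is a positive element of $\mathcal{A}\check{\otimes}\mathcal{A}$; (ii)$''$ $m(\rho)=0$; (iii)$''$ for every positive element $\nu\in\mathcal{A}\check{\otimes}\mathcal{A}$ with $m(\nu)=1$ and $\mathfrak{F}(\nu)=\nu$, the element $\rho+\nu$ is invertible in $\mathcal{A}\check{\otimes}\mathcal{A}$; (iv)$'$ $\mathfrak{F}(\rho)=\rho$; (v)$'$ $\mathfrak{M}(\rho)\leq\rho\otimes1+1\otimes\rho$ in $\mathcal{A}\check{\otimes}\mathcal{A}\check{\otimes}\mathcal{A}$, where $\mathfrak{M}:\mathcal{A}\check{\otimes}\mathcal{A}\to\mathcal{A}\check{\otimes}\mathcal{A}\check{\otimes}\mathcal{A}$ is the *-morphism with $\mathfrak{M}(a\otimes b)=a\otimes1\otimes b$.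
   Formalization: The hypothesis r > 0 is added: for ρ₁ = ρ₂ = 0 and r = 0 the claim fails whenever both algebras are nonzero (e.g. A₁ = A₂ = C, where ρ = 0 and ν = 1₁₁ + 1₂₂ violates the invertibility condition (iii)''). *)

theory Defs
  imports "HOL-Analysis.Analysis"
begin

class scaleC =
  fixes scaleC :: "complex \<Rightarrow> 'a \<Rightarrow> 'a" (infixr "*\<^sub>C" 75)

class involution =
  fixes inv_star :: "'a \<Rightarrow> 'a" ("_\<^sup>\<star>" [1000] 999)

text \<open>
  Complex unital *-algebras with a C*-norm, not necessarily complete. The unit is not required to
  differ from 0, so the zero algebra is included.
\<close>

class pre_cstar_algebra = real_normed_algebra + monoid_mult + scaleC + involution +
  assumes scaleC_add_right: "c *\<^sub>C (x + y) = c *\<^sub>C x + c *\<^sub>C y"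
    and scaleC_add_left: "(c + d) *\<^sub>C x = c *\<^sub>C x + d *\<^sub>C x"
    and scaleC_scaleC: "c *\<^sub>C d *\<^sub>C x = (c * d) *\<^sub>C x"
    and scaleR_scaleC: "r *\<^sub>R x = complex_of_real r *\<^sub>C x"
    and mult_scaleC_left: "(c *\<^sub>C x) * y = c *\<^sub>C (x * y)"
    and mult_scaleC_right: "x * (c *\<^sub>C y) = c *\<^sub>C (x * y)"
    and norm_scaleC: "norm (c *\<^sub>C x) = cmod c * norm x"
    and star_star: "(x\<^sup>\<star>)\<^sup>\<star> = x"
    and star_add: "(x + y)\<^sup>\<star> = x\<^sup>\<star> + y\<^sup>\<star>"
    and star_scaleC: "(c *\<^sub>C x)\<^sup>\<star> = cnj c *\<^sub>C x\<^sup>\<star>"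
    and star_mult: "(x * y)\<^sup>\<star> = y\<^sup>\<star> * x\<^sup>\<star>"
    and cstar_identity: "norm (x\<^sup>\<star> * x) = (norm x)\<^sup>2"

class cstar_algebra = pre_cstar_algebra + banach

instantiation complex :: cstar_algebra
begin
definition scaleC_complex :: "complex \<Rightarrow> complex \<Rightarrow> complex" where "scaleC_complex = (*)"
definition inv_star_complex :: "complex \<Rightarrow> complex" where "inv_star_complex = cnj"
instance
  by standard (auto simp: scaleC_complex_def inv_star_complex_def algebra_simps norm_mult
      scaleR_conv_of_real power2_eq_square)
end

definition cbounded_linear :: "('a::pre_cstar_algebra \<Rightarrow> 'b::pre_cstar_algebra) \<Rightarrow> bool" where
  "cbounded_linear f \<longleftrightarrow> bounded_linear f \<and> (\<forall>c x. f (c *\<^sub>C x) = c *\<^sub>C f x)"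

text \<open>For bounded positive functionals on a unital C*-algebra, norm 1 amounts to value 1 at the unit.\<close>

definition state :: "('a::cstar_algebra \<Rightarrow> complex) \<Rightarrow> bool" where
  "state \<phi> \<longleftrightarrow> cbounded_linear \<phi> \<and> (\<forall>a. \<phi> (a\<^sup>\<star> * a) \<in> \<real>\<^sub>\<ge>\<^sub>0) \<and> \<phi> 1 = 1"

lemma scaleC_one [simp]: "1 *\<^sub>C x = (x::'a::pre_cstar_algebra)"
  using scaleR_scaleC[of 1 x] by simp

lemma scaleC_zero_left [simp]: "0 *\<^sub>C x = (0::'a::pre_cstar_algebra)"
  using scaleR_scaleC[of 0 x] by simp

lemma scaleC_minus1: "(-1) *\<^sub>C x = - (x::'a::pre_cstar_algebra)"
  using scaleR_scaleC[of "-1" x] by simp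

lemma star_minus: "(- x)\<^sup>\<star> = - (x\<^sup>\<star> :: 'a::pre_cstar_algebra)"
  using star_scaleC[of "-1" x] by (simp add: scaleC_minus1)

lemma star_one [simp]: "1\<^sup>\<star> = (1 :: 'a::pre_cstar_algebra)"
  by (metis mult_1 mult_1_right star_mult star_star)

lemma norm_star: "norm (x\<^sup>\<star>) = norm (x :: 'a::pre_cstar_algebra)"
proof -
  have *: "norm y \<le> norm (y\<^sup>\<star>)" for y :: 'a
  proof (cases "y = 0")
    case False
    have "(norm y)\<^sup>2 \<le> norm (y\<^sup>\<star>) * norm y"
      using norm_mult_ineq[of "y\<^sup>\<star>" y] by (simp add: cstar_identity)
    then show ?thesis using False by (simp add: power2_eq_square)
  qed simp
  show ?thesis using *[of x] *[of "x\<^sup>\<star>"] by (simp add: star_star)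
qed

lemma quadratic_nonneg_cs:
  fixes c d :: complex and A B :: real
  assumes "\<And>t. complex_of_real A + t * c + cnj t * d + complex_of_real ((cmod t)\<^sup>2 * B) \<in> \<real>\<^sub>\<ge>\<^sub>0"
    and "B \<ge> 0"
  shows "d = cnj c" "A \<ge> 0" "(cmod c)\<^sup>2 \<le> A * B"
proof -
  show d: "d = cnj c"
    using assms(1)[of 1] assms(1)[of \<i>]
    by (auto simp: complex_nonneg_Reals_iff complex_eq_iff)
  show A: "A \<ge> 0" using assms(1)[of 0] by (simp add: complex_nonneg_Reals_iff)
  have *: "0 \<le> A + 2 * Re (t * c) + (cmod t)\<^sup>2 * B" for t
    using assms(1)[of t] by (simp add: complex_nonneg_Reals_iff d algebra_simps)
  have q: "0 \<le> A - 2 * s * (cmod c)\<^sup>2 + s\<^sup>2 * (cmod c)\<^sup>2 * B" for s :: real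
  proof -
    have "Re ((- of_real s * cnj c) * c) = - s * (cmod c)\<^sup>2"
      unfolding cmod_power2 by (simp add: algebra_simps power2_eq_square)
    moreover have "(cmod (- of_real s * cnj c))\<^sup>2 = s\<^sup>2 * (cmod c)\<^sup>2"
      by (simp add: norm_mult power_mult_distrib)
    ultimately show ?thesis using *[of "- of_real s * cnj c"] by simp
  qed
  show "(cmod c)\<^sup>2 \<le> A * B"
  proof (cases "B = 0")
    case True
    have "cmod c = 0"
    proof (rule ccontr)
      assume "cmod c \<noteq> 0"
      then show False using q[of "(A + 1) / (cmod c)\<^sup>2"] True A by (simp add: divide_simps)
    qed
    then show ?thesis using True by simp
  next
    case False
    then have "0 < B" using assms(2) by simp
    then show ?thesis using q[of "1 / B"] by (simp add: field_simps power2_eq_square)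
  qed
qed

definition pos_fun :: "('a::cstar_algebra \<Rightarrow> complex) \<Rightarrow> bool" where
  "pos_fun \<phi> \<longleftrightarrow> cbounded_linear \<phi> \<and> (\<forall>a. \<phi> (a\<^sup>\<star> * a) \<in> \<real>\<^sub>\<ge>\<^sub>0)"

lemma state_pos_fun: "state \<phi> \<Longrightarrow> pos_fun \<phi>"
  by (simp add: state_def pos_fun_def)

lemma cbounded_linearD:
  assumes "cbounded_linear f"
  shows "f (x + y) = f x + f y" "f (c *\<^sub>C x) = c *\<^sub>C f x" "f 0 = 0" "f (- x) = - f x" "f (x - y) = f x - f y"
  using assms by (auto simp: cbounded_linear_def linear_simps)

lemma pos_fun_lin:
  assumes "pos_fun \<phi>"
  shows "\<phi> (x + y) = \<phi> x + \<phi> y" "\<phi> (c *\<^sub>C x) = c * \<phi> x" "\<phi> 0 = 0"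
  using assms cbounded_linearD[of \<phi>] by (auto simp: pos_fun_def scaleC_complex_def)

lemma nonneg_Reals_of_real: "z \<in> \<real>\<^sub>\<ge>\<^sub>0 \<Longrightarrow> z = complex_of_real (Re z)" "z \<in> \<real>\<^sub>\<ge>\<^sub>0 \<Longrightarrow> Re z \<ge> 0"
  by (auto simp: complex_nonneg_Reals_iff complex_eq_iff)

lemma pos_fun_cs:
  assumes "pos_fun \<phi>"
  shows "\<phi> (y\<^sup>\<star> * x) = cnj (\<phi> (x\<^sup>\<star> * y))"
    "(cmod (\<phi> (x\<^sup>\<star> * y)))\<^sup>2 \<le> Re (\<phi> (x\<^sup>\<star> * x)) * Re (\<phi> (y\<^sup>\<star> * y))"
proof -
  note lin = pos_fun_lin[OF assms]
  have pos: "\<phi> (a\<^sup>\<star> * a) \<in> \<real>\<^sub>\<ge>\<^sub>0" for a using assms by (simp add: pos_fun_def)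
  have *: "complex_of_real (Re (\<phi> (x\<^sup>\<star> * x))) + t * \<phi> (x\<^sup>\<star> * y) + cnj t * \<phi> (y\<^sup>\<star> * x)
     + complex_of_real ((cmod t)\<^sup>2 * Re (\<phi> (y\<^sup>\<star> * y))) \<in> \<real>\<^sub>\<ge>\<^sub>0" for t
  proof -
    have "\<phi> ((x + t *\<^sub>C y)\<^sup>\<star> * (x + t *\<^sub>C y)) =
      \<phi> (x\<^sup>\<star> * x) + t * \<phi> (x\<^sup>\<star> * y) + cnj t * \<phi> (y\<^sup>\<star> * x) + (cnj t * t) * \<phi> (y\<^sup>\<star> * y)"
      by (simp add: star_add star_scaleC mult_scaleC_left mult_scaleC_right distrib_left distrib_right lin
            algebra_simps)
    moreover have "cnj t * t = complex_of_real ((cmod t)\<^sup>2)"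
      by (simp only: complex_norm_square mult.commute)
    ultimately show ?thesis
      using pos[of "x + t *\<^sub>C y"] nonneg_Reals_of_real(1)[OF pos[of x]] nonneg_Reals_of_real(1)[OF pos[of y]]
      by (metis of_real_mult)
  qed
  note q = quadratic_nonneg_cs[OF *, OF nonneg_Reals_of_real(2)[OF pos]]
  show "\<phi> (y\<^sup>\<star> * x) = cnj (\<phi> (x\<^sup>\<star> * y))" by (rule q(1))
  show "(cmod (\<phi> (x\<^sup>\<star> * y)))\<^sup>2 \<le> Re (\<phi> (x\<^sup>\<star> * x)) * Re (\<phi> (y\<^sup>\<star> * y))" by (rule q(3))
qed

lemma pos_fun_bound:
  assumes "pos_fun \<phi>" "h\<^sup>\<star> = h"
  shows "cmod (\<phi> h) \<le> Re (\<phi> 1) * norm h"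
proof -
  define M where "M = Re (\<phi> 1)"
  have M0: "0 \<le> M"
    using assms(1) unfolding pos_fun_def M_def
    by (metis star_one mult_1 nonneg_Reals_of_real(2))
  have cs: "(cmod (\<phi> k))\<^sup>2 \<le> M * cmod (\<phi> (k * k))" if "k\<^sup>\<star> = k" for k
  proof -
    have "(cmod (\<phi> k))\<^sup>2 \<le> M * Re (\<phi> (k * k))"
      using pos_fun_cs(2)[OF assms(1), of 1 k] that by (simp add: M_def)
    also have "\<dots> \<le> M * cmod (\<phi> (k * k))"
      by (intro mult_left_mono complex_Re_le_cmod M0)
    finally show ?thesis .
  qed
  obtain C where C: "C \<ge> 0" "\<And>x. cmod (\<phi> x) \<le> norm x * C"
    using bounded_linear.nonneg_bounded[of \<phi>] assms(1) unfolding pos_fun_def cbounded_linear_def by blast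
  have it: "M * cmod (\<phi> k) ^ (2 ^ n) \<le> C * (M * norm k) ^ (2 ^ n)" if "k\<^sup>\<star> = k" for k n
    using that
  proof (induction n arbitrary: k)
    case 0
    show ?case using mult_left_mono[OF C(2)[of k] M0] by (simp add: mult_ac)
  next
    case (Suc n)
    have sk: "(k * k)\<^sup>\<star> = k * k" using Suc.prems by (simp add: star_mult)
    have "M * cmod (\<phi> k) ^ (2 ^ Suc n) = M * ((cmod (\<phi> k))\<^sup>2) ^ (2 ^ n)"
      by (simp add: power_mult)
    also have "\<dots> \<le> M * (M * cmod (\<phi> (k * k))) ^ (2 ^ n)"
      by (intro mult_left_mono power_mono cs Suc.prems M0) simp
    also have "\<dots> = M ^ (2 ^ n) * (M * cmod (\<phi> (k * k)) ^ (2 ^ n))"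
      by (simp add: power_mult_distrib)
    also have "\<dots> \<le> M ^ (2 ^ n) * (C * (M * norm (k * k)) ^ (2 ^ n))"
      by (intro mult_left_mono Suc.IH sk) (simp add: M0)
    also have "\<dots> \<le> M ^ (2 ^ n) * (C * (M * (norm k * norm k)) ^ (2 ^ n))"
      by (intro mult_left_mono power_mono norm_mult_ineq) (simp_all add: M0 C)
    also have "\<dots> = C * (M * norm k) ^ (2 ^ Suc n)"
      by (simp add: power_mult_distrib power_mult power2_eq_square mult_ac)
    finally show ?case .
  qed
  show ?thesis
  proof (cases "M = 0")
    case True
    then show ?thesis using cs[OF assms(2)] by (simp add: M_def)
  next
    case False
    then have Mp: "M > 0" using M0 by simp
    show ?thesis
    proof (rule ccontr)
      assume "\<not> ?thesis"
      then have lt: "M * norm h < cmod (\<phi> h)" by (simp add: M_def)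
      have ne: "norm h \<noteq> 0" using lt pos_fun_lin(3)[OF assms(1)] by auto
      define q where "q = cmod (\<phi> h) / (M * norm h)"
      have yp: "0 < M * norm h" using Mp ne by simp
      have q1: "1 < q" using lt yp by (simp add: q_def)
      have qb: "q ^ (2 ^ n) \<le> C / M" for n
      proof -
        have "q ^ (2 ^ n) = cmod (\<phi> h) ^ (2 ^ n) / (M * norm h) ^ (2 ^ n)"
          by (simp only: q_def power_divide)
        then show ?thesis
          using it[OF assms(2), of n] Mp zero_less_power[OF yp, of "2 ^ n"]
          by (simp add: field_simps del: power_mult_distrib)
      qed
      obtain n where n: "C / M < q ^ n" using real_arch_pow[OF q1] by blast
      have "q ^ n \<le> q ^ (2 ^ n)" using q1 by (intro power_increasing) auto
      then show False using n qb[of n] by simp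
    qed
  qed
qed


text \<open>
  A list of pairs stands for the formal sum of the elementary tensors of its entries; the operations
  on lists are those of the *-algebra of formal sums. Evaluating a bilinear map on the formal sum
  gives \<open>tsum\<close>.
\<close>

definition tsum :: "('a \<Rightarrow> 'b \<Rightarrow> 'c::comm_monoid_add) \<Rightarrow> ('a \<times> 'b) list \<Rightarrow> 'c" where
  "tsum f x = (\<Sum>(a, b)\<leftarrow>x. f a b)"

definition tmult :: "('a::times \<times> 'b::times) list \<Rightarrow> ('a \<times> 'b) list \<Rightarrow> ('a \<times> 'b) list" where
  "tmult x y = concat (map (\<lambda>(a, b). map (\<lambda>(c, d). (a * c, b * d)) y) x)"

definition tstar :: "('a::involution \<times> 'b::involution) list \<Rightarrow> ('a \<times> 'b) list" where
  "tstar x = map (\<lambda>(a, b). (a\<^sup>\<star>, b\<^sup>\<star>)) x"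

definition tscale :: "complex \<Rightarrow> ('a::scaleC \<times> 'b) list \<Rightarrow> ('a \<times> 'b) list" where
  "tscale c x = map (\<lambda>(a, b). (c *\<^sub>C a, b)) x"

text \<open>
  For states \<open>\<phi>\<close> and \<open>\<psi>\<close> with GNS spaces \<open>H\<close> and \<open>K\<close>, the
  number \<open>gns_norm \<phi> \<psi> y\<close> is the norm of the vector of the Hilbert space tensor product of
  \<open>H\<close> and \<open>K\<close> given by the sum of the tensors of the classes of the entries of \<open>y\<close>. These vectors
  are dense, and the tensor product of the two GNS representations maps \<open>x\<close> to the closure of
  \<open>y \<mapsto> tmult x y\<close>. Hence the supremum below is the operator norm of \<open>x\<close> in the tensor product of the
  universal representations (direct sums of all GNS representations), i.e. the spatial norm.
\<close>

definition gns_norm ::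
  "('a::cstar_algebra \<Rightarrow> complex) \<Rightarrow> ('b::cstar_algebra \<Rightarrow> complex) \<Rightarrow> ('a \<times> 'b) list \<Rightarrow> real" where
  "gns_norm \<phi> \<psi> y = sqrt (Re (tsum (\<lambda>a b. \<phi> a * \<psi> b) (tmult (tstar y) y)))"

definition spatial_norm :: "('a::cstar_algebra \<times> 'b::cstar_algebra) list \<Rightarrow> real" where
  "spatial_norm x = Sup (insert 0 {gns_norm \<phi> \<psi> (tmult x y) | \<phi> \<psi> y.
     state \<phi> \<and> state \<psi> \<and> gns_norm \<phi> \<psi> y \<le> 1})"

lemma tsum_simps [simp]:
  "tsum f [] = 0" "tsum f ((a, b) # x) = f a b + tsum f x" "tsum f (x @ y) = tsum f x + tsum f y"
  by (auto simp: tsum_def ac_simps)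

lemma tmult_simps [simp]:
  "tmult [] y = []" "tmult (x @ x') y = tmult x y @ tmult x' y"
  by (auto simp: tmult_def)

lemma tmult_Cons: "tmult ((a, b) # x) y = tmult [(a, b)] y @ tmult x y"
  by (auto simp: tmult_def)

lemma tmult_single_Nil [simp]: "tmult [(a, b)] [] = []"
  and tmult_single_Cons [simp]: "tmult [(a, b)] ((c, d) # y) = (a * c, b * d) # tmult [(a, b)] y"
  and tmult_single_append [simp]: "tmult [(a, b)] (y @ y') = tmult [(a, b)] y @ tmult [(a, b)] y'"
  by (auto simp: tmult_def)

lemma tmult_Nil_right [simp]: "tmult x [] = []"
  by (induction x) (auto simp: tmult_def)

lemma tsum_tmult_single: "tsum f (tmult [(a, b)] y) = tsum (\<lambda>c d. f (a * c) (b * d)) y"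
  by (induction y) auto

lemma tsum_tmult: "tsum f (tmult x y) = tsum (\<lambda>a b. tsum (\<lambda>c d. f (a * c) (b * d)) y) x"
proof (induction x)
  case (Cons p x)
  obtain a b where p: "p = (a, b)" by (cases p)
  show ?case unfolding p tmult_Cons[of a b x] tsum_simps
    by (simp add: Cons.IH tsum_tmult_single)
qed simp

lemma tstar_simps [simp]:
  "tstar [] = []" "tstar ((a, b) # x) = (a\<^sup>\<star>, b\<^sup>\<star>) # tstar x" "tstar (x @ y) = tstar x @ tstar y"
  by (auto simp: tstar_def)

lemma tsum_tstar: "tsum f (tstar x) = tsum (\<lambda>a b. f (a\<^sup>\<star>) (b\<^sup>\<star>)) x"
  by (induction x) auto

lemma tstar_tstar [simp]: "tstar (tstar x) = (x :: ('a::pre_cstar_algebra \<times> 'b::pre_cstar_algebra) list)"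
  by (induction x) (auto simp: star_star)

lemma tscale_simps [simp]:
  "tscale c [] = []" "tscale c ((a, b) # x) = (c *\<^sub>C a, b) # tscale c x"
  "tscale c (x @ y) = tscale c x @ tscale c y"
  by (auto simp: tscale_def)

lemma tsum_tscale: "tsum f (tscale c x) = tsum (\<lambda>a b. f (c *\<^sub>C a) b) x"
  by (induction x) auto

lemma tsum_0 [simp]: "tsum (\<lambda>a b. 0) x = 0"
  by (induction x) auto

lemma tsum_add: "tsum (\<lambda>a b. f a b + g a b) x = tsum f x + tsum g x"
  by (induction x) (auto simp: ac_simps)

lemma tsum_left: "tsum (\<lambda>a b. k * f a b) x = (k::complex) * tsum f x"
  by (induction x) (auto simp: distrib_left)

lemma tsum_cnj: "cnj (tsum f x) = tsum (\<lambda>a b. cnj (f a b)) x"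
  by (induction x) auto

lemma tsum_swap: "tsum (\<lambda>a b. tsum (\<lambda>c d. f a b c d) y) x = tsum (\<lambda>c d. tsum (\<lambda>a b. f a b c d) x) y"
proof (induction x)
  case (Cons p x)
  then show ?case by (cases p) (auto simp: tsum_add)
qed simp

definition cbilinear :: "('a::pre_cstar_algebra \<Rightarrow> 'b::pre_cstar_algebra \<Rightarrow> complex) \<Rightarrow> bool" where
  "cbilinear f \<longleftrightarrow> (\<forall>a a' b. f (a + a') b = f a b + f a' b) \<and> (\<forall>a b b'. f a (b + b') = f a b + f a b')
     \<and> (\<forall>c a b. f (c *\<^sub>C a) b = c * f a b) \<and> (\<forall>c a b. f a (c *\<^sub>C b) = c * f a b)"

definition teq :: "('a::pre_cstar_algebra \<times> 'b::pre_cstar_algebra) list \<Rightarrow> ('a \<times> 'b) list \<Rightarrow> bool" where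
  "teq x y \<longleftrightarrow> (\<forall>f. cbilinear f \<longrightarrow> tsum f x = tsum f y)"

lemma teqI: "(\<And>f. cbilinear f \<Longrightarrow> tsum f x = tsum f y) \<Longrightarrow> teq x y"
  by (simp add: teq_def)

lemma cbilinearD:
  assumes "cbilinear f"
  shows "f (a + a') b = f a b + f a' b" "f a (b + b') = f a b + f a b'"
    "f (c *\<^sub>C a) b = c * f a b" "f a (c *\<^sub>C b) = c * f a b"
  using assms by (auto simp: cbilinear_def)

lemma tsum_tscale_bil: "cbilinear f \<Longrightarrow> tsum f (tscale c x) = c * tsum f x"
  by (simp add: tsum_tscale cbilinearD tsum_left)

lemma cbilinear_mult_left: "cbilinear f \<Longrightarrow> cbilinear (\<lambda>c d. f (a * c) (b * d))"
  by (auto simp: cbilinear_def distrib_left mult_scaleC_right)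

lemma cbilinear_mult_right: "cbilinear f \<Longrightarrow> cbilinear (\<lambda>c d. f (c * a) (d * b))"
  by (auto simp: cbilinear_def distrib_right mult_scaleC_left)

lemma cbilinear_tsum: "(\<And>a b. cbilinear (f a b)) \<Longrightarrow> cbilinear (\<lambda>c d. tsum (\<lambda>a b. f a b c d) x)"
  by (auto simp: cbilinear_def tsum_add tsum_left)

lemma teq_refl [simp]: "teq x x" and teq_sym: "teq x y \<Longrightarrow> teq y x"
  and teq_trans: "teq x y \<Longrightarrow> teq y z \<Longrightarrow> teq x z"
  by (auto simp: teq_def)

lemma teq_append: "teq x y \<Longrightarrow> teq x' y' \<Longrightarrow> teq (x @ x') (y @ y')"
  by (auto simp: teq_def)

lemma teq_tscale: "teq x y \<Longrightarrow> teq (tscale c x) (tscale c y)"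
  by (auto simp: teq_def tsum_tscale_bil)

lemma teq_tmult: assumes "teq x y" "teq x' y'" shows "teq (tmult x x') (tmult y y')"
proof (rule teqI)
  fix f :: "'a \<Rightarrow> 'b \<Rightarrow> complex" assume f: "cbilinear f"
  have "tsum f (tmult x x') = tsum (\<lambda>a b. tsum (\<lambda>c d. f (a * c) (b * d)) x') x"
    by (simp add: tsum_tmult)
  also have "\<dots> = tsum (\<lambda>a b. tsum (\<lambda>c d. f (a * c) (b * d)) y') x"
    using assms(2) cbilinear_mult_left[OF f] unfolding teq_def by presburger
  also have "\<dots> = tsum (\<lambda>a b. tsum (\<lambda>c d. f (a * c) (b * d)) y') y"
    using assms(1) cbilinear_tsum[of "\<lambda>c d a b. f (a * c) (b * d)", OF cbilinear_mult_right[OF f], of y']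
    unfolding teq_def by blast
  finally show "tsum f (tmult x x') = tsum f (tmult y y')" by (simp add: tsum_tmult)
qed

lemma tsum_cong_bil: "teq x y \<Longrightarrow> cbilinear f \<Longrightarrow> tsum f x = tsum f y"
  by (simp add: teq_def)

lemma teq_tmult_assoc: "teq (tmult (tmult x y) z) (tmult x (tmult y z))"
  by (rule teqI) (simp add: tsum_tmult mult.assoc)

lemma teq_tmult_append: "teq (tmult x (y @ z)) (tmult x y @ tmult x z)"
  by (rule teqI) (simp add: tsum_tmult tsum_add)

lemma teq_tmult_scale1: "teq (tmult (tscale c x) y) (tscale c (tmult x y))"
  by (rule teqI) (simp add: tsum_tmult tsum_tscale mult_scaleC_left)

lemma teq_tmult_scale2: "teq (tmult x (tscale c y)) (tscale c (tmult x y))"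
  by (rule teqI) (simp add: tsum_tmult tsum_tscale mult_scaleC_right)

lemma teq_commute: "teq (x @ y) (y @ x)"
  by (rule teqI) (simp add: add.commute)

lemma teq_star_mult: "teq (tstar (tmult x y)) (tmult (tstar y) (tstar x))"
  by (rule teqI) (simp add: tsum_tmult tsum_tstar star_mult, rule tsum_swap)

lemma teq_star_scale: "teq (tstar (tscale c x)) (tscale (cnj c) (tstar x))"
  by (rule teqI) (simp add: tsum_tscale tsum_tstar star_scaleC)

lemma cbilinear_star: "cbilinear f \<Longrightarrow> cbilinear (\<lambda>a b. cnj (f (a\<^sup>\<star>) (b\<^sup>\<star>)))"
  by (auto simp: cbilinear_def star_add star_scaleC)

lemma teq_tstar: assumes "teq x y" shows "teq (tstar x) (tstar y)"
proof (rule teqI)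
  fix f :: "'a \<Rightarrow> 'b \<Rightarrow> complex" assume f: "cbilinear f"
  have "cnj (tsum f (tstar x)) = cnj (tsum f (tstar y))"
    using tsum_cong_bil[OF assms cbilinear_star[OF f]] by (simp add: tsum_tstar tsum_cnj)
  then show "tsum f (tstar x) = tsum f (tstar y)" by (simp only: complex_cnj_cancel_iff)
qed

definition ip :: "('a::cstar_algebra \<Rightarrow> complex) \<Rightarrow> ('b::cstar_algebra \<Rightarrow> complex) \<Rightarrow> ('a \<times> 'b) list \<Rightarrow> ('a \<times> 'b) list \<Rightarrow> complex"
  where "ip \<phi> \<psi> x y = tsum (\<lambda>a b. \<phi> a * \<psi> b) (tmult (tstar x) y)"

lemma pos_fun_cbilinear: "pos_fun \<phi> \<Longrightarrow> pos_fun \<psi> \<Longrightarrow> cbilinear (\<lambda>a b. \<phi> a * \<psi> b)"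
  by (auto simp: cbilinear_def pos_fun_lin algebra_simps)

lemma ip_eq: "ip \<phi> \<psi> x y = tsum (\<lambda>a b. tsum (\<lambda>c d. \<phi> (a\<^sup>\<star> * c) * \<psi> (b\<^sup>\<star> * d)) y) x"
  by (simp add: ip_def tsum_tmult tsum_tstar)

lemma ip_teq: "pos_fun \<phi> \<Longrightarrow> pos_fun \<psi> \<Longrightarrow> teq x x' \<Longrightarrow> teq y y' \<Longrightarrow> ip \<phi> \<psi> x y = ip \<phi> \<psi> x' y'"
  unfolding ip_def by (intro tsum_cong_bil teq_tmult teq_tstar pos_fun_cbilinear)

lemma ip_append: "ip \<phi> \<psi> (x @ x') y = ip \<phi> \<psi> x y + ip \<phi> \<psi> x' y"
  "ip \<phi> \<psi> x (y @ y') = ip \<phi> \<psi> x y + ip \<phi> \<psi> x y'"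
  by (auto simp: ip_eq tsum_add)

lemma ip_scale:
  assumes "pos_fun \<phi>" "pos_fun \<psi>"
  shows "ip \<phi> \<psi> x (tscale c y) = c * ip \<phi> \<psi> x y" "ip \<phi> \<psi> (tscale c x) y = cnj c * ip \<phi> \<psi> x y"
  by (auto simp: ip_eq tsum_tscale star_scaleC mult_scaleC_left mult_scaleC_right
      pos_fun_lin[OF assms(1)] mult.assoc tsum_left)

lemma ip_nonneg:
  assumes \<phi>: "pos_fun \<phi>" and \<psi>: "pos_fun \<psi>"
  shows "ip \<phi> \<psi> x x \<in> \<real>\<^sub>\<ge>\<^sub>0"
proof (induction x rule: length_induct)
  case (1 x)
  show ?case
  proof (cases x)
    case Nil
    then show ?thesis by (simp add: ip_def)
  next
    case (Cons p xs)
    obtain a0 b0 where x: "x = (a0, b0) # xs" using Cons by (cases p) auto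
    define m where "m = \<phi> (a0\<^sup>\<star> * a0)"
    have m: "m \<in> \<real>\<^sub>\<ge>\<^sub>0" using \<phi> by (simp add: m_def pos_fun_def)
    define \<alpha> where "\<alpha> a = \<phi> (a0\<^sup>\<star> * a) / m" for a
    define xs' where "xs' = map (\<lambda>(a, b). (a - \<alpha> a *\<^sub>C a0, b)) xs"
    define w where "w = b0 + tsum (\<lambda>a b. \<alpha> a *\<^sub>C b) xs"
    have orth: "\<phi> (a0\<^sup>\<star> * (a - \<alpha> a *\<^sub>C a0)) = 0" for a
    proof -
      have "\<phi> (a0\<^sup>\<star> * (a - \<alpha> a *\<^sub>C a0)) = \<phi> (a0\<^sup>\<star> * a) - \<alpha> a * m"
        using \<phi> by (simp add: right_diff_distrib mult_scaleC_right cbounded_linearD(5) pos_fun_def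
            m_def pos_fun_lin(2)[OF \<phi>])
      also have "\<dots> = 0"
      proof (cases "m = 0")
        case True
        then have "(cmod (\<phi> (a0\<^sup>\<star> * a)))\<^sup>2 \<le> 0" using pos_fun_cs(2)[OF \<phi>, of a0 a] by (simp add: m_def)
        then show ?thesis using True by simp
      qed (simp add: \<alpha>_def)
      finally show ?thesis .
    qed
    have orth': "\<phi> ((a - \<alpha> a *\<^sub>C a0)\<^sup>\<star> * a0) = 0" for a
      using pos_fun_cs(1)[OF \<phi>, of "a - \<alpha> a *\<^sub>C a0" a0] orth[of a] by simp
    have bil_xs: "tsum f xs = f a0 (tsum (\<lambda>a b. \<alpha> a *\<^sub>C b) xs) + tsum f xs'" if f: "cbilinear f" for f
    proof -
      have z: "f a 0 = 0" for a using cbilinearD(4)[OF f, of a 0 0] by simp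
      have s: "f a b = f a0 (\<alpha> a *\<^sub>C b) + f (a - \<alpha> a *\<^sub>C a0) b" for a b
        using cbilinearD(1)[OF f, of "\<alpha> a *\<^sub>C a0" "a - \<alpha> a *\<^sub>C a0" b]
        by (simp add: cbilinearD(3,4)[OF f])
      show ?thesis unfolding xs'_def
      proof (induction xs)
        case (Cons p xs)
        obtain a b where p: "p = (a, b)" by (cases p)
        show ?case using s[of a b] by (simp add: p Cons.IH cbilinearD(2)[OF f])
      qed (simp add: z)
    qed
    have "teq x ((a0, w) # xs')"
      by (rule teqI) (simp add: x bil_xs w_def cbilinearD(2))
    then have "ip \<phi> \<psi> x x = ip \<phi> \<psi> ([(a0, w)] @ xs') ([(a0, w)] @ xs')"
      using ip_teq[OF \<phi> \<psi>] by simp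
    also have "\<dots> = m * \<psi> (w\<^sup>\<star> * w) + ip \<phi> \<psi> [(a0, w)] xs' + ip \<phi> \<psi> xs' [(a0, w)] + ip \<phi> \<psi> xs' xs'"
      unfolding ip_append by (simp add: ip_eq m_def)
    also have "ip \<phi> \<psi> [(a0, w)] xs' = 0"
    proof -
      have "tsum (\<lambda>c d. \<phi> (a0\<^sup>\<star> * c) * \<psi> (w\<^sup>\<star> * d)) (map (\<lambda>(a, b). (a - \<alpha> a *\<^sub>C a0, b)) ys) = 0" for ys
        by (induction ys) (auto simp: orth)
      then show ?thesis by (simp add: ip_eq xs'_def)
    qed
    also have "ip \<phi> \<psi> xs' [(a0, w)] = 0"
    proof -
      have "tsum (\<lambda>a b. \<phi> (a\<^sup>\<star> * a0) * \<psi> (b\<^sup>\<star> * w)) (map (\<lambda>(a, b). (a - \<alpha> a *\<^sub>C a0, b)) ys) = 0" for ys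
        by (induction ys) (auto simp: orth')
      then show ?thesis by (simp add: ip_eq xs'_def)
    qed
    finally have e: "ip \<phi> \<psi> x x = m * \<psi> (w\<^sup>\<star> * w) + ip \<phi> \<psi> xs' xs'" by simp
    have "length xs' < length x" by (simp add: xs'_def x)
    then have "ip \<phi> \<psi> xs' xs' \<in> \<real>\<^sub>\<ge>\<^sub>0" using 1 by blast
    moreover have "\<psi> (w\<^sup>\<star> * w) \<in> \<real>\<^sub>\<ge>\<^sub>0" using \<psi> by (simp add: pos_fun_def)
    ultimately show ?thesis unfolding e using m by (intro nonneg_Reals_add_I nonneg_Reals_mult_I)
  qed
qed

lemma ip_cs:
  assumes \<phi>: "pos_fun \<phi>" and \<psi>: "pos_fun \<psi>"
  shows "ip \<phi> \<psi> y x = cnj (ip \<phi> \<psi> x y)"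
    "(cmod (ip \<phi> \<psi> x y))\<^sup>2 \<le> Re (ip \<phi> \<psi> x x) * Re (ip \<phi> \<psi> y y)"
proof -
  note pos = ip_nonneg[OF assms]
  have *: "complex_of_real (Re (ip \<phi> \<psi> x x)) + t * ip \<phi> \<psi> x y + cnj t * ip \<phi> \<psi> y x
     + complex_of_real ((cmod t)\<^sup>2 * Re (ip \<phi> \<psi> y y)) \<in> \<real>\<^sub>\<ge>\<^sub>0" for t
  proof -
    have "ip \<phi> \<psi> (x @ tscale t y) (x @ tscale t y) =
      ip \<phi> \<psi> x x + t * ip \<phi> \<psi> x y + cnj t * ip \<phi> \<psi> y x + (cnj t * t) * ip \<phi> \<psi> y y"
      by (simp add: ip_append ip_scale[OF assms] algebra_simps)
    moreover have "cnj t * t = complex_of_real ((cmod t)\<^sup>2)"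
      by (simp only: complex_norm_square mult.commute)
    ultimately show ?thesis
      using pos[of "x @ tscale t y"] nonneg_Reals_of_real(1)[OF pos[of x]] nonneg_Reals_of_real(1)[OF pos[of y]]
      by (metis of_real_mult)
  qed
  note q = quadratic_nonneg_cs[OF *, OF nonneg_Reals_of_real(2)[OF pos]]
  show "ip \<phi> \<psi> y x = cnj (ip \<phi> \<psi> x y)" by (rule q(1))
  show "(cmod (ip \<phi> \<psi> x y))\<^sup>2 \<le> Re (ip \<phi> \<psi> x x) * Re (ip \<phi> \<psi> y y)" by (rule q(3))
qed

lemma gns_norm_ip: "gns_norm \<phi> \<psi> x = sqrt (Re (ip \<phi> \<psi> x x))"
  by (simp add: gns_norm_def ip_def)

context
  fixes \<phi> :: "'a::cstar_algebra \<Rightarrow> complex" and \<psi> :: "'b::cstar_algebra \<Rightarrow> complex"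
  assumes \<phi>: "pos_fun \<phi>" and \<psi>: "pos_fun \<psi>"
begin

lemma gns_norm_nonneg [simp]: "0 \<le> gns_norm \<phi> \<psi> x"
  using nonneg_Reals_of_real(2)[OF ip_nonneg[OF \<phi> \<psi>]] by (simp add: gns_norm_ip)

lemma gns_norm_sq: "(gns_norm \<phi> \<psi> x)\<^sup>2 = Re (ip \<phi> \<psi> x x)"
  using nonneg_Reals_of_real(2)[OF ip_nonneg[OF \<phi> \<psi>]] by (simp add: gns_norm_ip)

lemma gns_norm_cs: "cmod (ip \<phi> \<psi> x y) \<le> gns_norm \<phi> \<psi> x * gns_norm \<phi> \<psi> y"
proof (rule power2_le_imp_le)
  show "(cmod (ip \<phi> \<psi> x y))\<^sup>2 \<le> (gns_norm \<phi> \<psi> x * gns_norm \<phi> \<psi> y)\<^sup>2"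
    using ip_cs(2)[OF \<phi> \<psi>] by (simp add: power_mult_distrib gns_norm_sq)
qed simp

lemma gns_norm_teq: "teq x y \<Longrightarrow> gns_norm \<phi> \<psi> x = gns_norm \<phi> \<psi> y"
  by (simp add: gns_norm_ip ip_teq[OF \<phi> \<psi>, of x y x y])

lemma gns_norm_scale: "gns_norm \<phi> \<psi> (tscale c x) = cmod c * gns_norm \<phi> \<psi> x"
proof -
  have "ip \<phi> \<psi> (tscale c x) (tscale c x) = complex_of_real ((cmod c)\<^sup>2) * ip \<phi> \<psi> x x"
    unfolding ip_scale[OF \<phi> \<psi>] complex_norm_square by (simp add: mult_ac)
  then show ?thesis by (simp add: gns_norm_ip real_sqrt_mult)
qed

lemma gns_norm_append: "gns_norm \<phi> \<psi> (x @ y) \<le> gns_norm \<phi> \<psi> x + gns_norm \<phi> \<psi> y"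
proof (rule power2_le_imp_le)
  have "(gns_norm \<phi> \<psi> (x @ y))\<^sup>2 = (gns_norm \<phi> \<psi> x)\<^sup>2 + (gns_norm \<phi> \<psi> y)\<^sup>2 + 2 * Re (ip \<phi> \<psi> x y)"
    using ip_cs(1)[OF \<phi> \<psi>, of y x] by (simp add: gns_norm_sq ip_append)
  also have "\<dots> \<le> (gns_norm \<phi> \<psi> x)\<^sup>2 + (gns_norm \<phi> \<psi> y)\<^sup>2 + 2 * (gns_norm \<phi> \<psi> x * gns_norm \<phi> \<psi> y)"
    using gns_norm_cs[of x y] complex_Re_le_cmod[of "ip \<phi> \<psi> x y"] by linarith
  finally show "(gns_norm \<phi> \<psi> (x @ y))\<^sup>2 \<le> (gns_norm \<phi> \<psi> x + gns_norm \<phi> \<psi> y)\<^sup>2"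
    by (simp add: power2_sum mult.assoc)
qed simp

lemma ip_adj: "ip \<phi> \<psi> (tmult x y) z = ip \<phi> \<psi> y (tmult (tstar x) z)"
proof -
  have "teq (tmult (tstar (tmult x y)) z) (tmult (tstar y) (tmult (tstar x) z))"
    by (rule teq_trans[OF teq_tmult[OF teq_star_mult teq_refl] teq_tmult_assoc])
  then show ?thesis unfolding ip_def by (rule tsum_cong_bil[OF _ pos_fun_cbilinear[OF \<phi> \<psi>]])
qed

lemma gns_norm_single1: "gns_norm \<phi> \<psi> (tmult [(a, 1)] y) \<le> norm a * gns_norm \<phi> \<psi> y"
proof -
  define \<theta> where "\<theta> c = ip \<phi> \<psi> y (tmult [(c, 1)] y)" for c
  have e: "\<theta> c = tsum (\<lambda>a b. tsum (\<lambda>c' d. \<phi> (a\<^sup>\<star> * (c * c')) * \<psi> (b\<^sup>\<star> * d)) y) y" for c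
    by (simp add: \<theta>_def ip_eq tsum_tmult_single)
  have bl: "bounded_linear \<phi>" using \<phi> by (simp add: pos_fun_def cbounded_linear_def)
  have bl1: "bounded_linear (\<lambda>c. \<phi> (a * (c * b)) * k)" for a b k
    by (intro bounded_linear_mult_const bounded_linear_compose[OF bl] bounded_linear_const_mult
        bounded_linear_mult_left)
  have blsum: "bounded_linear (\<lambda>c. tsum (\<lambda>a b. f a b c) z)" if "\<And>a b. bounded_linear (f a b)" 
    for f :: "'a \<Rightarrow> 'b \<Rightarrow> 'a \<Rightarrow> complex" and z
    by (induction z) (auto intro!: bounded_linear_add[OF that])
  have "pos_fun \<theta>"
    unfolding pos_fun_def cbounded_linear_def
  proof (intro conjI allI)
    show "bounded_linear \<theta>" unfolding e[abs_def] by (intro blsum bl1)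
    show "\<theta> (k *\<^sub>C c) = k *\<^sub>C \<theta> c" for k c
      unfolding e by (simp add: mult_scaleC_left mult_scaleC_right pos_fun_lin[OF \<phi>] mult.assoc tsum_left
          scaleC_complex_def)
    show "\<theta> (c\<^sup>\<star> * c) \<in> \<real>\<^sub>\<ge>\<^sub>0" for c
    proof -
      have "\<theta> (c\<^sup>\<star> * c) = ip \<phi> \<psi> (tmult [(c, 1)] y) (tmult [(c, 1)] y)"
        unfolding ip_adj by (simp add: \<theta>_def ip_eq tsum_tmult_single mult.assoc)
      then show ?thesis using ip_nonneg[OF \<phi> \<psi>] by simp
    qed
  qed
  have "(gns_norm \<phi> \<psi> (tmult [(a, 1)] y))\<^sup>2 = Re (\<theta> (a\<^sup>\<star> * a))"
    unfolding gns_norm_sq ip_adj by (simp add: \<theta>_def ip_eq tsum_tmult_single mult.assoc)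
  also have "\<dots> \<le> cmod (\<theta> (a\<^sup>\<star> * a))" by (rule complex_Re_le_cmod)
  also have "\<dots> \<le> Re (\<theta> 1) * norm (a\<^sup>\<star> * a)"
    by (rule pos_fun_bound[OF \<open>pos_fun \<theta>\<close>]) (simp add: star_mult star_star)
  also have "Re (\<theta> 1) = (gns_norm \<phi> \<psi> y)\<^sup>2"
    unfolding gns_norm_sq by (simp add: \<theta>_def ip_eq tsum_tmult_single)
  finally have "(gns_norm \<phi> \<psi> (tmult [(a, 1)] y))\<^sup>2 \<le> (norm a * gns_norm \<phi> \<psi> y)\<^sup>2"
    by (simp add: cstar_identity power_mult_distrib mult.commute)
  then show ?thesis by (rule power2_le_imp_le) simp
qed

end

lemma ip_swap: "ip \<psi> \<phi> (map prod.swap x) (map prod.swap y) = ip \<phi> \<psi> x y"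
proof -
  have s: "tsum f (map prod.swap z) = tsum (\<lambda>a b. f b a) z" for f :: "'a \<Rightarrow> 'b \<Rightarrow> complex" and z
    by (induction z) auto
  show ?thesis by (simp add: ip_eq s mult.commute)
qed

lemma tmult_swap: "tmult (map prod.swap x) (map prod.swap y) = map prod.swap (tmult x y)"
proof (induction x)
  case (Cons p x)
  obtain a b where p: "p = (a, b)" by (cases p)
  have "tmult [(b, a)] (map prod.swap y) = map prod.swap (tmult [(a, b)] y)"
    by (induction y) auto
  then show ?case using tmult_Cons[of a b x y] tmult_Cons[of b a "map prod.swap x" "map prod.swap y"]
    by (simp add: p Cons.IH)
qed simp

lemma gns_norm_single:
  assumes \<phi>: "pos_fun \<phi>" and \<psi>: "pos_fun \<psi>"
  shows "gns_norm \<phi> \<psi> (tmult [(a, b)] y) \<le> norm a * norm b * gns_norm \<phi> \<psi> y"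
proof -
  have sw: "gns_norm \<psi> \<phi> (map prod.swap z) = gns_norm \<phi> \<psi> z" for z
    by (simp add: gns_norm_ip ip_swap)
  have 2: "gns_norm \<phi> \<psi> (tmult [(1, b)] y) \<le> norm b * gns_norm \<phi> \<psi> y"
    using gns_norm_single1[OF \<psi> \<phi>, of b "map prod.swap y"] tmult_swap[of "[(1, b)]" y]
    by (simp add: sw)
  have "tmult [(a, b)] y = tmult [(a, 1)] (tmult [(1, b)] y)"
    by (induction y) auto
  then have "gns_norm \<phi> \<psi> (tmult [(a, b)] y) \<le> norm a * gns_norm \<phi> \<psi> (tmult [(1, b)] y)"
    using gns_norm_single1[OF \<phi> \<psi>] by simp
  also have "\<dots> \<le> norm a * (norm b * gns_norm \<phi> \<psi> y)"
    by (intro mult_left_mono 2) simp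
  finally show ?thesis by (simp add: mult.assoc)
qed

lemma gns_norm_tmult_bound:
  assumes "pos_fun \<phi>" "pos_fun \<psi>"
  shows "gns_norm \<phi> \<psi> (tmult x y) \<le> tsum (\<lambda>a b. norm a * norm b) x * gns_norm \<phi> \<psi> y"
proof (induction x)
  case Nil
  then show ?case by (simp add: gns_norm_def)
next
  case (Cons p x)
  obtain a b where p: "p = (a, b)" by (cases p)
  have "gns_norm \<phi> \<psi> (tmult (p # x) y) \<le> gns_norm \<phi> \<psi> (tmult [(a, b)] y) + gns_norm \<phi> \<psi> (tmult x y)"
    unfolding p by (subst tmult_Cons) (rule gns_norm_append[OF assms])
  then show ?case using Cons gns_norm_single[OF assms, of a b y] by (simp add: p algebra_simps)
qed


lemma gns_norm_Nil [simp]: "gns_norm \<phi> \<psi> [] = 0"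
  by (simp add: gns_norm_def)

lemma tsum_norm_nonneg: "0 \<le> tsum (\<lambda>a b. norm a * norm b) x"
  by (induction x) auto

lemma spatial_bdd: "bdd_above (insert 0 {gns_norm \<phi> \<psi> (tmult x y) | \<phi> \<psi> y.
     state \<phi> \<and> state \<psi> \<and> gns_norm \<phi> \<psi> y \<le> 1})"
proof (rule bdd_aboveI[where M = "tsum (\<lambda>a b. norm a * norm b) x"], clarsimp, elim disjE exE conjE)
  fix r \<phi> \<psi> y assume *: "r = gns_norm \<phi> \<psi> (tmult x y)" "state \<phi>" "state \<psi>" "gns_norm \<phi> \<psi> y \<le> 1"
  have "r \<le> tsum (\<lambda>a b. norm a * norm b) x * gns_norm \<phi> \<psi> y"
    unfolding * using * by (intro gns_norm_tmult_bound state_pos_fun)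
  also have "\<dots> \<le> tsum (\<lambda>a b. norm a * norm b) x"
    using * tsum_norm_nonneg by (intro mult_left_le)
  finally show "r \<le> tsum (\<lambda>a b. norm a * norm b) x" .
qed (simp add: tsum_norm_nonneg)

lemma spatial_norm_nonneg [simp]: "0 \<le> spatial_norm x"
  unfolding spatial_norm_def by (rule cSup_upper[OF _ spatial_bdd]) simp

lemma spatial_norm_upper:
  assumes "state \<phi>" "state \<psi>"
  shows "gns_norm \<phi> \<psi> (tmult x y) \<le> spatial_norm x * gns_norm \<phi> \<psi> y"
proof -
  note p = state_pos_fun[OF assms(1)] state_pos_fun[OF assms(2)]
  have *: "gns_norm \<phi> \<psi> (tmult x z) \<le> spatial_norm x" if "gns_norm \<phi> \<psi> z \<le> 1" for z
    unfolding spatial_norm_def using that assms by (intro cSup_upper[OF _ spatial_bdd]) blast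
  show ?thesis
  proof (cases "gns_norm \<phi> \<psi> y = 0")
    case True
    then show ?thesis using gns_norm_tmult_bound[OF p, of x y] by simp
  next
    case False
    define k where "k = gns_norm \<phi> \<psi> y"
    have k: "k > 0" using False gns_norm_nonneg[OF p, of y] by (simp add: k_def)
    define c where "c = complex_of_real (1 / k)"
    have c: "cmod c = 1 / k" using k by (simp add: c_def norm_divide)
    have "gns_norm \<phi> \<psi> (tmult x (tscale c y)) \<le> spatial_norm x"
      using k by (intro *) (simp add: gns_norm_scale[OF p] c flip: k_def)
    then show ?thesis
      using k by (simp add: gns_norm_teq[OF p teq_tmult_scale2] gns_norm_scale[OF p] c field_simps
          flip: k_def)
  qed
qed

lemma spatial_norm_least:
  assumes "c \<ge> 0"
    "\<And>\<phi> \<psi> y. state \<phi> \<Longrightarrow> state \<psi> \<Longrightarrow> pos_fun \<phi> \<Longrightarrow> pos_fun \<psi> \<Longrightarrow> gns_norm \<phi> \<psi> (tmult x y) \<le> c * gns_norm \<phi> \<psi> y"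
  shows "spatial_norm x \<le> c"
  unfolding spatial_norm_def
proof (rule cSup_least, simp, clarsimp, elim disjE exE conjE)
  fix r \<phi> \<psi> y assume *: "r = gns_norm \<phi> \<psi> (tmult x y)" "state \<phi>" "state \<psi>" "gns_norm \<phi> \<psi> y \<le> 1"
  have "r \<le> c * gns_norm \<phi> \<psi> y" unfolding * using * by (intro assms state_pos_fun)
  also have "\<dots> \<le> c" using * assms(1) by (intro mult_left_le)
  finally show "r \<le> c" .
qed (simp add: assms)

lemma spatial_norm_teq: assumes "teq x y" shows "spatial_norm x = spatial_norm y"
proof -
  have "spatial_norm x \<le> spatial_norm y" if t: "teq x y" for x y :: "('a::cstar_algebra \<times> 'b::cstar_algebra) list"
  proof (rule spatial_norm_least)
    fix \<phi> \<psi> z assume s: "state (\<phi> :: 'a \<Rightarrow> complex)" "state (\<psi> :: 'b \<Rightarrow> complex)" and p: "pos_fun \<phi>" "pos_fun \<psi>"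
    show "gns_norm \<phi> \<psi> (tmult x z) \<le> spatial_norm y * gns_norm \<phi> \<psi> z"
      using spatial_norm_upper[OF s, of y z] gns_norm_teq[OF p teq_tmult[OF t teq_refl], of z] by simp
  qed simp
  from this[OF assms] this[OF teq_sym[OF assms]] show ?thesis by simp
qed

lemma spatial_norm_append: "spatial_norm (x @ y) \<le> spatial_norm x + spatial_norm y"
proof (rule spatial_norm_least)
  fix \<phi> \<psi> z assume s: "state (\<phi> :: 'a \<Rightarrow> complex)" "state (\<psi> :: 'b \<Rightarrow> complex)" and p: "pos_fun \<phi>" "pos_fun \<psi>"
  show "gns_norm \<phi> \<psi> (tmult (x @ y) z) \<le> (spatial_norm x + spatial_norm y) * gns_norm \<phi> \<psi> z"
    using gns_norm_append[OF p, of "tmult x z" "tmult y z"] spatial_norm_upper[OF s, of x z]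
      spatial_norm_upper[OF s, of y z] by (simp add: distrib_right)
qed simp

lemma spatial_norm_scale: "spatial_norm (tscale c x) = cmod c * spatial_norm x"
proof -
  have le: "spatial_norm (tscale c x) \<le> cmod c * spatial_norm x" for c and x :: "('a \<times> 'b) list"
  proof (rule spatial_norm_least)
    fix \<phi> \<psi> z assume s: "state (\<phi> :: 'a \<Rightarrow> complex)" "state (\<psi> :: 'b \<Rightarrow> complex)" and p: "pos_fun \<phi>" "pos_fun \<psi>"
    show "gns_norm \<phi> \<psi> (tmult (tscale c x) z) \<le> cmod c * spatial_norm x * gns_norm \<phi> \<psi> z"
      using mult_left_mono[OF spatial_norm_upper[OF s, of x z], of "cmod c"]
      by (simp add: gns_norm_teq[OF p teq_tmult_scale1] gns_norm_scale[OF p] mult.assoc)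
  qed simp
  show ?thesis
  proof (cases "c = 0")
    case True
    then show ?thesis using le[of c x] by (simp add: antisym)
  next
    case False
    have "teq (tscale (1 / c) (tscale c x)) x"
      using False by (intro teqI) (simp add: tsum_tscale_bil)
    then have "spatial_norm x \<le> cmod (1 / c) * spatial_norm (tscale c x)"
      using le[of "1 / c" "tscale c x"] spatial_norm_teq by metis
    then show ?thesis using False le[of c x] by (simp add: norm_divide field_simps)
  qed
qed

lemma spatial_norm_mult: "spatial_norm (tmult x y) \<le> spatial_norm x * spatial_norm y"
proof (rule spatial_norm_least)
  fix \<phi> \<psi> z assume s: "state (\<phi> :: 'a \<Rightarrow> complex)" "state (\<psi> :: 'b \<Rightarrow> complex)" and p: "pos_fun \<phi>" "pos_fun \<psi>"
  have "gns_norm \<phi> \<psi> (tmult (tmult x y) z) = gns_norm \<phi> \<psi> (tmult x (tmult y z))"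
    by (rule gns_norm_teq[OF p teq_tmult_assoc])
  also have "\<dots> \<le> spatial_norm x * gns_norm \<phi> \<psi> (tmult y z)"
    by (rule spatial_norm_upper[OF s])
  also have "\<dots> \<le> spatial_norm x * (spatial_norm y * gns_norm \<phi> \<psi> z)"
    by (intro mult_left_mono spatial_norm_upper[OF s]) simp
  finally show "gns_norm \<phi> \<psi> (tmult (tmult x y) z) \<le> spatial_norm x * spatial_norm y * gns_norm \<phi> \<psi> z"
    by (simp add: mult.assoc)
qed simp

lemma spatial_norm_single: "spatial_norm [(a, b)] \<le> norm a * norm b"
  by (rule spatial_norm_least) (auto intro: gns_norm_single)

lemma spatial_norm_star_le: "spatial_norm (tstar x) \<le> spatial_norm x"
proof (rule spatial_norm_least)
  fix \<phi> \<psi> z assume s: "state (\<phi> :: 'a \<Rightarrow> complex)" "state (\<psi> :: 'b \<Rightarrow> complex)" and p: "pos_fun \<phi>" "pos_fun \<psi>"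
  let ?g = "gns_norm \<phi> \<psi>"
  have "(?g (tmult (tstar x) z))\<^sup>2 \<le> cmod (ip \<phi> \<psi> z (tmult x (tmult (tstar x) z)))"
    unfolding gns_norm_sq[OF p] ip_adj[OF p] by (simp add: complex_Re_le_cmod)
  also have "\<dots> \<le> ?g z * ?g (tmult x (tmult (tstar x) z))" by (rule gns_norm_cs[OF p])
  also have "\<dots> \<le> ?g z * (spatial_norm x * ?g (tmult (tstar x) z))"
    by (intro mult_left_mono spatial_norm_upper[OF s] gns_norm_nonneg[OF p])
  finally have "?g (tmult (tstar x) z) * ?g (tmult (tstar x) z) \<le> (spatial_norm x * ?g z) * ?g (tmult (tstar x) z)"
    by (simp add: power2_eq_square mult_ac)
  then show "?g (tmult (tstar x) z) \<le> spatial_norm x * ?g z"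
    using gns_norm_nonneg[OF p, of "tmult (tstar x) z"] gns_norm_nonneg[OF p, of z]
    by (cases "?g (tmult (tstar x) z) = 0") auto
qed simp

lemma spatial_norm_star: "spatial_norm (tstar x) = spatial_norm x"
  using spatial_norm_star_le[of x] spatial_norm_star_le[of "tstar x"] by simp

lemma spatial_norm_cstar: "spatial_norm (tmult (tstar x) x) = (spatial_norm x)\<^sup>2"
proof (rule antisym)
  show "spatial_norm (tmult (tstar x) x) \<le> (spatial_norm x)\<^sup>2"
    using spatial_norm_mult[of "tstar x" x] by (simp add: spatial_norm_star power2_eq_square)
  have "spatial_norm x \<le> sqrt (spatial_norm (tmult (tstar x) x))"
  proof (rule spatial_norm_least)
    fix \<phi> \<psi> z assume s: "state (\<phi> :: 'a \<Rightarrow> complex)" "state (\<psi> :: 'b \<Rightarrow> complex)" and p: "pos_fun \<phi>" "pos_fun \<psi>"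
    let ?g = "gns_norm \<phi> \<psi>"
    have "(?g (tmult x z))\<^sup>2 \<le> cmod (ip \<phi> \<psi> z (tmult (tstar x) (tmult x z)))"
      unfolding gns_norm_sq[OF p] ip_adj[OF p] by (simp add: complex_Re_le_cmod)
    also have "\<dots> \<le> ?g z * ?g (tmult (tstar x) (tmult x z))" by (rule gns_norm_cs[OF p])
    also have "?g (tmult (tstar x) (tmult x z)) = ?g (tmult (tmult (tstar x) x) z)"
      by (rule gns_norm_teq[OF p teq_sym[OF teq_tmult_assoc]])
    also have "?g z * \<dots> \<le> ?g z * (spatial_norm (tmult (tstar x) x) * ?g z)"
      by (intro mult_left_mono spatial_norm_upper[OF s] gns_norm_nonneg[OF p])
    also have "\<dots> = (sqrt (spatial_norm (tmult (tstar x) x)) * ?g z)\<^sup>2"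
      by (simp add: power_mult_distrib power2_eq_square mult_ac)
    finally show "?g (tmult x z) \<le> sqrt (spatial_norm (tmult (tstar x) x)) * ?g z"
      by (rule power2_le_imp_le) (simp add: gns_norm_nonneg[OF p])
  qed simp
  then show "(spatial_norm x)\<^sup>2 \<le> spatial_norm (tmult (tstar x) x)"
    by (metis real_le_rsqrt real_sqrt_ge_0_iff real_sqrt_le_iff real_sqrt_pow2 power_mono spatial_norm_nonneg)
qed

definition tminus :: "('a::pre_cstar_algebra \<times> 'b::pre_cstar_algebra) list \<Rightarrow> ('a \<times> 'b) list \<Rightarrow> ('a \<times> 'b) list" where
  "tminus x y = x @ tscale (- 1) y"

lemma tsum_tminus: "cbilinear f \<Longrightarrow> tsum f (tminus x y) = tsum f x - tsum f y"
  by (simp add: tminus_def tsum_tscale_bil)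

definition spatial_eq :: "('a::cstar_algebra \<times> 'b::cstar_algebra) list \<Rightarrow> ('a \<times> 'b) list \<Rightarrow> bool" where
  "spatial_eq x y \<longleftrightarrow> spatial_norm (tminus x y) = 0"

lemma spatial_norm_Nil [simp]: "spatial_norm [] = 0"
  using spatial_norm_scale[of 0 "[]"] by simp

lemma spatial_norm_tscale1: "spatial_norm (tscale (-1) x) = spatial_norm x"
  by (simp add: spatial_norm_scale)

lemma teq_spatial_eq: assumes "teq x y" shows "spatial_eq x y"
proof -
  have "teq (tminus x y) []"
    using assms by (intro teqI) (simp add: tsum_tminus teq_def)
  then show ?thesis using spatial_norm_teq[of "tminus x y" "[]"] by (simp add: spatial_eq_def)
qed

lemma spatial_norm_tri:
  "spatial_norm (tminus x z) \<le> spatial_norm (tminus x y) + spatial_norm (tminus y z)"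
proof -
  have "teq (tminus x z) (tminus x y @ tminus y z)" by (rule teqI) (simp add: tsum_tminus)
  then show ?thesis using spatial_norm_append spatial_norm_teq by metis
qed

lemma spatial_norm_minus_commute: "spatial_norm (tminus x y) = spatial_norm (tminus y x)"
proof -
  have "teq (tminus x y) (tscale (-1) (tminus y x))" by (rule teqI) (simp add: tsum_tminus tsum_tscale_bil)
  then show ?thesis using spatial_norm_teq spatial_norm_tscale1 by metis
qed

lemma spatial_eq_equivp: "equivp spatial_eq"
proof (rule equivpI)
  show "reflp spatial_eq" by (rule reflpI) (simp add: teq_spatial_eq)
  show "symp spatial_eq" by (rule sympI) (simp add: spatial_eq_def spatial_norm_minus_commute)
  show "transp spatial_eq"
  proof (rule transpI)
    fix x y z assume "spatial_eq x y" "spatial_eq y z"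
    then show "spatial_eq x z"
      using spatial_norm_tri[of x z y] spatial_norm_nonneg[of "tminus x z"] unfolding spatial_eq_def by linarith
  qed
qed

lemma spatial_eq_le:
  assumes "spatial_norm (tminus x y) \<le> K" "K = 0" shows "spatial_eq x y"
  using assms spatial_norm_nonneg[of "tminus x y"] unfolding spatial_eq_def by linarith

lemma spatial_eq_append: 
  assumes "spatial_eq x y" "spatial_eq x' y'" shows "spatial_eq (x @ x') (y @ y')"
proof (rule spatial_eq_le)
  have "teq (tminus (x @ x') (y @ y')) (tminus x y @ tminus x' y')" by (rule teqI) (simp add: tsum_tminus)
  then show "spatial_norm (tminus (x @ x') (y @ y')) \<le> spatial_norm (tminus x y) + spatial_norm (tminus x' y')"
    using spatial_norm_append spatial_norm_teq by metis
qed (use assms in \<open>simp add: spatial_eq_def\<close>)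

lemma spatial_eq_scale: assumes "spatial_eq x y" shows "spatial_eq (tscale c x) (tscale c y)"
proof (rule spatial_eq_le)
  have "teq (tminus (tscale c x) (tscale c y)) (tscale c (tminus x y))"
    by (rule teqI) (simp add: tsum_tminus tsum_tscale_bil algebra_simps)
  then show "spatial_norm (tminus (tscale c x) (tscale c y)) \<le> cmod c * spatial_norm (tminus x y)"
    using spatial_norm_scale spatial_norm_teq by (metis order_refl)
qed (use assms in \<open>simp add: spatial_eq_def\<close>)

lemma spatial_eq_minus:
  "spatial_eq x y \<Longrightarrow> spatial_eq x' y' \<Longrightarrow> spatial_eq (tminus x x') (tminus y y')"
  unfolding tminus_def by (intro spatial_eq_append spatial_eq_scale)

lemma tsum_tmult_tminus1: "cbilinear f \<Longrightarrow> tsum f (tmult (tminus x y) z) = tsum f (tmult x z) - tsum f (tmult y z)"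
  and tsum_tmult_tminus2: "cbilinear f \<Longrightarrow> tsum f (tmult z (tminus x y)) = tsum f (tmult z x) - tsum f (tmult z y)"
  using tsum_cong_bil[OF teq_tmult_scale1, of f "-1"] tsum_cong_bil[OF teq_tmult_scale2, of f z "-1"]
    tsum_cong_bil[OF teq_tmult_append, of f z]
  by (auto simp: tminus_def tsum_tscale_bil)

lemma spatial_eq_mult:
  assumes "spatial_eq x y" "spatial_eq x' y'" shows "spatial_eq (tmult x x') (tmult y y')"
proof (rule spatial_eq_le)
  have "teq (tminus (tmult x x') (tmult y y')) (tmult (tminus x y) x' @ tmult y (tminus x' y'))"
    by (rule teqI) (simp add: tsum_tminus tsum_tmult_tminus1 tsum_tmult_tminus2)
  then have "spatial_norm (tminus (tmult x x') (tmult y y')) \<le>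
      spatial_norm (tmult (tminus x y) x') + spatial_norm (tmult y (tminus x' y'))"
    using spatial_norm_append spatial_norm_teq by metis
  also have "\<dots> \<le> spatial_norm (tminus x y) * spatial_norm x' + spatial_norm y * spatial_norm (tminus x' y')"
    by (intro add_mono spatial_norm_mult)
  finally show "spatial_norm (tminus (tmult x x') (tmult y y')) \<le>
    spatial_norm (tminus x y) * spatial_norm x' + spatial_norm y * spatial_norm (tminus x' y')" .
qed (use assms in \<open>simp add: spatial_eq_def\<close>)

lemma spatial_eq_star: assumes "spatial_eq x y" shows "spatial_eq (tstar x) (tstar y)"
proof (rule spatial_eq_le)
  have "teq (tminus (tstar x) (tstar y)) (tstar (tminus x y))"
    using tsum_cong_bil[OF teq_star_scale, of _ "-1" y]
    by (intro teqI) (simp add: tminus_def tsum_tscale_bil)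
  then show "spatial_norm (tminus (tstar x) (tstar y)) \<le> spatial_norm (tminus x y)"
    using spatial_norm_star spatial_norm_teq by (metis order_refl)
qed (use assms in \<open>simp add: spatial_eq_def\<close>)

lemma spatial_eq_norm: assumes "spatial_eq x y" shows "spatial_norm x = spatial_norm y"
proof -
  have "spatial_norm x \<le> spatial_norm y + spatial_norm (tminus x y)" for x y :: "('a \<times> 'b) list"
  proof -
    have "teq x (y @ tminus x y)" by (rule teqI) (simp add: tsum_tminus)
    then show ?thesis using spatial_norm_append spatial_norm_teq by metis
  qed
  from this[of x y] this[of y x] show ?thesis
    using assms spatial_norm_minus_commute[of x y] by (simp add: spatial_eq_def)
qed

text \<open>
  Formal sums at spatial distance 0 are identified. The spatial norm is a norm on the algebraic
  tensor product, so this quotient is the algebraic tensor product with the spatial norm.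
\<close>

quotient_type (overloaded) ('a, 'b) alg_tensor = "('a::cstar_algebra \<times> 'b::cstar_algebra) list" / spatial_eq
  by (rule spatial_eq_equivp)

instantiation alg_tensor :: (cstar_algebra, cstar_algebra) pre_cstar_algebra
begin

lift_definition zero_alg_tensor :: "('a, 'b) alg_tensor" is "[]" .
lift_definition one_alg_tensor :: "('a, 'b) alg_tensor" is "[(1, 1)]" .
lift_definition plus_alg_tensor :: "('a, 'b) alg_tensor \<Rightarrow> ('a, 'b) alg_tensor \<Rightarrow> ('a, 'b) alg_tensor"
  is "(@)" by (rule spatial_eq_append)
lift_definition minus_alg_tensor :: "('a, 'b) alg_tensor \<Rightarrow> ('a, 'b) alg_tensor \<Rightarrow> ('a, 'b) alg_tensor"
  is tminus by (rule spatial_eq_minus)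
lift_definition uminus_alg_tensor :: "('a, 'b) alg_tensor \<Rightarrow> ('a, 'b) alg_tensor"
  is "tscale (-1)" by (rule spatial_eq_scale)
lift_definition times_alg_tensor :: "('a, 'b) alg_tensor \<Rightarrow> ('a, 'b) alg_tensor \<Rightarrow> ('a, 'b) alg_tensor"
  is tmult by (rule spatial_eq_mult)
lift_definition scaleC_alg_tensor :: "complex \<Rightarrow> ('a, 'b) alg_tensor \<Rightarrow> ('a, 'b) alg_tensor"
  is tscale by (rule spatial_eq_scale)
lift_definition inv_star_alg_tensor :: "('a, 'b) alg_tensor \<Rightarrow> ('a, 'b) alg_tensor"
  is tstar by (rule spatial_eq_star)
lift_definition norm_alg_tensor :: "('a, 'b) alg_tensor \<Rightarrow> real"
  is spatial_norm by (rule spatial_eq_norm)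
definition scaleR_alg_tensor :: "real \<Rightarrow> ('a, 'b) alg_tensor \<Rightarrow> ('a, 'b) alg_tensor"
  where "scaleR_alg_tensor r x = complex_of_real r *\<^sub>C x"
definition sgn_alg_tensor :: "('a, 'b) alg_tensor \<Rightarrow> ('a, 'b) alg_tensor"
  where "sgn_alg_tensor x = inverse (norm x) *\<^sub>R x"
definition dist_alg_tensor :: "('a, 'b) alg_tensor \<Rightarrow> ('a, 'b) alg_tensor \<Rightarrow> real"
  where "dist_alg_tensor x y = norm (x - y)"
definition uniformity_alg_tensor :: "(('a, 'b) alg_tensor \<times> ('a, 'b) alg_tensor) filter"
  where "uniformity_alg_tensor = (INF e\<in>{0<..}. principal {(x, y). dist x y < e})"
definition open_alg_tensor :: "('a, 'b) alg_tensor set \<Rightarrow> bool"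
  where "open_alg_tensor U \<longleftrightarrow> (\<forall>x\<in>U. \<forall>\<^sub>F (x', y) in uniformity. x' = x \<longrightarrow> y \<in> U)"

instance
proof
  fix x y z :: "('a, 'b) alg_tensor" and c d :: complex and a b :: real
  show "x + y + z = x + (y + z)" by transfer (simp add: teq_spatial_eq)
  show "x + y = y + x" by transfer (rule teq_spatial_eq[OF teq_commute])
  show "0 + x = x" by transfer (simp add: teq_spatial_eq)
  show "- x + x = 0" by transfer (rule teq_spatial_eq, rule teqI, simp add: tsum_tscale_bil)
  show "x - y = x + - y" by transfer (simp add: tminus_def teq_spatial_eq)
  show add_right: "c *\<^sub>C (x + y) = c *\<^sub>C x + c *\<^sub>C y" for c by transfer (simp add: teq_spatial_eq)
  show add_left: "(c + d) *\<^sub>C x = c *\<^sub>C x + d *\<^sub>C x" for c d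
    by transfer (rule teq_spatial_eq, rule teqI, simp add: tsum_tscale_bil algebra_simps)
  show sc: "c *\<^sub>C d *\<^sub>C x = (c * d) *\<^sub>C x" for c d
    by transfer (rule teq_spatial_eq, rule teqI, simp add: tsum_tscale_bil algebra_simps)
  have sc1: "1 *\<^sub>C x = x"
    by transfer (rule teq_spatial_eq, rule teqI, simp add: tsum_tscale_bil)
  show "a *\<^sub>R (x + y) = a *\<^sub>R x + a *\<^sub>R y" by (simp add: scaleR_alg_tensor_def add_right)
  show "(a + b) *\<^sub>R x = a *\<^sub>R x + b *\<^sub>R x" by (simp add: scaleR_alg_tensor_def add_left)
  show "a *\<^sub>R b *\<^sub>R x = (a * b) *\<^sub>R x" by (simp add: scaleR_alg_tensor_def sc)
  show "1 *\<^sub>R x = x" by (simp add: scaleR_alg_tensor_def sc1)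
  show "a *\<^sub>R x = complex_of_real a *\<^sub>C x" by (rule scaleR_alg_tensor_def)
  show "x * y * z = x * (y * z)" by transfer (rule teq_spatial_eq[OF teq_tmult_assoc])
  show "(x + y) * z = x * z + y * z" by transfer (simp add: teq_spatial_eq)
  show "x * (y + z) = x * y + x * z" by transfer (rule teq_spatial_eq[OF teq_tmult_append])
  show m1: "(c *\<^sub>C x) * y = c *\<^sub>C (x * y)" for c by transfer (rule teq_spatial_eq[OF teq_tmult_scale1])
  show m2: "x * (c *\<^sub>C y) = c *\<^sub>C (x * y)" for c by transfer (rule teq_spatial_eq[OF teq_tmult_scale2])
  show "(a *\<^sub>R x) * y = a *\<^sub>R (x * y)" by (simp add: scaleR_alg_tensor_def m1)
  show "x * (a *\<^sub>R y) = a *\<^sub>R (x * y)" by (simp add: scaleR_alg_tensor_def m2)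
  show "1 * x = x" by transfer (rule teq_spatial_eq, rule teqI, simp add: tsum_tmult)
  show "x * 1 = x" by transfer (rule teq_spatial_eq, rule teqI, simp add: tsum_tmult)
  show nC: "norm (c *\<^sub>C x) = cmod c * norm x" for c by transfer (rule spatial_norm_scale)
  show "norm (a *\<^sub>R x) = \<bar>a\<bar> * norm x" by (simp add: scaleR_alg_tensor_def nC)
  show "(norm x = 0) = (x = 0)" 
  proof (transfer)
    fix x :: "('a \<times> 'b) list"
    have "tminus x [] = x" by (simp add: tminus_def)
    then show "(spatial_norm x = 0) = spatial_eq x []" by (simp add: spatial_eq_def)
  qed
  show "norm (x + y) \<le> norm x + norm y" by transfer (rule spatial_norm_append)
  show "norm (x * y) \<le> norm x * norm y" by transfer (rule spatial_norm_mult)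
  show "(x\<^sup>\<star>)\<^sup>\<star> = x" by transfer (simp add: teq_spatial_eq)
  show "(x + y)\<^sup>\<star> = x\<^sup>\<star> + y\<^sup>\<star>" by transfer (simp add: teq_spatial_eq)
  show "(c *\<^sub>C x)\<^sup>\<star> = cnj c *\<^sub>C x\<^sup>\<star>" by transfer (rule teq_spatial_eq[OF teq_star_scale])
  show "(x * y)\<^sup>\<star> = y\<^sup>\<star> * x\<^sup>\<star>" by transfer (rule teq_spatial_eq[OF teq_star_mult])
  show "norm (x\<^sup>\<star> * x) = (norm x)\<^sup>2" by transfer (rule spatial_norm_cstar)
qed (rule sgn_alg_tensor_def dist_alg_tensor_def uniformity_alg_tensor_def open_alg_tensor_def)+

end


lemma Cauchy_dominated:
  fixes X :: "nat \<Rightarrow> 'a::real_normed_vector" and Y :: "nat \<Rightarrow> 'b::real_normed_vector"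
    and Z :: "nat \<Rightarrow> 'c::real_normed_vector"
  assumes "Cauchy X" "Cauchy Y"
    and le: "\<And>m n. norm (Z m - Z n) \<le> K * norm (X m - X n) + L * norm (Y m - Y n)"
  shows "Cauchy Z"
proof (rule CauchyI)
  fix e :: real assume e: "0 < e"
  define M where "M = \<bar>K\<bar> + \<bar>L\<bar> + 1"
  have M: "M > 0" by (simp add: M_def)
  obtain N1 where N1: "\<And>m n. m \<ge> N1 \<Longrightarrow> n \<ge> N1 \<Longrightarrow> norm (X m - X n) < e / M"
    using CauchyD[OF assms(1), of "e / M"] e M by auto
  obtain N2 where N2: "\<And>m n. m \<ge> N2 \<Longrightarrow> n \<ge> N2 \<Longrightarrow> norm (Y m - Y n) < e / M"
    using CauchyD[OF assms(2), of "e / M"] e M by auto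
  have "norm (Z m - Z n) < e" if "m \<ge> max N1 N2" "n \<ge> max N1 N2" for m n
  proof -
    have "norm (Z m - Z n) \<le> \<bar>K\<bar> * norm (X m - X n) + \<bar>L\<bar> * norm (Y m - Y n)"
      using le[of m n] by (meson abs_ge_self add_mono mult_right_mono norm_ge_zero order_trans)
    also have "\<dots> \<le> \<bar>K\<bar> * (e / M) + \<bar>L\<bar> * (e / M)"
      using N1[of m n] N2[of m n] that by (intro add_mono mult_left_mono) auto
    also have "\<dots> = (\<bar>K\<bar> + \<bar>L\<bar>) * (e / M)" by (rule distrib_right[symmetric])
    also have "\<dots> < M * (e / M)" using e M by (intro mult_strict_right_mono) (auto simp: M_def)
    finally show ?thesis using M by simp
  qed
  then show "\<exists>N. \<forall>m\<ge>N. \<forall>n\<ge>N. norm (Z m - Z n) < e" by blast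
qed

lemma null_dominated:
  fixes X :: "nat \<Rightarrow> 'a::real_normed_vector" and Y :: "nat \<Rightarrow> 'b::real_normed_vector"
    and Z :: "nat \<Rightarrow> 'c::real_normed_vector"
  assumes "X \<longlonglongrightarrow> 0" "Y \<longlonglongrightarrow> 0"
    and le: "\<And>n. norm (Z n) \<le> K * norm (X n) + L * norm (Y n)"
  shows "Z \<longlonglongrightarrow> 0"
proof (rule Lim_null_comparison[OF always_eventually[rule_format, OF le]])
  show "(\<lambda>n. K * norm (X n) + L * norm (Y n)) \<longlonglongrightarrow> 0"
    using tendsto_add[OF tendsto_mult[OF tendsto_const[of K] tendsto_norm[OF assms(1)]]
        tendsto_mult[OF tendsto_const[of L] tendsto_norm[OF assms(2)]]] by simp
qed

definition cauchy_rel :: "(nat \<Rightarrow> 'a::pre_cstar_algebra) \<Rightarrow> (nat \<Rightarrow> 'a) \<Rightarrow> bool" where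
  "cauchy_rel X Y \<longleftrightarrow> Cauchy X \<and> Cauchy Y \<and> (\<lambda>n. X n - Y n) \<longlonglongrightarrow> 0"

lemma cauchy_relI:
  fixes X X' Y Y' Z Z' :: "nat \<Rightarrow> 'a::pre_cstar_algebra"
  assumes "cauchy_rel X X'" "cauchy_rel Y Y'"
    and "\<And>m n. norm (Z m - Z n) \<le> K * norm (X m - X n) + L * norm (Y m - Y n)"
    and "\<And>m n. norm (Z' m - Z' n) \<le> K * norm (X' m - X' n) + L * norm (Y' m - Y' n)"
    and "\<And>n. norm (Z n - Z' n) \<le> K * norm (X n - X' n) + L * norm (Y n - Y' n)"
  shows "cauchy_rel Z Z'"
  using assms unfolding cauchy_rel_def
  by (meson Cauchy_dominated null_dominated)

lemma cauchy_rel_const: "cauchy_rel (\<lambda>_. c) (\<lambda>_. c)"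
  by (simp add: cauchy_rel_def convergent_Cauchy convergent_const)

lemma cauchy_rel_refl: "Cauchy X \<Longrightarrow> cauchy_rel X X"
  by (simp add: cauchy_rel_def)

quotient_type (overloaded) 'a completion = "nat \<Rightarrow> 'a::pre_cstar_algebra" / partial: cauchy_rel
proof (rule part_equivpI)
  show "\<exists>X::nat \<Rightarrow> 'a. cauchy_rel X X" using cauchy_rel_const by blast
  show "symp (cauchy_rel :: (nat \<Rightarrow> 'a) \<Rightarrow> _)"
  proof (rule sympI)
    fix X Y :: "nat \<Rightarrow> 'a" assume "cauchy_rel X Y"
    then show "cauchy_rel Y X"
      unfolding cauchy_rel_def using tendsto_minus[of "\<lambda>n. X n - Y n" 0] by auto
  qed
  show "transp (cauchy_rel :: (nat \<Rightarrow> 'a) \<Rightarrow> _)"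
  proof (rule transpI)
    fix X Y Z :: "nat \<Rightarrow> 'a" assume "cauchy_rel X Y" "cauchy_rel Y Z"
    then show "cauchy_rel X Z"
      unfolding cauchy_rel_def using tendsto_add[of "\<lambda>n. X n - Y n" 0 _ "\<lambda>n. Y n - Z n" 0] by auto
  qed
qed

lemma cauchy_rel_add: 
  assumes "cauchy_rel X X'" "cauchy_rel Y Y'" shows "cauchy_rel (\<lambda>n. X n + Y n) (\<lambda>n. X' n + Y' n)"
proof -
  have "norm (a + b - (a' + b')) \<le> 1 * norm (a - a') + 1 * norm (b - b')" for a b a' b' :: 'a
    using norm_triangle_ineq[of "a - a'" "b - b'"] by (simp add: algebra_simps)
  then show ?thesis by (intro cauchy_relI[OF assms])
qed

lemma cauchy_rel_scale: 
  assumes "cauchy_rel X X'" shows "cauchy_rel (\<lambda>n. c *\<^sub>C X n) (\<lambda>n. c *\<^sub>C X' n)"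
proof -
  have "norm (c *\<^sub>C a - c *\<^sub>C a') \<le> cmod c * norm (a - a') + 0 * norm (a - a')" for a a' :: 'a
  proof -
    have "c *\<^sub>C (a - a') = c *\<^sub>C a - c *\<^sub>C a'"
      using scaleC_add_right[of c "a - a'" a'] by (simp add: eq_diff_eq)
    then show ?thesis using norm_scaleC[of c "a - a'"] by simp
  qed
  then show ?thesis by (intro cauchy_relI[OF assms assms])
qed

lemma cauchy_rel_uminus:
  assumes "cauchy_rel X X'" shows "cauchy_rel (\<lambda>n. - X n) (\<lambda>n. - X' n)"
  using cauchy_rel_scale[OF assms, of "-1"] by (simp add: scaleC_minus1)

lemma cauchy_rel_minus:
  assumes "cauchy_rel X X'" "cauchy_rel Y Y'" shows "cauchy_rel (\<lambda>n. X n - Y n) (\<lambda>n. X' n - Y' n)"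
  using cauchy_rel_add[OF assms(1) cauchy_rel_uminus[OF assms(2)]] by simp

lemma cauchy_rel_star:
  assumes "cauchy_rel X X'" shows "cauchy_rel (\<lambda>n. (X n)\<^sup>\<star>) (\<lambda>n. (X' n)\<^sup>\<star>)"
proof -
  have "norm (a\<^sup>\<star> - a'\<^sup>\<star>) \<le> 1 * norm (a - a') + 0 * norm (a - a')" for a a' :: 'a
    using star_add[of a "- a'"] norm_star[of "a - a'"] by (simp add: star_minus)
  then show ?thesis by (intro cauchy_relI[OF assms assms])
qed

lemma cauchy_rel_bound:
  assumes "cauchy_rel X X'"
  obtains B where "B > 0" "\<And>n. norm (X n) \<le> B" "\<And>n. norm (X' n) \<le> B"
proof -
  have "Bseq X" "Bseq X'" using assms by (auto simp: cauchy_rel_def intro: Cauchy_Bseq)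
  then obtain B1 B2 where "B1 > 0" "\<And>n. norm (X n) \<le> B1" "\<And>n. norm (X' n) \<le> B2"
    unfolding Bseq_def by blast
  then have "max B1 B2 > 0" "norm (X n) \<le> max B1 B2" "norm (X' n) \<le> max B1 B2" for n
    by (auto simp: le_max_iff_disj)
  then show ?thesis by (rule that)
qed

lemma cauchy_rel_mult:
  assumes "cauchy_rel X X'" "cauchy_rel Y Y'" shows "cauchy_rel (\<lambda>n. X n * Y n) (\<lambda>n. X' n * Y' n)"
proof -
  obtain A where A: "A > 0" "\<And>n. norm (X n) \<le> A" "\<And>n. norm (X' n) \<le> A"
    using cauchy_rel_bound[OF assms(1)] by blast
  obtain B where B: "B > 0" "\<And>n. norm (Y n) \<le> B" "\<And>n. norm (Y' n) \<le> B"
    using cauchy_rel_bound[OF assms(2)] by blast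
  have le: "norm (a * b - a' * b') \<le> B * norm (a - a') + A * norm (b - b')"
    if "norm b \<le> B" "norm a' \<le> A" for a b a' b' :: 'a
  proof -
    have "a * b - a' * b' = (a - a') * b + a' * (b - b')" by (simp add: algebra_simps)
    also have "norm \<dots> \<le> norm (a - a') * norm b + norm a' * norm (b - b')"
      by (intro order_trans[OF norm_triangle_ineq] add_mono norm_mult_ineq)
    also have "\<dots> \<le> norm (a - a') * B + A * norm (b - b')"
      by (intro add_mono mult_left_mono mult_right_mono that) auto
    finally show ?thesis by (simp add: mult.commute)
  qed
  show ?thesis by (intro cauchy_relI[OF assms, where K = B and L = A] le A(2,3) B(2,3))
qed

lemma Cauchy_norm:
  fixes X :: "nat \<Rightarrow> 'a::real_normed_vector"
  assumes "Cauchy X" shows "(\<lambda>n. norm (X n)) \<longlonglongrightarrow> lim (\<lambda>n. norm (X n))"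
proof -
  have "Cauchy (\<lambda>n. norm (X n))"
    by (rule Cauchy_dominated[OF assms assms, where K = 1 and L = 0]) (simp add: norm_triangle_ineq3)
  then show ?thesis by (simp add: Cauchy_convergent_iff convergent_LIMSEQ_iff)
qed

lemma cauchy_rel_norm:
  assumes "cauchy_rel X Y" shows "lim (\<lambda>n. norm (X n)) = lim (\<lambda>n. norm (Y n))"
proof -
  have X: "(\<lambda>n. norm (X n)) \<longlonglongrightarrow> lim (\<lambda>n. norm (X n))" and Y: "(\<lambda>n. norm (Y n)) \<longlonglongrightarrow> lim (\<lambda>n. norm (Y n))"
    using assms by (auto simp: cauchy_rel_def intro: Cauchy_norm)
  have d: "(\<lambda>n. X n - Y n) \<longlonglongrightarrow> 0" using assms by (simp add: cauchy_rel_def)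
  have "norm (norm (X n) - norm (Y n)) \<le> 1 * norm (X n - Y n) + 0 * norm (X n - Y n)" for n
    by (simp add: norm_triangle_ineq3)
  then have "(\<lambda>n. norm (X n) - norm (Y n)) \<longlonglongrightarrow> 0" by (rule null_dominated[OF d d])
  from LIMSEQ_unique[OF tendsto_diff[OF X Y] this] show ?thesis by simp
qed

instantiation completion :: (pre_cstar_algebra) pre_cstar_algebra
begin

lift_definition zero_completion :: "'a completion" is "\<lambda>_. 0" by (rule cauchy_rel_const)
lift_definition one_completion :: "'a completion" is "\<lambda>_. 1" by (rule cauchy_rel_const)
lift_definition plus_completion :: "'a completion \<Rightarrow> 'a completion \<Rightarrow> 'a completion"
  is "\<lambda>X Y n. X n + Y n" by (rule cauchy_rel_add)
lift_definition minus_completion :: "'a completion \<Rightarrow> 'a completion \<Rightarrow> 'a completion"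
  is "\<lambda>X Y n. X n - Y n" by (rule cauchy_rel_minus)
lift_definition uminus_completion :: "'a completion \<Rightarrow> 'a completion"
  is "\<lambda>X n. - X n" by (rule cauchy_rel_uminus)
lift_definition times_completion :: "'a completion \<Rightarrow> 'a completion \<Rightarrow> 'a completion"
  is "\<lambda>X Y n. X n * Y n" by (rule cauchy_rel_mult)
lift_definition scaleC_completion :: "complex \<Rightarrow> 'a completion \<Rightarrow> 'a completion"
  is "\<lambda>c X n. c *\<^sub>C X n" by (rule cauchy_rel_scale)
lift_definition inv_star_completion :: "'a completion \<Rightarrow> 'a completion"
  is "\<lambda>X n. (X n)\<^sup>\<star>" by (rule cauchy_rel_star)
lift_definition norm_completion :: "'a completion \<Rightarrow> real"
  is "\<lambda>X. lim (\<lambda>n. norm (X n))" by (rule cauchy_rel_norm)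
definition scaleR_completion :: "real \<Rightarrow> 'a completion \<Rightarrow> 'a completion"
  where "scaleR_completion r x = complex_of_real r *\<^sub>C x"
definition sgn_completion :: "'a completion \<Rightarrow> 'a completion"
  where "sgn_completion x = inverse (norm x) *\<^sub>R x"
definition dist_completion :: "'a completion \<Rightarrow> 'a completion \<Rightarrow> real"
  where "dist_completion x y = norm (x - y)"
definition uniformity_completion :: "('a completion \<times> 'a completion) filter"
  where "uniformity_completion = (INF e\<in>{0<..}. principal {(x, y). dist x y < e})"
definition open_completion :: "'a completion set \<Rightarrow> bool"
  where "open_completion U \<longleftrightarrow> (\<forall>x\<in>U. \<forall>\<^sub>F (x', y) in uniformity. x' = x \<longrightarrow> y \<in> U)"

instance
proof
  fix x y z :: "'a completion" and c d :: complex and a b :: real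
  note [simp] = cauchy_rel_refl
  have n: "Cauchy X" if "cauchy_rel X X" for X :: "nat \<Rightarrow> 'a" using that by (simp add: cauchy_rel_def)
  note ops = cauchy_rel_add cauchy_rel_mult cauchy_rel_scale cauchy_rel_uminus cauchy_rel_minus
    cauchy_rel_star cauchy_rel_const
  show "x + y + z = x + (y + z)" by transfer (simp add: add.assoc ops)
  show "x + y = y + x" by transfer (simp add: add.commute ops)
  show "0 + x = x" by transfer simp
  show "- x + x = 0" by transfer (simp add: ops)
  show "x - y = x + - y" by transfer (simp add: ops)
  show add_right: "c *\<^sub>C (x + y) = c *\<^sub>C x + c *\<^sub>C y" for c by transfer (simp add: ops scaleC_add_right)
  show add_left: "(c + d) *\<^sub>C x = c *\<^sub>C x + d *\<^sub>C x" for c d by transfer (simp add: ops scaleC_add_left)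
  show sc: "c *\<^sub>C d *\<^sub>C x = (c * d) *\<^sub>C x" for c d by transfer (simp add: ops scaleC_scaleC)
  have sc1: "1 *\<^sub>C x = x" by transfer simp
  show "a *\<^sub>R (x + y) = a *\<^sub>R x + a *\<^sub>R y" by (simp add: scaleR_completion_def add_right)
  show "(a + b) *\<^sub>R x = a *\<^sub>R x + b *\<^sub>R x" by (simp add: scaleR_completion_def add_left)
  show "a *\<^sub>R b *\<^sub>R x = (a * b) *\<^sub>R x" by (simp add: scaleR_completion_def sc)
  show "1 *\<^sub>R x = x" by (simp add: scaleR_completion_def sc1)
  show "a *\<^sub>R x = complex_of_real a *\<^sub>C x" by (rule scaleR_completion_def)
  show "x * y * z = x * (y * z)" by transfer (simp add: mult.assoc ops)
  show "(x + y) * z = x * z + y * z" by transfer (simp add: distrib_right ops)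
  show "x * (y + z) = x * y + x * z" by transfer (simp add: distrib_left ops)
  show m1: "(c *\<^sub>C x) * y = c *\<^sub>C (x * y)" for c by transfer (simp add: ops mult_scaleC_left)
  show m2: "x * (c *\<^sub>C y) = c *\<^sub>C (x * y)" for c by transfer (simp add: ops mult_scaleC_right)
  show "(a *\<^sub>R x) * y = a *\<^sub>R (x * y)" by (simp add: scaleR_completion_def m1)
  show "x * (a *\<^sub>R y) = a *\<^sub>R (x * y)" by (simp add: scaleR_completion_def m2)
  show "1 * x = x" by transfer simp
  show "x * 1 = x" by transfer simp
  show nC: "norm (c *\<^sub>C x) = cmod c * norm x" for c
  proof transfer
    fix c and X :: "nat \<Rightarrow> 'a" assume "cauchy_rel X X"
    from tendsto_mult[OF tendsto_const[of "cmod c"] Cauchy_norm[OF n[OF this]]]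
    show "lim (\<lambda>n. norm (c *\<^sub>C X n)) = cmod c * lim (\<lambda>n. norm (X n))"
      by (simp add: norm_scaleC limI)
  qed
  show "norm (a *\<^sub>R x) = \<bar>a\<bar> * norm x" by (simp add: scaleR_completion_def nC)
  show "(norm x = 0) = (x = 0)"
  proof transfer
    fix X :: "nat \<Rightarrow> 'a" assume X: "cauchy_rel X X"
    have "(lim (\<lambda>n. norm (X n)) = 0) \<longleftrightarrow> (\<lambda>n. norm (X n)) \<longlonglongrightarrow> 0"
      using Cauchy_norm[OF n[OF X]] limI by metis
    also have "\<dots> \<longleftrightarrow> X \<longlonglongrightarrow> 0" by (rule tendsto_norm_zero_iff)
    also have "\<dots> \<longleftrightarrow> cauchy_rel X (\<lambda>_. 0)"
      using n[OF X] cauchy_rel_const[of "0::'a"] by (auto simp: cauchy_rel_def)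
    finally show "(lim (\<lambda>n. norm (X n)) = 0) = cauchy_rel X (\<lambda>_. 0)" .
  qed
  show "norm (x + y) \<le> norm x + norm y"
  proof transfer
    fix X Y :: "nat \<Rightarrow> 'a" assume X: "cauchy_rel X X" and Y: "cauchy_rel Y Y"
    show "lim (\<lambda>n. norm (X n + Y n)) \<le> lim (\<lambda>n. norm (X n)) + lim (\<lambda>n. norm (Y n))"
      by (rule LIMSEQ_le[OF Cauchy_norm[OF n[OF cauchy_rel_add[OF X Y]]]
          tendsto_add[OF Cauchy_norm[OF n[OF X]] Cauchy_norm[OF n[OF Y]]]])
        (simp add: norm_triangle_ineq)
  qed
  show "norm (x * y) \<le> norm x * norm y"
  proof transfer
    fix X Y :: "nat \<Rightarrow> 'a" assume X: "cauchy_rel X X" and Y: "cauchy_rel Y Y"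
    show "lim (\<lambda>n. norm (X n * Y n)) \<le> lim (\<lambda>n. norm (X n)) * lim (\<lambda>n. norm (Y n))"
      by (rule LIMSEQ_le[OF Cauchy_norm[OF n[OF cauchy_rel_mult[OF X Y]]]
          tendsto_mult[OF Cauchy_norm[OF n[OF X]] Cauchy_norm[OF n[OF Y]]]])
        (simp add: norm_mult_ineq)
  qed
  show "(x\<^sup>\<star>)\<^sup>\<star> = x" by transfer (simp add: ops star_star)
  show "(x + y)\<^sup>\<star> = x\<^sup>\<star> + y\<^sup>\<star>" by transfer (simp add: ops star_add)
  show "(c *\<^sub>C x)\<^sup>\<star> = cnj c *\<^sub>C x\<^sup>\<star>" by transfer (simp add: ops star_scaleC)
  show "(x * y)\<^sup>\<star> = y\<^sup>\<star> * x\<^sup>\<star>" by transfer (simp add: ops star_mult)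
  show "norm (x\<^sup>\<star> * x) = (norm x)\<^sup>2"
  proof transfer
    fix X :: "nat \<Rightarrow> 'a" assume "cauchy_rel X X"
    from tendsto_power[OF Cauchy_norm[OF n[OF this]], of 2]
    show "lim (\<lambda>n. norm ((X n)\<^sup>\<star> * X n)) = (lim (\<lambda>n. norm (X n)))\<^sup>2"
      by (simp add: cstar_identity limI)
  qed
qed (rule sgn_completion_def dist_completion_def uniformity_completion_def open_completion_def)+

end

lift_definition to_completion :: "'a::pre_cstar_algebra \<Rightarrow> 'a completion" is "\<lambda>x _. x"
  by (rule cauchy_rel_const)

lemma norm_to_completion: "norm (to_completion x) = norm x"
  by transfer (simp add: lim_const)

lemma to_completion_diff: "to_completion (x - y) = to_completion x - to_completion y"
  by transfer (rule cauchy_rel_const)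

lemma to_completion_dense: assumes "e > 0" shows "\<exists>a. norm (x - to_completion a) < e"
  using assms
proof transfer
  fix e :: real and X :: "nat \<Rightarrow> 'a" assume e: "0 < e" and X: "cauchy_rel X X"
  obtain N where N: "\<And>m n. m \<ge> N \<Longrightarrow> n \<ge> N \<Longrightarrow> norm (X m - X n) < e / 2"
    using CauchyD[of X "e / 2"] X e by (auto simp: cauchy_rel_def)
  have "cauchy_rel (\<lambda>n. X n - X N) (\<lambda>n. X n - X N)" by (intro cauchy_rel_minus X cauchy_rel_const)
  then have l: "(\<lambda>n. norm (X n - X N)) \<longlonglongrightarrow> lim (\<lambda>n. norm (X n - X N))"
    by (intro Cauchy_norm) (simp add: cauchy_rel_def)
  have "lim (\<lambda>n. norm (X n - X N)) \<le> e / 2"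
    by (rule LIMSEQ_le_const2[OF l]) (use N less_imp_le in blast)
  then show "\<exists>a. lim (\<lambda>n. norm (X n - a)) < e" using e by (intro exI[of _ "X N"]) simp
qed

lemma to_completion_converges: 
  assumes "Cauchy X" shows "\<exists>x. (\<lambda>n. to_completion (X n)) \<longlonglongrightarrow> x"
proof -
  define x where "x = abs_completion X"
  have X: "cauchy_rel X X" using assms by (rule cauchy_rel_refl)
  have d: "norm (to_completion a - x) = lim (\<lambda>n. norm (a - X n))" for a
  proof -
    have "cauchy_rel (\<lambda>n. a - X n) (\<lambda>n. a - X n)" by (intro cauchy_rel_minus X cauchy_rel_const)
    moreover have "to_completion a - x = abs_completion (\<lambda>n. a - X n)"
      unfolding x_def to_completion.abs_eq by (rule minus_completion.abs_eq[OF cauchy_rel_const X])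
    ultimately show ?thesis by (simp add: norm_completion.abs_eq)
  qed
  have "(\<lambda>n. to_completion (X n)) \<longlonglongrightarrow> x"
  proof (rule LIMSEQ_I)
    fix e :: real assume e: "0 < e"
    obtain N where N: "\<And>m n. m \<ge> N \<Longrightarrow> n \<ge> N \<Longrightarrow> norm (X m - X n) < e / 2"
      using CauchyD[OF assms, of "e / 2"] e by auto
    have "norm (to_completion (X m) - x) < e" if m: "m \<ge> N" for m
    proof -
      have "cauchy_rel (\<lambda>n. X m - X n) (\<lambda>n. X m - X n)" by (intro cauchy_rel_minus X cauchy_rel_const)
      then have l: "(\<lambda>n. norm (X m - X n)) \<longlonglongrightarrow> lim (\<lambda>n. norm (X m - X n))"
        by (intro Cauchy_norm) (simp add: cauchy_rel_def)
      have "lim (\<lambda>n. norm (X m - X n)) \<le> e / 2"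
        by (rule LIMSEQ_le_const2[OF l]) (use N m less_imp_le in blast)
      then show ?thesis using e d by simp
    qed
    then show "\<exists>N. \<forall>n\<ge>N. norm (to_completion (X n) - x) < e" by blast
  qed
  then show ?thesis by blast
qed

instance completion :: (pre_cstar_algebra) cstar_algebra
proof
  fix X :: "nat \<Rightarrow> 'a completion" assume X: "Cauchy X"
  have "\<forall>n. \<exists>a. norm (X n - to_completion a) < inverse (real (Suc n))"
    by (intro allI to_completion_dense) simp
  then obtain A where A: "\<And>n. norm (X n - to_completion (A n)) < inverse (real (Suc n))" by metis
  have null: "(\<lambda>n. X n - to_completion (A n)) \<longlonglongrightarrow> 0"
    by (rule Lim_null_comparison[OF _ LIMSEQ_inverse_real_of_nat])
      (use A less_imp_le in \<open>auto intro!: always_eventually\<close>)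
  have "Cauchy (\<lambda>n. X n - to_completion (A n))" using null by (rule LIMSEQ_imp_Cauchy)
  then have "Cauchy (\<lambda>n. to_completion (A n))"
  proof -
    have "norm (to_completion (A m) - to_completion (A n)) \<le> 1 * norm (X m - X n)
      + 1 * norm ((X m - to_completion (A m)) - (X n - to_completion (A n)))" for m n
    proof -
      have "to_completion (A m) - to_completion (A n) = (X m - X n) - ((X m - to_completion (A m)) - (X n - to_completion (A n)))"
        by simp
      then show ?thesis using norm_triangle_ineq4 by (metis mult_1)
    qed
    then show ?thesis by (rule Cauchy_dominated[OF X \<open>Cauchy (\<lambda>n. X n - to_completion (A n))\<close>])
  qed
  then have "Cauchy A"
    unfolding Cauchy_iff by (simp flip: to_completion_diff add: norm_to_completion)
  then obtain x where "(\<lambda>n. to_completion (A n)) \<longlonglongrightarrow> x" using to_completion_converges by blast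
  from tendsto_add[OF null this] have "X \<longlonglongrightarrow> x" by simp
  then show "convergent X" by (auto simp: convergent_def)
qed

text \<open>
  The product type of the library carries the Euclidean norm, which is not a C*-norm; the direct sum
  of C*-algebras needs the maximum norm.
\<close>

datatype ('a, 'b) direct_sum = DSum (dfst: 'a) (dsnd: 'b)

instantiation direct_sum :: (pre_cstar_algebra, pre_cstar_algebra) pre_cstar_algebra
begin

definition "0 = DSum 0 0"
definition "1 = DSum 1 1"
definition "x + y = DSum (dfst x + dfst y) (dsnd x + dsnd y)"
definition "x - y = DSum (dfst x - dfst y) (dsnd x - dsnd y)"
definition "- x = DSum (- dfst x) (- dsnd x)"
definition "x * y = DSum (dfst x * dfst y) (dsnd x * dsnd y)"
definition "r *\<^sub>R x = DSum (r *\<^sub>R dfst x) (r *\<^sub>R dsnd x)"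
definition "c *\<^sub>C x = DSum (c *\<^sub>C dfst x) (c *\<^sub>C dsnd x)"
definition "x\<^sup>\<star> = DSum ((dfst x)\<^sup>\<star>) ((dsnd x)\<^sup>\<star>)"
definition "norm x = max (norm (dfst x)) (norm (dsnd x))"
definition "sgn (x :: ('a, 'b) direct_sum) = inverse (norm x) *\<^sub>R x"
definition "dist (x :: ('a, 'b) direct_sum) y = norm (x - y)"
definition "uniformity = (INF e\<in>{0<..}. principal {(x :: ('a, 'b) direct_sum, y). dist x y < e})"
definition "open (U :: ('a, 'b) direct_sum set) \<longleftrightarrow> (\<forall>x\<in>U. \<forall>\<^sub>F (x', y) in uniformity. x' = x \<longrightarrow> y \<in> U)"

instance
proof
  note defs = zero_direct_sum_def one_direct_sum_def plus_direct_sum_def minus_direct_sum_def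
    uminus_direct_sum_def times_direct_sum_def scaleR_direct_sum_def scaleC_direct_sum_def
    inv_star_direct_sum_def norm_direct_sum_def
  fix x y z :: "('a, 'b) direct_sum" and c d :: complex and a b :: real
  show "x + y + z = x + (y + z)" by (simp add: defs add.assoc)
  show "x + y = y + x" by (simp add: defs add.commute)
  show "0 + x = x" by (simp add: defs)
  show "- x + x = 0" by (simp add: defs)
  show "x - y = x + - y" by (simp add: defs)
  show "c *\<^sub>C (x + y) = c *\<^sub>C x + c *\<^sub>C y" by (simp add: defs scaleC_add_right)
  show "(c + d) *\<^sub>C x = c *\<^sub>C x + d *\<^sub>C x" by (simp add: defs scaleC_add_left)
  show "c *\<^sub>C d *\<^sub>C x = (c * d) *\<^sub>C x" by (simp add: defs scaleC_scaleC)
  show "a *\<^sub>R (x + y) = a *\<^sub>R x + a *\<^sub>R y" by (simp add: defs scaleR_add_right)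
  show "(a + b) *\<^sub>R x = a *\<^sub>R x + b *\<^sub>R x" by (simp add: defs scaleR_add_left)
  show "a *\<^sub>R b *\<^sub>R x = (a * b) *\<^sub>R x" by (simp add: defs)
  show "1 *\<^sub>R x = x" by (simp add: defs)
  show "a *\<^sub>R x = complex_of_real a *\<^sub>C x" by (simp add: defs scaleR_scaleC)
  show "x * y * z = x * (y * z)" by (simp add: defs mult.assoc)
  show "(x + y) * z = x * z + y * z" by (simp add: defs distrib_right)
  show "x * (y + z) = x * y + x * z" by (simp add: defs distrib_left)
  show "(c *\<^sub>C x) * y = c *\<^sub>C (x * y)" by (simp add: defs mult_scaleC_left)
  show "x * (c *\<^sub>C y) = c *\<^sub>C (x * y)" by (simp add: defs mult_scaleC_right)
  show "(a *\<^sub>R x) * y = a *\<^sub>R (x * y)" by (simp add: defs)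
  show "x * (a *\<^sub>R y) = a *\<^sub>R (x * y)" by (simp add: defs)
  show "1 * x = x" by (simp add: defs)
  show "x * 1 = x" by (simp add: defs)
  show "norm (c *\<^sub>C x) = cmod c * norm x" by (simp add: defs norm_scaleC max_mult_distrib_left)
  show "norm (a *\<^sub>R x) = \<bar>a\<bar> * norm x" by (simp add: defs max_mult_distrib_left)
  show "(norm x = 0) = (x = 0)"
  proof -
    have "(max (norm p) (norm q) = 0) = (p = 0 \<and> q = 0)" for p :: 'a and q :: 'b
      using norm_ge_zero[of p] norm_ge_zero[of q] by (auto simp: max_def split: if_splits)
    then show ?thesis by (cases x) (simp add: defs)
  qed
  show "norm (x + y) \<le> norm x + norm y"
    by (auto simp: defs intro!: order_trans[OF norm_triangle_ineq] add_mono)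
  show "norm (x * y) \<le> norm x * norm y"
    by (auto simp: defs intro!: order_trans[OF norm_mult_ineq] mult_mono simp: le_max_iff_disj)
  show "(x\<^sup>\<star>)\<^sup>\<star> = x" by (simp add: defs star_star)
  show "(x + y)\<^sup>\<star> = x\<^sup>\<star> + y\<^sup>\<star>" by (simp add: defs star_add)
  show "(c *\<^sub>C x)\<^sup>\<star> = cnj c *\<^sub>C x\<^sup>\<star>" by (simp add: defs star_scaleC)
  show "(x * y)\<^sup>\<star> = y\<^sup>\<star> * x\<^sup>\<star>" by (simp add: defs star_mult)
  show "norm (x\<^sup>\<star> * x) = (norm x)\<^sup>2"
  proof -
    have "max (s\<^sup>2) (t\<^sup>2) = (max s t)\<^sup>2" if "0 \<le> s" "0 \<le> t" for s t :: real
      using that power_mono[of s t 2] power_mono[of t s 2] by (auto simp: max_def)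
    then show ?thesis by (simp add: defs cstar_identity)
  qed
qed (rule sgn_direct_sum_def dist_direct_sum_def uniformity_direct_sum_def open_direct_sum_def)+

end

instance direct_sum :: (cstar_algebra, cstar_algebra) cstar_algebra
proof
  fix X :: "nat \<Rightarrow> ('a, 'b) direct_sum" assume X: "Cauchy X"
  have "Cauchy (\<lambda>n. dfst (X n))"
    by (rule Cauchy_dominated[OF X X, where K = 1 and L = 0]) (simp add: norm_direct_sum_def minus_direct_sum_def)
  then obtain a where a: "(\<lambda>n. dfst (X n)) \<longlonglongrightarrow> a" by (auto simp: Cauchy_convergent_iff convergent_def)
  have "Cauchy (\<lambda>n. dsnd (X n))"
    by (rule Cauchy_dominated[OF X X, where K = 1 and L = 0]) (simp add: norm_direct_sum_def minus_direct_sum_def)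
  then obtain b where b: "(\<lambda>n. dsnd (X n)) \<longlonglongrightarrow> b" by (auto simp: Cauchy_convergent_iff convergent_def)
  have "(\<lambda>n. X n - DSum a b) \<longlonglongrightarrow> 0"
    by (rule null_dominated[of "\<lambda>n. dfst (X n) - a" "\<lambda>n. dsnd (X n) - b" _ 1 1])
      (use a b in \<open>auto simp: LIM_zero_iff norm_direct_sum_def minus_direct_sum_def\<close>)
  then show "convergent X" by (auto simp: LIM_zero_iff convergent_def)
qed


type_synonym ('a, 'b) spatial_tensor = "('a, 'b) alg_tensor completion"

definition tensor :: "'a::cstar_algebra \<Rightarrow> 'b::cstar_algebra \<Rightarrow> ('a, 'b) spatial_tensor" (infixr "\<otimes>" 75) where
  "a \<otimes> b = to_completion (abs_alg_tensor [(a, b)])"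

text \<open>
  The continuous linear extension of \<open>a \<otimes> b \<mapsto> f a b\<close>. It is unique whenever it exists, because the
  elementary tensors span a dense subspace. It is meaningful for \<open>f\<close> bilinear and bounded for the
  spatial norm.
\<close>

definition tensor_extend ::
  "('a::cstar_algebra \<Rightarrow> 'b::cstar_algebra \<Rightarrow> 'c::cstar_algebra) \<Rightarrow> ('a, 'b) spatial_tensor \<Rightarrow> 'c" where
  "tensor_extend f = (THE F. cbounded_linear F \<and> (\<forall>a b. F (a \<otimes> b) = f a b))"

lemma completion_extend:
  fixes g :: "'a::pre_cstar_algebra \<Rightarrow> 'c::cstar_algebra"
  assumes g: "cbounded_linear g"
  shows "\<exists>F. cbounded_linear F \<and> (\<forall>x. F (to_completion x) = g x)"
proof -
  interpret g: bounded_linear g using g by (simp add: cbounded_linear_def)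
  define F where "F \<xi> = lim (\<lambda>n. g (rep_completion \<xi> n))" for \<xi>
  have conv: "(\<lambda>n. g (X n)) \<longlonglongrightarrow> F (abs_completion X)" if X: "Cauchy X" for X
  proof -
    have "cauchy_rel (rep_completion (abs_completion X)) X"
      by (rule Quotient3_rep_abs[OF Quotient3_completion]) (rule cauchy_rel_refl[OF X])
    then have d: "(\<lambda>n. rep_completion (abs_completion X) n - X n) \<longlonglongrightarrow> 0"
      by (simp add: cauchy_rel_def)
    obtain l where l: "(\<lambda>n. g (X n)) \<longlonglongrightarrow> l"
      using g.Cauchy[OF X] by (auto simp: Cauchy_convergent_iff convergent_def)
    have "(\<lambda>n. g (rep_completion (abs_completion X) n)) \<longlonglongrightarrow> l"
      using tendsto_add[OF l g.tendsto_zero[OF d]] by (simp add: g.diff)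
    then show ?thesis using l by (simp add: F_def limI)
  qed
  have n: "Cauchy X" if "cauchy_rel X X" for X :: "nat \<Rightarrow> 'a" using that by (simp add: cauchy_rel_def)
  obtain K where K: "\<And>x. norm (g x) \<le> norm x * K" using g.bounded by blast
  have "bounded_linear F"
  proof (rule bounded_linear_intro)
    fix x y and r :: real
    show "F (x + y) = F x + F y"
    proof (induct x rule: completion.abs_induct, induct y rule: completion.abs_induct)
      fix X Y :: "nat \<Rightarrow> 'a" assume Y: "cauchy_rel Y Y" and X: "cauchy_rel X X"
      have "(\<lambda>n. g (X n + Y n)) \<longlonglongrightarrow> F (abs_completion X) + F (abs_completion Y)"
        unfolding g.add by (intro tendsto_add conv n X Y)
      moreover have "(\<lambda>n. g (X n + Y n)) \<longlonglongrightarrow> F (abs_completion X + abs_completion Y)"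
        unfolding plus_completion.abs_eq[OF X Y] by (intro conv n cauchy_rel_add X Y)
      ultimately show "F (abs_completion X + abs_completion Y) = F (abs_completion X) + F (abs_completion Y)"
        using LIMSEQ_unique by blast
    qed
    show "F (r *\<^sub>R x) = r *\<^sub>R F x"
    proof (induct x rule: completion.abs_induct)
      fix X :: "nat \<Rightarrow> 'a" assume X: "cauchy_rel X X"
      have "(\<lambda>n. g (r *\<^sub>R X n)) \<longlonglongrightarrow> r *\<^sub>R F (abs_completion X)"
        unfolding g.scaleR by (intro tendsto_scaleR tendsto_const conv n X)
      moreover have "(\<lambda>n. g (r *\<^sub>R X n)) \<longlonglongrightarrow> F (r *\<^sub>R abs_completion X)"
        unfolding scaleR_scaleC scaleC_completion.abs_eq[OF X] by (intro conv n cauchy_rel_scale X)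
      ultimately show "F (r *\<^sub>R abs_completion X) = r *\<^sub>R F (abs_completion X)"
        using LIMSEQ_unique by blast
    qed
    show "norm (F x) \<le> norm x * K"
    proof (induct x rule: completion.abs_induct)
      fix X :: "nat \<Rightarrow> 'a" assume X: "cauchy_rel X X"
      show "norm (F (abs_completion X)) \<le> norm (abs_completion X) * K"
        unfolding norm_completion.abs_eq[OF X]
        by (rule LIMSEQ_le[OF tendsto_norm[OF conv[OF n[OF X]]]
            tendsto_mult[OF Cauchy_norm[OF n[OF X]] tendsto_const[of K]]]) (simp add: K)
    qed
  qed
  moreover have "F (c *\<^sub>C x) = c *\<^sub>C F x" for c x
  proof (induct x rule: completion.abs_induct)
    fix X :: "nat \<Rightarrow> 'a" assume X: "cauchy_rel X X"
    have bl: "bounded_linear (\<lambda>y::'c. c *\<^sub>C y)"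
      by (rule bounded_linear_intro[where K = "cmod c"])
        (auto simp: scaleC_add_right scaleR_scaleC scaleC_scaleC norm_scaleC mult.commute)
    have "(\<lambda>n. g (c *\<^sub>C X n)) \<longlonglongrightarrow> c *\<^sub>C F (abs_completion X)"
      unfolding cbounded_linearD(2)[OF g] by (intro bounded_linear.tendsto[OF bl] conv n X)
    moreover have "(\<lambda>n. g (c *\<^sub>C X n)) \<longlonglongrightarrow> F (c *\<^sub>C abs_completion X)"
      unfolding scaleC_completion.abs_eq[OF X] by (intro conv n cauchy_rel_scale X)
    ultimately show "F (c *\<^sub>C abs_completion X) = c *\<^sub>C F (abs_completion X)"
      using LIMSEQ_unique by blast
  qed
  moreover have "F (to_completion x) = g x" for x
    using conv[of "\<lambda>_. x"] cauchy_rel_const[of x] unfolding to_completion.abs_eq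
    by (auto simp: cauchy_rel_def LIMSEQ_const_iff)
  ultimately show ?thesis by (auto simp: cbounded_linear_def)
qed

lemma abs_alg_tensor_sum:
  "abs_alg_tensor x = tsum (\<lambda>a b. abs_alg_tensor [(a, b)]) x"
proof (induction x)
  case Nil
  show ?case by (simp add: zero_alg_tensor_def)
next
  case (Cons p x)
  obtain a b where p: "p = (a, b)" by (cases p)
  have "abs_alg_tensor (p # x) = abs_alg_tensor [(a, b)] + abs_alg_tensor x"
    by (simp add: plus_alg_tensor.abs_eq p)
  then show ?case by (simp only: p tsum_simps Cons.IH)
qed

lemma to_completion_add: "to_completion (x + y) = to_completion x + to_completion y"
  by transfer (rule cauchy_rel_const)

lemma to_completion_sum: "to_completion (abs_alg_tensor x) = tsum (\<otimes>) x"
proof (induction x)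
  case Nil
  have "to_completion 0 = (0 :: ('a, 'b) spatial_tensor)" by transfer (rule cauchy_rel_const)
  then show ?case by (simp add: zero_alg_tensor_def)
next
  case (Cons p x)
  obtain a b where p: "p = (a, b)" by (cases p)
  have "abs_alg_tensor (p # x) = abs_alg_tensor [(a, b)] + abs_alg_tensor x"
    by (simp add: plus_alg_tensor.abs_eq p)
  then show ?case by (simp only: p tsum_simps Cons.IH to_completion_add tensor_def)
qed

lemma norm_tsum_tensor: "norm (tsum (\<otimes>) x) = spatial_norm x"
  by (simp flip: to_completion_sum add: norm_to_completion norm_alg_tensor.abs_eq)

lemma tensor_dense: assumes "e > 0" shows "\<exists>x. norm (\<xi> - tsum (\<otimes>) x) < e"
proof -
  obtain a where a: "norm (\<xi> - to_completion a) < e" using to_completion_dense[OF assms] by blast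
  have "\<exists>x. a = abs_alg_tensor x" by (induct a rule: alg_tensor.abs_induct) auto
  then obtain x where "a = abs_alg_tensor x" by blast
  then show ?thesis using a by (auto simp: to_completion_sum)
qed

lemma tensor_ext_unique:
  assumes F: "cbounded_linear F" and G: "cbounded_linear G" and eq: "\<And>a b. F (a \<otimes> b) = G (a \<otimes> b)"
  shows "F = G"
proof
  fix \<xi>
  interpret D: bounded_linear "\<lambda>x. F x - G x"
    using F G by (intro bounded_linear_sub) (auto simp: cbounded_linear_def)
  have z: "F (tsum (\<otimes>) x) - G (tsum (\<otimes>) x) = 0" for x
  proof (induction x)
    case Nil
    show ?case using cbounded_linearD(3)[OF F] cbounded_linearD(3)[OF G] by simp
  next
    case (Cons p x)
    then show ?case by (cases p) (simp add: cbounded_linearD(1)[OF F] cbounded_linearD(1)[OF G] eq)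
  qed
  obtain K where K: "K > 0" "\<And>x. norm (F x - G x) \<le> norm x * K" using D.pos_bounded by blast
  have "norm (F \<xi> - G \<xi>) \<le> 0"
  proof (rule field_le_epsilon)
    fix e :: real assume e: "0 < e"
    obtain x where x: "norm (\<xi> - tsum (\<otimes>) x) < e / K" using tensor_dense[of "e / K"] e K by auto
    have "norm (F \<xi> - G \<xi>) = norm (F (\<xi> - tsum (\<otimes>) x) - G (\<xi> - tsum (\<otimes>) x))"
      using D.diff[of \<xi> "tsum (\<otimes>) x"] z[of x] by simp
    also have "\<dots> \<le> norm (\<xi> - tsum (\<otimes>) x) * K" by (rule K)
    also have "\<dots> \<le> 0 + e" using x K by (simp add: field_simps)
    finally show "norm (F \<xi> - G \<xi>) \<le> 0 + e" .
  qed
  then show "F \<xi> = G \<xi>" by simp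
qed

lemma tensor_extend:
  fixes f :: "'a::cstar_algebra \<Rightarrow> 'b::cstar_algebra \<Rightarrow> 'c::cstar_algebra"
  assumes scale: "\<And>c a b. f (c *\<^sub>C a) b = c *\<^sub>C f a b"
    and bound: "\<And>x. norm (tsum f x) \<le> C * spatial_norm x"
  shows "cbounded_linear (tensor_extend f)" "tensor_extend f (a \<otimes> b) = f a b"
proof -
  have sc: "tsum f (tscale c x) = c *\<^sub>C tsum f x" for c x
  proof (induction x)
    case Nil
    have "c *\<^sub>C (0::'c) = 0" by (metis add_cancel_left_left scaleC_add_right)
    then show ?case by simp
  qed (auto simp: scale scaleC_add_right)
  have wd: "tsum f x = tsum f y" if "spatial_eq x y" for x y
  proof -
    have "norm (tsum f (tminus x y)) \<le> 0" using bound[of "tminus x y"] that by (simp add: spatial_eq_def)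
    then show ?thesis by (simp add: tminus_def sc scaleC_minus1)
  qed
  define g where "g t = tsum f (rep_alg_tensor t)" for t
  have g: "g (abs_alg_tensor x) = tsum f x" for x
    unfolding g_def by (rule wd) (rule Quotient3_rep_abs[OF Quotient3_alg_tensor], simp add: teq_spatial_eq)
  have gC: "g (c *\<^sub>C t) = c *\<^sub>C g t" for c t
    by (induct t rule: alg_tensor.abs_induct) (simp add: scaleC_alg_tensor.abs_eq g sc)
  have "bounded_linear g"
  proof (rule bounded_linear_intro)
    show "g (s + t) = g s + g t" for s t
      by (induct s rule: alg_tensor.abs_induct, induct t rule: alg_tensor.abs_induct)
        (simp add: plus_alg_tensor.abs_eq g)
    show "g (r *\<^sub>R t) = r *\<^sub>R g t" for r t by (simp add: scaleR_scaleC gC)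
    show "norm (g t) \<le> norm t * C" for t
      by (induct t rule: alg_tensor.abs_induct) (simp add: norm_alg_tensor.abs_eq g mult.commute bound)
  qed
  then have "cbounded_linear g" by (simp add: cbounded_linear_def gC)
  from completion_extend[OF this] obtain F where
    F: "cbounded_linear F" "\<And>x. F (to_completion x) = g x" by blast
  then have F': "cbounded_linear F \<and> (\<forall>a b. F (a \<otimes> b) = f a b)" by (simp add: tensor_def g)
  have "cbounded_linear (tensor_extend f) \<and> (\<forall>a b. tensor_extend f (a \<otimes> b) = f a b)"
    unfolding tensor_extend_def
  proof (rule theI[of _ F])
    show "G = F" if "cbounded_linear G \<and> (\<forall>a b. G (a \<otimes> b) = f a b)" for G
      using that F' by (intro tensor_ext_unique) auto
  qed (rule F')
  then show "cbounded_linear (tensor_extend f)" "tensor_extend f (a \<otimes> b) = f a b" by auto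
qed

definition cstar_invertible :: "'a::cstar_algebra \<Rightarrow> bool" where
  "cstar_invertible x \<longleftrightarrow> (\<exists>y. x * y = 1 \<and> y * x = 1)"

definition cstar_spectrum :: "'a::cstar_algebra \<Rightarrow> complex set" where
  "cstar_spectrum x = {c. \<not> cstar_invertible (c *\<^sub>C 1 - x)}"

definition cstar_positive :: "'a::cstar_algebra \<Rightarrow> bool" where
  "cstar_positive x \<longleftrightarrow> x\<^sup>\<star> = x \<and> cstar_spectrum x \<subseteq> \<real>\<^sub>\<ge>\<^sub>0"

definition cstar_le :: "'a::cstar_algebra \<Rightarrow> 'a \<Rightarrow> bool" where
  "cstar_le x y \<longleftrightarrow> cstar_positive (y - x)"

definition spatially_continuous_multiplication :: "'a::cstar_algebra itself \<Rightarrow> bool" where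
  "spatially_continuous_multiplication (_ :: 'a itself) \<longleftrightarrow>
     (\<exists>C. \<forall>x :: ('a \<times> 'a) list. norm (tsum (*) x) \<le> C * spatial_norm x)"

definition tensor_mult :: "('a::cstar_algebra, 'a) spatial_tensor \<Rightarrow> 'a" where
  "tensor_mult = tensor_extend (*)"

definition tensor_flip :: "('a::cstar_algebra, 'b::cstar_algebra) spatial_tensor \<Rightarrow> ('b, 'a) spatial_tensor" where
  "tensor_flip = tensor_extend (\<lambda>a b. b \<otimes> a)"

definition tensor_map :: "('a::cstar_algebra \<Rightarrow> 'c::cstar_algebra) \<Rightarrow> ('b::cstar_algebra \<Rightarrow> 'd::cstar_algebra) \<Rightarrow>
    ('a, 'b) spatial_tensor \<Rightarrow> ('c, 'd) spatial_tensor" where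
  "tensor_map f g = tensor_extend (\<lambda>a b. f a \<otimes> g b)"

text \<open>
  The threefold tensor product is bracketed to the left, so that
  \<open>\<rho> \<otimes> 1\<close> is an elementary tensor, while \<open>1 \<otimes> \<rho>\<close> and the *-morphism with
  \<open>a \<otimes> b \<mapsto> a \<otimes> 1 \<otimes> b\<close> are obtained by extension.
\<close>

definition insert_unit_left ::
  "('a::cstar_algebra, 'a) spatial_tensor \<Rightarrow> (('a, 'a) spatial_tensor, 'a) spatial_tensor" where
  "insert_unit_left = tensor_extend (\<lambda>a b. (1 \<otimes> a) \<otimes> b)"

definition insert_unit_middle ::
  "('a::cstar_algebra, 'a) spatial_tensor \<Rightarrow> (('a, 'a) spatial_tensor, 'a) spatial_tensor" where
  "insert_unit_middle = tensor_extend (\<lambda>a b. (a \<otimes> 1) \<otimes> b)"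

text \<open>The algebra of the pair is given by the type of \<open>\<rho>\<close>.\<close>

definition algebraic_compact_quantum_metric_space :: "('a::cstar_algebra, 'a) spatial_tensor \<Rightarrow> bool" where
  "algebraic_compact_quantum_metric_space \<rho> \<longleftrightarrow>
     spatially_continuous_multiplication TYPE('a) \<and>
     cstar_positive \<rho> \<and>
     tensor_mult \<rho> = 0 \<and>
     (\<forall>\<nu>. cstar_positive \<nu> \<and> tensor_mult \<nu> = 1 \<and> tensor_flip \<nu> = \<nu> \<longrightarrow> cstar_invertible (\<rho> + \<nu>)) \<and>
     tensor_flip \<rho> = \<rho> \<and>
     cstar_le (insert_unit_middle \<rho>) (\<rho> \<otimes> 1 + insert_unit_left \<rho>)"

definition inj_fst :: "'a::cstar_algebra \<Rightarrow> ('a, 'b::cstar_algebra) direct_sum" where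
  "inj_fst a = DSum a 0"

definition inj_snd :: "'b::cstar_algebra \<Rightarrow> ('a::cstar_algebra, 'b) direct_sum" where
  "inj_snd b = DSum 0 b"

end

theory Submission
  imports Defs
begin

text \<open>
  Write \<open>A = A\<^sub>1 \<oplus> A\<^sub>2\<close>. The coordinate projections and inclusions of \<open>A\<close> induce those of the
  decomposition of \<open>A \<otimes> A\<close> into the four blocks \<open>A\<^sub>i \<otimes> A\<^sub>j\<close>, and in a direct sum of C*-algebras
  invertibility and positivity can be tested block by block
  (\<open>internal_direct_sum_invertible\<close>, \<open>internal_direct_sum_positive\<close>). The blocks of the metric \<open>\<rho>\<close> are
  \<open>\<rho>\<^sub>1\<close> and \<open>\<rho>\<^sub>2\<close> on the diagonal and the scalar \<open>r\<close> off the diagonal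
  (\<open>direct_sum_metric_component\<close>), so each axiom for \<open>\<rho>\<close> becomes a statement about \<open>\<rho>\<^sub>1\<close>, \<open>\<rho>\<^sub>2\<close>
  and \<open>r\<close>.

  Multiplication and flip respect the blocks. In the invertibility axiom a block \<open>\<nu>\<^sub>i\<^sub>i\<close> of an
  admissible \<open>\<nu>\<close> is again admissible, and off the diagonal \<open>r + \<nu>\<^sub>i\<^sub>j\<close> is invertible because \<open>\<nu>\<^sub>i\<^sub>j\<close>
  is positive and \<open>r > 0\<close>. The triangle inequality lives in the eight blocks
  \<open>(A\<^sub>i \<otimes> A\<^sub>j) \<otimes> A\<^sub>k\<close>, where it says \<open>\<rho>\<^sub>i\<^sub>k \<le> \<rho>\<^sub>i\<^sub>j + \<rho>\<^sub>j\<^sub>k\<close> with the missing tensor factor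
  filled by 1. For \<open>i = j = k\<close> it is the hypothesis; if \<open>i \<noteq> k\<close>, one of the two terms on the right is
  \<open>r\<close> and cancels against the left side, which leaves the positivity of the other; if \<open>i = k \<noteq> j\<close> it
  reads \<open>\<rho>\<^sub>i \<le> 2 r\<close>, which is where the bound on \<open>r\<close> enters: the spectrum of \<open>\<rho>\<^sub>i\<close> lies in
  \<open>[0, \<parallel>\<rho>\<^sub>i\<parallel>]\<close> (\<open>cstar_positive_norm_complement\<close>).

  All of this needs the tensor product of two *-homomorphisms to exist as a *-homomorphism of the
  spatial tensor products. The coordinate maps are covered, and also \<open>a \<mapsto> a \<otimes> 1\<close> and
  \<open>a \<mapsto> 1 \<otimes> a\<close>, from which the maps of the triangle inequality are built. The point is that
  \<open>f \<otimes> id\<close> does not increase the spatial norm (\<open>spatial_norm_map_fst\<close>). The spatial norm of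
  \<open>x\<close> is computed from vectors in GNS spaces of the source of \<open>f\<close>, whereas that of its image involves
  all vectors in a GNS space of the target. Such a vector is decomposed by a Gram-Schmidt process into
  almost orthogonal pieces, each in a subspace that is cyclic for the source algebra, and on a cyclic
  subspace the action is a GNS representation of the source again (\<open>gns_norm_hom_bound\<close>).
\<close>

section \<open>Star homomorphisms\<close>

definition star_hom :: "('a::cstar_algebra \<Rightarrow> 'b::cstar_algebra) \<Rightarrow> bool" where
  "star_hom f \<longleftrightarrow> cbounded_linear f \<and> (\<forall>x y. f (x * y) = f x * f y) \<and> (\<forall>x. f (x\<^sup>\<star>) = (f x)\<^sup>\<star>)"

lemma star_homD:
  assumes "star_hom f"
  shows "cbounded_linear f" "f (x * y) = f x * f y" "f (x\<^sup>\<star>) = (f x)\<^sup>\<star>"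
    "f (x + y) = f x + f y" "f (c *\<^sub>C x) = c *\<^sub>C f x" "f 0 = 0" "f (- x) = - f x" "f (x - y) = f x - f y"
  using assms cbounded_linearD[of f] by (auto simp: star_hom_def)

lemma scaleC_zero_right [simp]: "c *\<^sub>C (0::'a::pre_cstar_algebra) = 0"
  by (metis add_cancel_left_left scaleC_add_right)

lemma bounded_linear_scaleC: "bounded_linear (\<lambda>x::'a::pre_cstar_algebra. c *\<^sub>C x)"
  by (rule bounded_linear_intro[where K = "cmod c"])
    (auto simp: scaleC_add_right scaleR_scaleC scaleC_scaleC norm_scaleC mult.commute)

lemma bounded_linear_star: "bounded_linear (\<lambda>x::'a::pre_cstar_algebra. x\<^sup>\<star>)"
  by (rule bounded_linear_intro[where K = 1]) (auto simp: star_add star_scaleC scaleR_scaleC norm_star)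

lemma cbounded_linear_id [simp]: "cbounded_linear (\<lambda>x. x)"
  and cbounded_linear_zero [simp]: "cbounded_linear (\<lambda>x. 0)"
  by (auto simp: cbounded_linear_def)

lemma cbounded_linear_add:
  "cbounded_linear f \<Longrightarrow> cbounded_linear g \<Longrightarrow> cbounded_linear (\<lambda>x. f x + g x)"
  by (auto simp: cbounded_linear_def bounded_linear_add scaleC_add_right)

lemma cbounded_linear_compose:
  assumes "cbounded_linear f" "cbounded_linear g" shows "cbounded_linear (\<lambda>x. f (g x))"
  using assms bounded_linear_compose[of f g] by (simp add: cbounded_linear_def)

lemma cbounded_linear_mult_left: "cbounded_linear f \<Longrightarrow> cbounded_linear (\<lambda>x. f x * a)"
  and cbounded_linear_mult_right: "cbounded_linear f \<Longrightarrow> cbounded_linear (\<lambda>x. a * f x)"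
  using bounded_linear_compose[OF bounded_linear_mult_left[of a], of f]
    bounded_linear_compose[OF bounded_linear_mult_right[of a], of f]
  by (simp_all add: cbounded_linear_def mult_scaleC_left mult_scaleC_right)

lemma cbounded_linear_star_conj:
  assumes "cbounded_linear f" shows "cbounded_linear (\<lambda>x. (f (x\<^sup>\<star>))\<^sup>\<star>)"
proof -
  have "bounded_linear (\<lambda>x. (f (x\<^sup>\<star>))\<^sup>\<star>)"
    using assms bounded_linear_compose[OF bounded_linear_star bounded_linear_compose[OF _ bounded_linear_star]]
    by (auto simp: cbounded_linear_def)
  then show ?thesis using assms by (simp add: cbounded_linear_def star_scaleC)
qed

lemma star_hom_id [simp]: "star_hom (\<lambda>x. x)"
  by (simp add: star_hom_def)

lemma star_hom_compose: "star_hom f \<Longrightarrow> star_hom g \<Longrightarrow> star_hom (\<lambda>x. f (g x))"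
  by (simp add: star_hom_def cbounded_linear_compose)

section \<open>Star homomorphisms and the spatial norm\<close>

lemma pos_fun_expand:
  assumes "pos_fun \<phi>"
  shows "\<phi> ((x + t *\<^sub>C y)\<^sup>\<star> * (x + t *\<^sub>C y)) =
      \<phi> (x\<^sup>\<star> * x) + t * \<phi> (x\<^sup>\<star> * y) + cnj t * \<phi> (y\<^sup>\<star> * x) + complex_of_real ((cmod t)\<^sup>2) * \<phi> (y\<^sup>\<star> * y)"
proof -
  have "\<phi> ((x + t *\<^sub>C y)\<^sup>\<star> * (x + t *\<^sub>C y)) =
      \<phi> (x\<^sup>\<star> * x) + t * \<phi> (x\<^sup>\<star> * y) + cnj t * \<phi> (y\<^sup>\<star> * x) + (cnj t * t) * \<phi> (y\<^sup>\<star> * y)"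
    by (simp add: star_add star_scaleC mult_scaleC_left mult_scaleC_right distrib_left distrib_right
        pos_fun_lin[OF assms] algebra_simps)
  moreover have "cnj t * t = complex_of_real ((cmod t)\<^sup>2)"
    by (simp only: complex_norm_square mult.commute)
  ultimately show ?thesis by simp
qed

text \<open>
  Closed under complex scalars, because slices of tensors have complex coefficients.
\<close>

definition csubspace :: "'a::pre_cstar_algebra set \<Rightarrow> bool" where
  "csubspace W \<longleftrightarrow> 0 \<in> W \<and> (\<forall>x\<in>W. \<forall>y\<in>W. x + y \<in> W) \<and> (\<forall>c. \<forall>x\<in>W. c *\<^sub>C x \<in> W)"

text \<open>
  The class of \<open>c\<close> in the GNS space of \<open>\<phi>\<close> need not have a nearest point in \<open>W\<close>, as \<open>W\<close> need not be
  closed there. A point \<open>w\<close> whose squared distance from \<open>c\<close> is within \<open>e\<close> of the infimum is enough: moving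
  from \<open>w\<close> in a direction \<open>v\<close> can lower the squared distance by at most \<open>e\<close>, and the discriminant of
  this quadratic in the step size bounds the inner product of \<open>v\<close> and \<open>c - w\<close>.
\<close>

lemma approximate_projection:
  assumes \<phi>: "pos_fun \<phi>" and W: "csubspace W" and e: "0 < (e::real)"
  obtains w where "w \<in> W" "\<And>v. v \<in> W \<Longrightarrow> (cmod (\<phi> (v\<^sup>\<star> * (c - w))))\<^sup>2 \<le> e * Re (\<phi> (v\<^sup>\<star> * v))"
proof -
  define D where "D u = Re (\<phi> (u\<^sup>\<star> * u))" for u
  have pos: "\<phi> (u\<^sup>\<star> * u) \<in> \<real>\<^sub>\<ge>\<^sub>0" for u using \<phi> by (simp add: pos_fun_def)
  have D: "\<phi> (u\<^sup>\<star> * u) = complex_of_real (D u)" "D u \<ge> 0" for u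
    using nonneg_Reals_of_real[OF pos] by (simp_all add: D_def)
  define m where "m = Inf ((\<lambda>w. D (c - w)) ` W)"
  have bdd: "bdd_below ((\<lambda>w. D (c - w)) ` W)" by (rule bdd_belowI[of _ 0]) (auto simp: D)
  have "(\<lambda>w. D (c - w)) ` W \<noteq> {}" using W by (auto simp: csubspace_def)
  then have "\<exists>y\<in>(\<lambda>w. D (c - w)) ` W. y < m + e"
    unfolding m_def by (rule cInf_lessD) (use e in simp)
  then obtain w where w: "w \<in> W" "D (c - w) < m + e" by blast
  show ?thesis
  proof (rule that[OF w(1)])
    fix v assume v: "v \<in> W"
    define u where "u = c - w"
    have "complex_of_real e + t * \<phi> (u\<^sup>\<star> * v) + cnj t * \<phi> (v\<^sup>\<star> * u) + complex_of_real ((cmod t)\<^sup>2 * D v) \<in> \<real>\<^sub>\<ge>\<^sub>0" for t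
    proof -
      have "w + (- t) *\<^sub>C v \<in> W" using W w(1) v by (auto simp: csubspace_def)
      then have "m \<le> D (c - (w + (- t) *\<^sub>C v))"
        unfolding m_def by (intro cInf_lower[OF _ bdd]) auto
      moreover have "c - (w + (- t) *\<^sub>C v) = u + t *\<^sub>C v"
        using scaleC_add_left[of t "- t" v] by (simp add: u_def algebra_simps)
      ultimately have "0 \<le> D (u + t *\<^sub>C v) - D u + e" using w(2) by (simp add: u_def)
      moreover have "complex_of_real (D (u + t *\<^sub>C v)) = complex_of_real (D u) + t * \<phi> (u\<^sup>\<star> * v)
          + cnj t * \<phi> (v\<^sup>\<star> * u) + complex_of_real ((cmod t)\<^sup>2) * complex_of_real (D v)"
        unfolding D(1)[symmetric] by (rule pos_fun_expand[OF \<phi>])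
      ultimately have "complex_of_real e + t * \<phi> (u\<^sup>\<star> * v) + cnj t * \<phi> (v\<^sup>\<star> * u) + complex_of_real ((cmod t)\<^sup>2 * D v)
          = complex_of_real (D (u + t *\<^sub>C v) - D u + e)"
        by (simp add: algebra_simps)
      then show ?thesis using \<open>0 \<le> D (u + t *\<^sub>C v) - D u + e\<close>
        by (metis nonneg_Reals_of_real_iff)
    qed
    from quadratic_nonneg_cs[OF this D(2)]
    show "(cmod (\<phi> (v\<^sup>\<star> * (c - w))))\<^sup>2 \<le> e * Re (\<phi> (v\<^sup>\<star> * v))"
      by (simp add: u_def D_def)
  qed
qed

text \<open>
  Slicing: contracting the second tensor factor of \<open>V\<close> against the vector \<open>e\<close> gives a vector \<open>s\<close> in the
  first factor, and \<open>s\<close> stays in \<open>W\<close> because it is a linear combination of the first entries of \<open>V\<close>.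
\<close>

lemma ip_single_slice:
  assumes \<phi>: "pos_fun \<phi>" and W: "csubspace W" and V: "\<forall>(a, b)\<in>set V. a \<in> W"
  shows "\<exists>s\<in>W. \<forall>w. \<phi> (s\<^sup>\<star> * w) = ip \<phi> \<psi> V [(w, e)]"
  using V
proof (induction V)
  case Nil
  have "(0::'a)\<^sup>\<star> = 0" using star_scaleC[of 0 "0::'a"] by simp
  then show ?case using W pos_fun_lin(3)[OF \<phi>] by (intro bexI[of _ 0]) (auto simp: ip_def csubspace_def)
next
  case (Cons p V)
  obtain a b where p: "p = (a, b)" by (cases p)
  from Cons obtain s where s: "s \<in> W" "\<And>w. \<phi> (s\<^sup>\<star> * w) = ip \<phi> \<psi> V [(w, e)]" by auto
  define s' where "s' = cnj (\<psi> (b\<^sup>\<star> * e)) *\<^sub>C a + s"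
  have "s' \<in> W" using W s(1) Cons.prems by (auto simp: csubspace_def s'_def p)
  moreover have "\<phi> (s'\<^sup>\<star> * w) = ip \<phi> \<psi> (p # V) [(w, e)]" for w
    using s(2)[of w] by (simp add: s'_def p star_add star_scaleC distrib_right mult_scaleC_left
        pos_fun_lin[OF \<phi>] ip_eq mult.commute)
  ultimately show ?case by blast
qed

text \<open>
  If the first entries of \<open>y\<close> are almost orthogonal to \<open>W\<close>, then \<open>y\<close> is almost orthogonal to
  \<open>W \<otimes> B\<close>. The estimate depends on \<open>V\<close> only through its norm, since the slice of \<open>V\<close> against \<open>d\<close> has
  norm at most \<open>\<parallel>V\<parallel> \<parallel>d\<parallel>\<close>; a bound in terms of the entries of \<open>V\<close> would be useless in
  \<open>gns_norm_hom_bound\<close>, where they come from projections depending on \<open>e\<close>.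
\<close>

lemma ip_almost_orthogonal:
  assumes \<phi>: "pos_fun \<phi>" and \<psi>: "pos_fun \<psi>" and W: "csubspace W"
    and V: "\<forall>(a, b)\<in>set V. a \<in> W" and e: "0 \<le> e"
    and orth: "\<forall>(u, d)\<in>set y. \<forall>v\<in>W. (cmod (\<phi> (v\<^sup>\<star> * u)))\<^sup>2 \<le> e\<^sup>2 * Re (\<phi> (v\<^sup>\<star> * v))"
  shows "cmod (ip \<phi> \<psi> V y) \<le> e * gns_norm \<phi> \<psi> V * tsum (\<lambda>u d. sqrt (Re (\<psi> (d\<^sup>\<star> * d)))) y"
  using orth
proof (induction y)
  case Nil
  then show ?case by (simp add: ip_eq)
next
  case (Cons p y)
  obtain u d where p: "p = (u, d)" by (cases p)
  obtain s where s: "s \<in> W" "\<And>w. \<phi> (s\<^sup>\<star> * w) = ip \<phi> \<psi> V [(w, d)]"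
    using ip_single_slice[OF \<phi> W V] by blast
  define S where "S = sqrt (Re (\<phi> (s\<^sup>\<star> * s)))"
  define N where "N = sqrt (Re (\<psi> (d\<^sup>\<star> * d)))"
  have p\<phi>: "Re (\<phi> (s\<^sup>\<star> * s)) \<ge> 0" and p\<psi>: "Re (\<psi> (d\<^sup>\<star> * d)) \<ge> 0"
    using \<phi> \<psi> by (auto simp: pos_fun_def intro!: nonneg_Reals_of_real(2))
  have S0: "S \<ge> 0" and S2: "S\<^sup>2 = Re (\<phi> (s\<^sup>\<star> * s))" using p\<phi> by (auto simp: S_def)
  have "S\<^sup>2 \<le> cmod (ip \<phi> \<psi> V [(s, d)])"
    unfolding S2 s(2)[symmetric] by (rule complex_Re_le_cmod)
  also have "\<dots> \<le> gns_norm \<phi> \<psi> V * gns_norm \<phi> \<psi> [(s, d)]" by (rule gns_norm_cs[OF \<phi> \<psi>])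
  also have "gns_norm \<phi> \<psi> [(s, d)] = S * N"
  proof -
    have "\<phi> (s\<^sup>\<star> * s) \<in> \<real>\<^sub>\<ge>\<^sub>0" "\<psi> (d\<^sup>\<star> * d) \<in> \<real>\<^sub>\<ge>\<^sub>0" using \<phi> \<psi> by (auto simp: pos_fun_def)
    then show ?thesis
      by (simp add: gns_norm_ip ip_eq S_def N_def real_sqrt_mult complex_nonneg_Reals_iff)
  qed
  finally have "S * S \<le> (gns_norm \<phi> \<psi> V * N) * S" by (simp add: power2_eq_square mult_ac)
  then have SN: "S \<le> gns_norm \<phi> \<psi> V * N"
    using S0 gns_norm_nonneg[OF \<phi> \<psi>, of V] p\<psi> by (cases "S = 0") (auto simp: N_def)
  have "(cmod (ip \<phi> \<psi> V [(u, d)]))\<^sup>2 \<le> (e * S)\<^sup>2"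
    using Cons.prems s by (auto simp: p S2 power_mult_distrib simp flip: s(2))
  then have "cmod (ip \<phi> \<psi> V [(u, d)]) \<le> e * S"
    by (rule power2_le_imp_le) (use e S0 in simp)
  also have "\<dots> \<le> e * (gns_norm \<phi> \<psi> V * N)" by (rule mult_left_mono[OF SN e])
  finally have 1: "cmod (ip \<phi> \<psi> V [(u, d)]) \<le> e * gns_norm \<phi> \<psi> V * N" by (simp add: mult.assoc)
  have "ip \<phi> \<psi> V (p # y) = ip \<phi> \<psi> V [(u, d)] + ip \<phi> \<psi> V y"
    using ip_append(2)[of \<phi> \<psi> V "[p]" y] by (simp add: p)
  then have "cmod (ip \<phi> \<psi> V (p # y)) \<le> cmod (ip \<phi> \<psi> V [(u, d)]) + cmod (ip \<phi> \<psi> V y)"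
    by (simp add: norm_triangle_ineq)
  then show ?case using 1 Cons by (simp add: p N_def distrib_left)
qed

text \<open>
  The real analysis behind the limit of vanishing orthogonality defect: \<open>p\<close> and \<open>q\<close> stand for the norms of
  the two pieces of a vector of norm \<open>n\<close>, and \<open>m\<close> for the norm of its image under an operator whose norm
  on each piece is at most \<open>K\<close>. As \<open>p\<close> may vary with \<open>\<delta>\<close>, one first shows \<open>p \<le> n + S\<close> for
  \<open>\<delta> \<le> 1\<close>.
\<close>

lemma square_bound_from_perturbation:
  fixes K n m S L :: real
  assumes K: "0 \<le> K" "0 \<le> n" "0 \<le> m" "0 \<le> S" "0 \<le> L"
    and *: "\<And>\<delta>. 0 < \<delta> \<Longrightarrow> \<exists>p q. 0 \<le> p \<and> 0 \<le> q \<and> p\<^sup>2 + q\<^sup>2 \<le> n\<^sup>2 + \<delta> * p * S \<and> m\<^sup>2 \<le> K\<^sup>2 * (p\<^sup>2 + q\<^sup>2) + \<delta> * p * L"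
  shows "m \<le> K * n"
proof -
  have "m\<^sup>2 \<le> (K * n)\<^sup>2"
  proof (rule field_le_epsilon)
    fix e :: real assume e: "0 < e"
    define M where "M = (K\<^sup>2 * S + L) * (n + S) + 1"
    have M: "M > 0" using K by (auto simp: M_def intro!: add_nonneg_pos)
    define \<delta> where "\<delta> = min 1 (e / M)"
    have d: "0 < \<delta>" "\<delta> \<le> 1" "\<delta> * M \<le> e" using e M by (auto simp: \<delta>_def min_def field_simps)
    obtain p q where pq: "0 \<le> p" "0 \<le> q" "p\<^sup>2 + q\<^sup>2 \<le> n\<^sup>2 + \<delta> * p * S" "m\<^sup>2 \<le> K\<^sup>2 * (p\<^sup>2 + q\<^sup>2) + \<delta> * p * L"
      using *[OF d(1)] by blast
    have "\<delta> * p * S \<le> p * S" using d pq K by (simp add: mult_left_le_one_le mult_right_mono)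
    then have le: "p * p \<le> n * n + p * S" using pq(3) zero_le_power2[of q] unfolding power2_eq_square by linarith
    have "p \<le> n + S"
    proof (rule ccontr)
      assume "\<not> p \<le> n + S"
      then have a: "n + S < p" by simp
      have "n * n + p * S \<le> n * p + p * S" using a K by (intro add_right_mono mult_left_mono) auto
      also have "\<dots> = (n + S) * p" by (simp add: algebra_simps)
      also have "\<dots> < p * p" using a K by (intro mult_strict_right_mono) auto
      finally show False using le by simp
    qed
    have "m\<^sup>2 \<le> K\<^sup>2 * (n\<^sup>2 + \<delta> * p * S) + \<delta> * p * L"
      using pq(4) mult_left_mono[OF pq(3), of "K\<^sup>2"] by simp
    also have "\<dots> = (K * n)\<^sup>2 + \<delta> * ((K\<^sup>2 * S + L) * p)" by (simp add: algebra_simps power_mult_distrib)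
    also have "\<dots> \<le> (K * n)\<^sup>2 + \<delta> * M"
    proof -
      have "(K\<^sup>2 * S + L) * p \<le> (K\<^sup>2 * S + L) * (n + S)" by (rule mult_left_mono[OF \<open>p \<le> n + S\<close>]) (use K in simp)
      then have "(K\<^sup>2 * S + L) * p \<le> M" by (simp add: M_def)
      then show ?thesis using d by simp
    qed
    also have "\<dots> \<le> (K * n)\<^sup>2 + e" using d by simp
    finally show "m\<^sup>2 \<le> (K * n)\<^sup>2 + e" .
  qed
  then show ?thesis by (rule power2_le_imp_le) (use K in simp)
qed

lemma tmult_assoc:
  fixes x y z :: "('a::semigroup_mult \<times> 'b::semigroup_mult) list"
  shows "tmult (tmult x y) z = tmult x (tmult y z)"
proof (induction x)
  case (Cons p x)
  obtain a b where p: "p = (a, b)" by (cases p)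
  have s: "tmult [(a * c, b * d)] z = tmult [(a, b)] (tmult [(c, d)] z)" for c d
    by (induction z) (auto simp: mult.assoc)
  have "tmult (tmult [(a, b)] y) z = tmult [(a, b)] (tmult y z)"
  proof (induction y)
    case (Cons q y)
    obtain c d where q: "q = (c, d)" by (cases q)
    show ?case
      using s[of c d] tmult_Cons[of "a * c" "b * d" "tmult [(a, b)] y" z] tmult_Cons[of c d y z]
      by (simp add: q Cons.IH)
  qed simp
  then show ?case
    using tmult_Cons[of a b x y] tmult_Cons[of a b x "tmult y z"] by (simp add: p Cons.IH)
qed simp

lemma tmult_map_hom:
  fixes f :: "'a::semigroup_mult \<Rightarrow> 'c::semigroup_mult" and x y :: "('a \<times> 'b::times) list"
  assumes "\<And>a a'. f (a * a') = f a * f a'"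
  shows "tmult (map (apfst f) x) (map (\<lambda>(a, d). (f a * c, d)) y) = map (\<lambda>(a, d). (f a * c, d)) (tmult x y)"
proof (induction x)
  case (Cons p x)
  obtain a b where p: "p = (a, b)" by (cases p)
  have "tmult [(f a, b)] (map (\<lambda>(a, d). (f a * c, d)) y) = map (\<lambda>(a, d). (f a * c, d)) (tmult [(a, b)] y)"
    by (induction y) (auto simp: assms mult.assoc)
  then show ?case
    using tmult_Cons[of a b x y] tmult_Cons[of "f a" b "map (apfst f) x"] by (simp add: p Cons.IH)
qed simp

text \<open>
  The action of the source algebra through \<open>f\<close> on the cyclic subspace generated by \<open>c\<close> is the GNS
  representation of this functional.
\<close>

lemma vector_functional:
  assumes f: "star_hom f" and \<phi>: "pos_fun \<phi>"
  shows "pos_fun (\<lambda>a. \<phi> (c\<^sup>\<star> * (f a * c)))"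
  unfolding pos_fun_def
proof (intro conjI allI)
  have "cbounded_linear \<phi>" using \<phi> by (simp add: pos_fun_def)
  then show "cbounded_linear (\<lambda>a. \<phi> (c\<^sup>\<star> * (f a * c)))"
    by (rule cbounded_linear_compose) (intro cbounded_linear_mult_right cbounded_linear_mult_left star_homD(1)[OF f])
  fix a
  have "c\<^sup>\<star> * (f (a\<^sup>\<star> * a) * c) = (f a * c)\<^sup>\<star> * (f a * c)"
    by (simp add: star_homD[OF f] star_mult mult.assoc)
  then show "\<phi> (c\<^sup>\<star> * (f (a\<^sup>\<star> * a) * c)) \<in> \<real>\<^sub>\<ge>\<^sub>0" using \<phi> by (simp add: pos_fun_def)
qed

lemma gns_norm_vector_functional:
  assumes f: "star_hom f"
  shows "gns_norm \<phi> \<psi> (map (\<lambda>(a, d). (f a * c, d)) z) = gns_norm (\<lambda>a. \<phi> (c\<^sup>\<star> * (f a * c))) \<psi> z"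
proof -
  have s: "tsum g (map (\<lambda>(a, d). (f a * c, d)) z) = tsum (\<lambda>a d. g (f a * c) d) z" for g :: "_ \<Rightarrow> _ \<Rightarrow> complex" and z
    by (induction z) auto
  show ?thesis
    by (simp add: gns_norm_ip ip_eq s star_homD[OF f] star_mult mult.assoc)
qed

text \<open>
  Induction on the number of elementary tensors in \<open>y = c0 \<otimes> d0 + \<Sum>k. ck \<otimes> dk\<close>. Each \<open>ck\<close> is split
  as \<open>f (\<alpha> ck) * c0\<close> plus a remainder almost orthogonal to the cyclic subspace \<open>W\<close> generated by \<open>c0\<close>.
  The first parts, together with \<open>c0 \<otimes> d0\<close>, form a vector \<open>Y1\<close> over \<open>W\<close>, to which the bound for
  positive functionals on the source applies; the remainders form a shorter vector \<open>y'\<close>, to which the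
  induction hypothesis applies. Since \<open>W\<close> is invariant, the images of \<open>Y1\<close> and \<open>y'\<close> are almost
  orthogonal too, so the two bounds combine by Pythagoras up to an error that tends to 0.
\<close>

lemma gns_norm_hom_bound:
  assumes f: "star_hom f" and \<phi>: "pos_fun \<phi>" and \<psi>: "pos_fun \<psi>" and K: "0 \<le> K"
    and bound: "\<And>\<phi>' y. pos_fun \<phi>' \<Longrightarrow> gns_norm \<phi>' \<psi> (tmult x y) \<le> K * gns_norm \<phi>' \<psi> y"
    and unit: "\<forall>(c, d)\<in>set y. f 1 * c = c"
  shows "gns_norm \<phi> \<psi> (tmult (map (apfst f) x) y) \<le> K * gns_norm \<phi> \<psi> y"
  using unit
proof (induction y rule: length_induct)
  case (1 y)
  let ?F = "map (apfst f)" and ?g = "gns_norm \<phi> \<psi>" and ?N = "\<lambda>d. sqrt (Re (\<psi> (d\<^sup>\<star> * d)))"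
  show ?case
  proof (cases y)
    case Nil
    then show ?thesis by simp
  next
    case (Cons p ys)
    obtain c0 d0 where y: "y = (c0, d0) # ys" using Cons by (cases p) auto
    define W where "W = range (\<lambda>a. f a * c0)"
    have W: "csubspace W"
      unfolding csubspace_def
    proof (intro conjI ballI allI)
      show "0 \<in> W" unfolding W_def by (rule image_eqI[of _ _ 0]) (simp_all add: star_homD[OF f])
    next
      fix v w assume "v \<in> W" "w \<in> W"
      then obtain a b where "v = f a * c0" "w = f b * c0" by (auto simp: W_def)
      then show "v + w \<in> W" unfolding W_def
        by (intro image_eqI[of _ _ "a + b"]) (simp_all add: star_homD[OF f] distrib_right)
    next
      fix k v assume "v \<in> W"
      then obtain a where "v = f a * c0" by (auto simp: W_def)
      then show "k *\<^sub>C v \<in> W" unfolding W_def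
        by (intro image_eqI[of _ _ "k *\<^sub>C a"]) (simp_all add: star_homD[OF f] mult_scaleC_left)
    qed
    define S where "S = tsum (\<lambda>u d. ?N d) ys"
    have N0: "0 \<le> Re (\<psi> (d\<^sup>\<star> * d))" for d using \<psi> nonneg_Reals_of_real(2) by (auto simp: pos_fun_def)
    have S0: "0 \<le> S" unfolding S_def by (induction ys) (auto simp: N0)
    \<comment> \<open>By adjunction the inner product of the images of \<open>Y1\<close> and \<open>y'\<close> is that of \<open>X\<close> applied to \<open>Y1\<close> and \<open>y'\<close>.\<close>
    define X where "X = ?F (tmult (tstar x) x)"
    define L where "L = tsum (\<lambda>a b. norm a * norm b) X"
    have L0: "0 \<le> L" unfolding L_def by (rule tsum_norm_nonneg)
    have unit0: "f 1 * c0 = c0" and unit_ys: "\<forall>(c, d)\<in>set ys. f 1 * c = c" using 1(2) by (auto simp: y)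
    show ?thesis
    proof (rule square_bound_from_perturbation[where S = "2 * S" and L = "2 * (L * S)"])
      fix \<delta> :: real assume \<delta>: "0 < \<delta>"
      have "\<forall>c. \<exists>a. \<forall>v\<in>W. (cmod (\<phi> (v\<^sup>\<star> * (c - f a * c0))))\<^sup>2 \<le> \<delta>\<^sup>2 * Re (\<phi> (v\<^sup>\<star> * v))"
      proof
        fix c
        obtain w where w: "w \<in> W" "\<And>v. v \<in> W \<Longrightarrow> (cmod (\<phi> (v\<^sup>\<star> * (c - w))))\<^sup>2 \<le> \<delta>\<^sup>2 * Re (\<phi> (v\<^sup>\<star> * v))"
          using approximate_projection[OF \<phi> W, of "\<delta>\<^sup>2" c] \<delta> by auto
        from w(1) obtain a where "w = f a * c0" by (auto simp: W_def)
        then show "\<exists>a. \<forall>v\<in>W. (cmod (\<phi> (v\<^sup>\<star> * (c - f a * c0))))\<^sup>2 \<le> \<delta>\<^sup>2 * Re (\<phi> (v\<^sup>\<star> * v))"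
          using w(2) by blast
      qed
      from choice[OF this]
      obtain \<alpha> where \<alpha>: "\<And>c v. v \<in> W \<Longrightarrow> (cmod (\<phi> (v\<^sup>\<star> * (c - f (\<alpha> c) * c0))))\<^sup>2 \<le> \<delta>\<^sup>2 * Re (\<phi> (v\<^sup>\<star> * v))"
        by blast
      define y1 where "y1 = (1, d0) # map (\<lambda>(c, d). (\<alpha> c, d)) ys"
      define Y1 where "Y1 = map (\<lambda>(a, d). (f a * c0, d)) y1"
      define y' where "y' = map (\<lambda>(c, d). (c - f (\<alpha> c) * c0, d)) ys"
      define p where "p = ?g Y1"
      define q where "q = ?g y'"
      have p0: "0 \<le> p" "0 \<le> q" by (simp_all add: p_def q_def gns_norm_nonneg[OF \<phi> \<psi>])
      have split: "teq y (Y1 @ y')"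
      proof (rule teqI)
        fix g :: "'b \<Rightarrow> 'c \<Rightarrow> complex" assume g: "cbilinear g"
        have "tsum g ys = tsum g (map (\<lambda>(a, d). (f a * c0, d)) (map (\<lambda>(c, d). (\<alpha> c, d)) ys))
            + tsum g (map (\<lambda>(c, d). (c - f (\<alpha> c) * c0, d)) ys)"
        proof (induction ys)
          case (Cons r ys)
          obtain c d where r: "r = (c, d)" by (cases r)
          have "g c d = g (f (\<alpha> c) * c0) d + g (c - f (\<alpha> c) * c0) d"
            using cbilinearD(1)[OF g, of "f (\<alpha> c) * c0" "c - f (\<alpha> c) * c0" d] by simp
          then show ?case by (simp add: r Cons.IH)
        qed simp
        then show "tsum g y = tsum g (Y1 @ y')" by (simp add: y Y1_def y1_def y'_def unit0)
      qed
      have orth: "\<forall>(u, d)\<in>set y'. \<forall>v\<in>W. (cmod (\<phi> (v\<^sup>\<star> * u)))\<^sup>2 \<le> \<delta>\<^sup>2 * Re (\<phi> (v\<^sup>\<star> * v))"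
        using \<alpha> by (auto simp: y'_def)
      have Sy': "tsum (\<lambda>u d. ?N d) y' = S" unfolding y'_def S_def by (induction ys) auto
      have cross: "cmod (ip \<phi> \<psi> V y') \<le> \<delta> * ?g V * S" if "V = map (\<lambda>(a, d). (f a * c0, d)) z" for V z
      proof -
        have "\<forall>(a, b)\<in>set V. a \<in> W" by (auto simp: that W_def)
        from ip_almost_orthogonal[OF \<phi> \<psi> W this _ orth] show ?thesis using \<delta> by (simp add: Sy')
      qed
      have sq: "(?g (u @ v))\<^sup>2 = (?g u)\<^sup>2 + (?g v)\<^sup>2 + 2 * Re (ip \<phi> \<psi> u v)" for u v
        using ip_cs(1)[OF \<phi> \<psi>, of v u] by (simp add: gns_norm_sq[OF \<phi> \<psi>] ip_append)
      have "\<bar>Re (ip \<phi> \<psi> Y1 y')\<bar> \<le> \<delta> * p * S"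
        using cross[of Y1 y1] abs_Re_le_cmod[of "ip \<phi> \<psi> Y1 y'"] by (simp add: Y1_def p_def)
      moreover have "(?g y)\<^sup>2 = p\<^sup>2 + q\<^sup>2 + 2 * Re (ip \<phi> \<psi> Y1 y')"
        using sq[of Y1 y'] gns_norm_teq[OF \<phi> \<psi> split] by (simp add: p_def q_def)
      ultimately have le1: "p\<^sup>2 + q\<^sup>2 \<le> (?g y)\<^sup>2 + \<delta> * p * (2 * S)" by (simp add: algebra_simps abs_le_iff)
      have hom: "\<And>a a'. f (a * a') = f a * f a'" by (rule star_homD(2)[OF f])
      have "?g (tmult (?F x) Y1) \<le> K * p"
        unfolding p_def Y1_def tmult_map_hom[OF hom] gns_norm_vector_functional[OF f]
        by (rule bound[OF vector_functional[OF f \<phi>]])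
      then have a: "(?g (tmult (?F x) Y1))\<^sup>2 \<le> K\<^sup>2 * p\<^sup>2"
        using power_mono[OF _ gns_norm_nonneg[OF \<phi> \<psi>], of _ "K * p" 2] by (simp add: power_mult_distrib)
      have "length y' < length y" by (simp add: y'_def y)
      moreover have "\<forall>(c, d)\<in>set y'. f 1 * c = c"
        using unit_ys by (auto simp: y'_def right_diff_distrib mult.assoc[symmetric] hom[symmetric])
      ultimately have "?g (tmult (?F x) y') \<le> K * q" using 1(1) by (simp add: q_def)
      then have b: "(?g (tmult (?F x) y'))\<^sup>2 \<le> K\<^sup>2 * q\<^sup>2"
        using power_mono[OF _ gns_norm_nonneg[OF \<phi> \<psi>], of _ "K * q" 2] by (simp add: power_mult_distrib)
      have "ip \<phi> \<psi> (tmult (?F x) Y1) (tmult (?F x) y') = ip \<phi> \<psi> (tmult (tstar (?F x)) (tmult (?F x) Y1)) y'"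
        unfolding ip_adj[OF \<phi> \<psi>, of "tstar (?F x)"] by simp
      also have "tstar (?F x) = ?F (tstar x)" by (induction x) (auto simp: star_homD[OF f])
      also have "tmult (?F (tstar x)) (tmult (?F x) Y1) = tmult X Y1"
      proof -
        have "tmult (?F (tstar x)) (tmult (?F x) Y1) = map (\<lambda>(a, d). (f a * c0, d)) (tmult (tstar x) (tmult x y1))"
          by (simp only: Y1_def tmult_map_hom[OF hom])
        moreover have "tmult X Y1 = map (\<lambda>(a, d). (f a * c0, d)) (tmult (tmult (tstar x) x) y1)"
          by (simp only: X_def Y1_def tmult_map_hom[OF hom])
        ultimately show ?thesis by (simp only: tmult_assoc)
      qed
      finally have ipX: "ip \<phi> \<psi> (tmult (?F x) Y1) (tmult (?F x) y') = ip \<phi> \<psi> (tmult X Y1) y'" .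
      have "cmod (ip \<phi> \<psi> (tmult X Y1) y') \<le> \<delta> * ?g (tmult X Y1) * S"
        by (rule cross[of _ "tmult (tmult (tstar x) x) y1"]) (simp only: X_def Y1_def tmult_map_hom[OF hom])
      also have "\<dots> \<le> \<delta> * (L * p) * S"
        unfolding L_def p_def using \<delta> S0 gns_norm_tmult_bound[OF \<phi> \<psi>] by (intro mult_right_mono mult_left_mono) auto
      finally have c: "Re (ip \<phi> \<psi> (tmult X Y1) y') \<le> \<delta> * (L * p) * S"
        using complex_Re_le_cmod[of "ip \<phi> \<psi> (tmult X Y1) y'"] by simp
      have "teq (tmult (?F x) y) (tmult (?F x) Y1 @ tmult (?F x) y')"
        by (rule teq_trans[OF teq_tmult[OF teq_refl split] teq_tmult_append])
      then have "(?g (tmult (?F x) y))\<^sup>2 = (?g (tmult (?F x) Y1))\<^sup>2 + (?g (tmult (?F x) y'))\<^sup>2 + 2 * Re (ip \<phi> \<psi> (tmult X Y1) y')"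
        using gns_norm_teq[OF \<phi> \<psi>] by (simp add: sq ipX)
      also have "\<dots> \<le> K\<^sup>2 * (p\<^sup>2 + q\<^sup>2) + \<delta> * p * (2 * (L * S))"
        using a b c by (simp add: algebra_simps)
      finally show "\<exists>p q. 0 \<le> p \<and> 0 \<le> q \<and> p\<^sup>2 + q\<^sup>2 \<le> (?g y)\<^sup>2 + \<delta> * p * (2 * S) \<and>
          (?g (tmult (?F x) y))\<^sup>2 \<le> K\<^sup>2 * (p\<^sup>2 + q\<^sup>2) + \<delta> * p * (2 * (L * S))"
        using p0 le1 by blast
    qed (simp_all add: K S0 L0 gns_norm_nonneg[OF \<phi> \<psi>])
  qed
qed

lemma gns_norm_scale_functional:
  assumes "0 \<le> k"
  shows "gns_norm (\<lambda>a. complex_of_real k * \<phi> a) \<psi> z = sqrt k * gns_norm \<phi> \<psi> z"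
proof -
  have "ip (\<lambda>a. complex_of_real k * \<phi> a) \<psi> z z = complex_of_real k * ip \<phi> \<psi> z z"
    by (simp add: ip_eq mult.assoc tsum_left)
  then show ?thesis by (simp add: gns_norm_ip real_sqrt_mult)
qed

text \<open>
  The spatial norm is defined by states, but the functionals produced by \<open>vector_functional\<close> are only
  positive: normalise, or observe that a positive functional vanishing at 1 is 0 by Cauchy-Schwarz.
\<close>

lemma gns_norm_pos_fun_upper:
  assumes \<phi>: "pos_fun \<phi>" and \<psi>: "state \<psi>"
  shows "gns_norm \<phi> \<psi> (tmult x y) \<le> spatial_norm x * gns_norm \<phi> \<psi> y"
proof -
  define k where "k = Re (\<phi> 1)"
  have "\<phi> (1\<^sup>\<star> * 1) \<in> \<real>\<^sub>\<ge>\<^sub>0" using \<phi> unfolding pos_fun_def by blast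
  then have k: "\<phi> 1 = complex_of_real k" "0 \<le> k"
    using nonneg_Reals_of_real by (auto simp: k_def)
  show ?thesis
  proof (cases "k = 0")
    case True
    have "\<phi> a = 0" for a using pos_fun_cs(2)[OF \<phi>, of 1 a] True by (simp add: k_def)
    then have "gns_norm \<phi> \<psi> z = 0" for z by (simp add: gns_norm_ip ip_eq)
    then show ?thesis by simp
  next
    case False
    define \<phi>' where "\<phi>' a = complex_of_real (1 / k) * \<phi> a" for a
    have "state \<phi>'"
      unfolding state_def
    proof (intro conjI allI)
      show "cbounded_linear \<phi>'"
        unfolding \<phi>'_def[abs_def] using \<phi> by (intro cbounded_linear_mult_right) (simp add: pos_fun_def)
      show "\<phi>' (a\<^sup>\<star> * a) \<in> \<real>\<^sub>\<ge>\<^sub>0" for a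
        unfolding \<phi>'_def using \<phi> k by (intro nonneg_Reals_mult_I) (auto simp: pos_fun_def)
      show "\<phi>' 1 = 1" using False k by (simp add: \<phi>'_def)
    qed
    from spatial_norm_upper[OF this \<psi>, of x y]
    have "sqrt (1 / k) * gns_norm \<phi> \<psi> (tmult x y) \<le> sqrt (1 / k) * (spatial_norm x * gns_norm \<phi> \<psi> y)"
      using k gns_norm_scale_functional[of "1 / k" \<phi> \<psi>] by (simp add: \<phi>'_def[abs_def] mult_ac)
    then show ?thesis using False k by simp
  qed
qed

lemma norm_projection_le_1:
  fixes p :: "'a::pre_cstar_algebra"
  assumes "p\<^sup>\<star> * p = p" shows "norm p \<le> 1"
proof -
  have "norm p * norm p = norm p" using cstar_identity[of p] assms by (simp add: power2_eq_square)
  then show ?thesis by (cases "norm p = 0") auto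
qed

text \<open>
  A *-homomorphism need not be unital, and the inclusions of the summands are not. The image of \<open>x\<close> only
  sees the part \<open>(f 1 \<otimes> 1) y\<close> of a vector \<open>y\<close>, which is not longer than \<open>y\<close> since \<open>f 1\<close> is a
  projection, and on which \<open>f 1\<close> acts as a unit.
\<close>

lemma spatial_norm_map_fst:
  fixes f :: "'a::cstar_algebra \<Rightarrow> 'b::cstar_algebra" and x :: "('a \<times> 'c::cstar_algebra) list"
  assumes f: "star_hom f"
  shows "spatial_norm (map (apfst f) x) \<le> spatial_norm x"
proof (rule spatial_norm_least)
  fix \<phi> :: "'b \<Rightarrow> complex" and \<psi> :: "'c \<Rightarrow> complex" and y :: "('b \<times> 'c) list"
  assume \<psi>': "state \<psi>" and \<phi>: "pos_fun \<phi>" and \<psi>: "pos_fun \<psi>"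
  define y1 where "y1 = tmult [(f 1, 1)] y"
  have f11: "f 1 * f 1 = f 1" "(f 1)\<^sup>\<star> = f 1" using star_homD(2,3)[OF f, of 1] star_homD(2)[OF f, of 1 1] by auto
  have unit: "\<forall>(c, d)\<in>set y1. f 1 * c = c"
  proof -
    have "\<forall>(c, d)\<in>set (tmult [(f 1, 1)] y). f 1 * c = c"
      by (induction y) (auto simp: mult.assoc[symmetric] f11)
    then show ?thesis by (simp add: y1_def)
  qed
  have "tmult (map (apfst f) x) [(f 1, 1)] = map (apfst f) x"
    by (induction x) (auto simp: star_homD(2)[OF f, symmetric] tmult_def)
  then have "tmult (map (apfst f) x) y = tmult (map (apfst f) x) y1"
    unfolding y1_def by (metis tmult_assoc)
  then have "gns_norm \<phi> \<psi> (tmult (map (apfst f) x) y) = gns_norm \<phi> \<psi> (tmult (map (apfst f) x) y1)" by simp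
  also have "\<dots> \<le> spatial_norm x * gns_norm \<phi> \<psi> y1"
    by (rule gns_norm_hom_bound[OF f \<phi> \<psi> _ _ unit]) (auto intro: gns_norm_pos_fun_upper \<psi>')
  also have "\<dots> \<le> spatial_norm x * gns_norm \<phi> \<psi> y"
  proof (rule mult_left_mono)
    have "gns_norm \<phi> \<psi> y1 \<le> norm (f 1) * gns_norm \<phi> \<psi> y"
      unfolding y1_def by (rule gns_norm_single1[OF \<phi> \<psi>])
    also have "\<dots> \<le> gns_norm \<phi> \<psi> y"
      using norm_projection_le_1[of "f 1"] gns_norm_nonneg[OF \<phi> \<psi>, of y] by (simp add: f11 mult_left_le_one_le)
    finally show "gns_norm \<phi> \<psi> y1 \<le> gns_norm \<phi> \<psi> y" .
  qed simp
  finally show "gns_norm \<phi> \<psi> (tmult (map (apfst f) x) y) \<le> spatial_norm x * gns_norm \<phi> \<psi> y" .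
qed simp

lemma spatial_norm_swap: "spatial_norm (map prod.swap x) = spatial_norm x"
proof -
  have sw: "gns_norm \<psi> \<phi> (map prod.swap z) = gns_norm \<phi> \<psi> z" for \<psi> \<phi> and z :: "('c::cstar_algebra \<times> 'd::cstar_algebra) list"
    by (simp add: gns_norm_ip ip_swap)
  have le: "spatial_norm (map prod.swap x) \<le> spatial_norm x" for x :: "('c::cstar_algebra \<times> 'd::cstar_algebra) list"
  proof (rule spatial_norm_least)
    fix \<phi> :: "'d \<Rightarrow> complex" and \<psi> :: "'c \<Rightarrow> complex" and y :: "('d \<times> 'c) list"
  assume s: "state \<phi>" "state \<psi>"
    show "gns_norm \<phi> \<psi> (tmult (map prod.swap x) y) \<le> spatial_norm x * gns_norm \<phi> \<psi> y"
      using spatial_norm_upper[OF s(2,1), of x "map prod.swap y"] sw[of \<phi> \<psi> "tmult x (map prod.swap y)"]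
        sw[of \<phi> \<psi> "map prod.swap y"] tmult_swap[of x "map prod.swap y"]
      by simp
  qed simp
  from le[of x] le[of "map prod.swap x"] show ?thesis by simp
qed

lemma spatial_norm_map_prod:
  assumes "star_hom f" "star_hom g"
  shows "spatial_norm (map (map_prod f g) x) \<le> spatial_norm x"
proof -
  have "map (map_prod f g) x = map (apfst f) (map prod.swap (map (apfst g) (map prod.swap x)))"
    by (induction x) auto
  then have "spatial_norm (map (map_prod f g) x) \<le> spatial_norm (map (apfst g) (map prod.swap x))"
    using spatial_norm_map_fst[OF assms(1)] spatial_norm_swap by metis
  also have "\<dots> \<le> spatial_norm x"
    using spatial_norm_map_fst[OF assms(2), of "map prod.swap x"] by (simp only: spatial_norm_swap)
  finally show ?thesis .
qed

section \<open>Maps of spatial tensor products\<close>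

lemma to_completion_hom:
  "to_completion (x * y) = to_completion x * to_completion y"
  "to_completion (x\<^sup>\<star>) = (to_completion x)\<^sup>\<star>"
  "to_completion (c *\<^sub>C x) = c *\<^sub>C to_completion x"
  "to_completion 1 = 1"
  by (transfer, rule cauchy_rel_const)+

lemma abs_alg_tensor_teq: "teq x y \<Longrightarrow> abs_alg_tensor x = abs_alg_tensor y"
  by (simp add: alg_tensor.abs_eq_iff teq_spatial_eq)

lemma tensor_add_left: "(a + a') \<otimes> b = a \<otimes> b + a' \<otimes> b"
proof -
  have "abs_alg_tensor [(a + a', b)] = abs_alg_tensor [(a, b)] + abs_alg_tensor [(a', b)]"
    unfolding plus_alg_tensor.abs_eq by (rule abs_alg_tensor_teq[OF teqI]) (simp add: cbilinearD)
  then show ?thesis by (simp add: tensor_def to_completion_add)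
qed

lemma tensor_add_right: "a \<otimes> (b + b') = a \<otimes> b + a \<otimes> b'"
proof -
  have "abs_alg_tensor [(a, b + b')] = abs_alg_tensor [(a, b)] + abs_alg_tensor [(a, b')]"
    unfolding plus_alg_tensor.abs_eq by (rule abs_alg_tensor_teq[OF teqI]) (simp add: cbilinearD)
  then show ?thesis by (simp add: tensor_def to_completion_add)
qed

lemma tensor_scaleC_left: "(c *\<^sub>C a) \<otimes> b = c *\<^sub>C (a \<otimes> b)"
proof -
  have "abs_alg_tensor [(c *\<^sub>C a, b)] = c *\<^sub>C abs_alg_tensor [(a, b)]"
    by (simp add: scaleC_alg_tensor.abs_eq)
  then show ?thesis by (simp only: tensor_def to_completion_hom)
qed

lemma tensor_scaleC_right: "a \<otimes> (c *\<^sub>C b) = c *\<^sub>C (a \<otimes> b)"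
proof -
  have "abs_alg_tensor [(a, c *\<^sub>C b)] = c *\<^sub>C abs_alg_tensor [(a, b)]"
    unfolding scaleC_alg_tensor.abs_eq by (rule abs_alg_tensor_teq[OF teqI]) (simp add: cbilinearD)
  then show ?thesis by (simp only: tensor_def to_completion_hom)
qed

lemma tensor_mult_tensor: "(a \<otimes> b) * (c \<otimes> d) = (a * c) \<otimes> (b * d)"
proof -
  have "abs_alg_tensor [(a, b)] * abs_alg_tensor [(c, d)] = abs_alg_tensor [(a * c, b * d)]"
    by (simp add: times_alg_tensor.abs_eq)
  then show ?thesis by (simp only: tensor_def flip: to_completion_hom)
qed

lemma tensor_star: "(a \<otimes> b)\<^sup>\<star> = a\<^sup>\<star> \<otimes> b\<^sup>\<star>"
proof -
  have "(abs_alg_tensor [(a, b)])\<^sup>\<star> = abs_alg_tensor [(a\<^sup>\<star>, b\<^sup>\<star>)]"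
    by (simp add: inv_star_alg_tensor.abs_eq)
  then show ?thesis by (simp only: tensor_def flip: to_completion_hom)
qed

lemma tensor_one: "1 \<otimes> 1 = 1"
  by (simp add: tensor_def to_completion_hom flip: one_alg_tensor_def)

lemma norm_tensor_le: "norm (a \<otimes> b) \<le> norm a * norm b"
  using norm_tsum_tensor[of "[(a, b)]"] spatial_norm_single[of a b] by simp

lemma tensor_scaleR:
  "(r *\<^sub>R a) \<otimes> b = r *\<^sub>R (a \<otimes> b)" "a \<otimes> (r *\<^sub>R b) = r *\<^sub>R (a \<otimes> b)"
  by (simp_all add: scaleR_scaleC tensor_scaleC_left tensor_scaleC_right)

lemma cbounded_linear_tensor_left: "cbounded_linear (\<lambda>a. a \<otimes> b)"
  unfolding cbounded_linear_def
  by (auto intro!: bounded_linear_intro[where K = "norm b"]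
      simp: tensor_add_left tensor_scaleC_left norm_tensor_le tensor_scaleR)

lemma cbounded_linear_tensor_right: "cbounded_linear (\<lambda>b. a \<otimes> b)"
  unfolding cbounded_linear_def
  by (auto intro!: bounded_linear_intro[where K = "norm a"]
      simp: tensor_add_right tensor_scaleC_right norm_tensor_le tensor_scaleR mult.commute[of "norm _" "norm a"])

lemma tensor_zero [simp]: "0 \<otimes> b = 0" "a \<otimes> 0 = 0"
  using cbounded_linearD(3)[OF cbounded_linear_tensor_left] cbounded_linearD(3)[OF cbounded_linear_tensor_right]
  by auto

lemma star_hom_tensor_unit: "star_hom (\<lambda>a. a \<otimes> 1)" "star_hom (\<lambda>b. 1 \<otimes> b)"
  by (simp_all add: star_hom_def cbounded_linear_tensor_left cbounded_linear_tensor_right tensor_mult_tensor tensor_star)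

lemma tensor_eqI:
  assumes "cbounded_linear F" "cbounded_linear G" "\<And>a b. F (a \<otimes> b) = G (a \<otimes> b)"
  shows "F \<xi> = G \<xi>"
  using tensor_ext_unique[OF assms] by simp

lemma tensor_map:
  assumes f: "star_hom f" and g: "star_hom g"
  shows cbounded_linear_tensor_map: "cbounded_linear (tensor_map f g)"
    and tensor_map_tensor: "tensor_map f g (a \<otimes> b) = f a \<otimes> g b"
proof -
  have sc: "f (c *\<^sub>C a) \<otimes> g b = c *\<^sub>C (f a \<otimes> g b)" for c a b
    by (simp add: star_homD[OF f] tensor_scaleC_left)
  have bd: "norm (tsum (\<lambda>a b. f a \<otimes> g b) x) \<le> 1 * spatial_norm x" for x
  proof -
    have "tsum (\<lambda>a b. f a \<otimes> g b) x = tsum (\<otimes>) (map (map_prod f g) x)" by (induction x) auto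
    then show ?thesis using spatial_norm_map_prod[OF f g, of x] by (simp add: norm_tsum_tensor)
  qed
  show "cbounded_linear (tensor_map f g)" "tensor_map f g (a \<otimes> b) = f a \<otimes> g b"
    unfolding tensor_map_def using tensor_extend[OF sc bd] by auto
qed

text \<open>
  Both sides of multiplicativity are continuous and linear in each variable separately, so comparing them
  on elementary tensors in one variable at a time is enough.
\<close>

lemma star_hom_tensor_map:
  assumes f: "star_hom f" and g: "star_hom g"
  shows "star_hom (tensor_map f g)"
proof -
  note F = cbounded_linear_tensor_map[OF f g] and Ft = tensor_map_tensor[OF f g]
  have 1: "tensor_map f g (\<xi> * (c \<otimes> d)) = tensor_map f g \<xi> * tensor_map f g (c \<otimes> d)" for \<xi> c d
  proof (rule tensor_eqI[of "\<lambda>\<xi>. tensor_map f g (\<xi> * (c \<otimes> d))"])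
    show "cbounded_linear (\<lambda>\<xi>. tensor_map f g (\<xi> * (c \<otimes> d)))"
      by (rule cbounded_linear_compose[OF F]) (simp add: cbounded_linear_mult_left)
    show "cbounded_linear (\<lambda>\<xi>. tensor_map f g \<xi> * tensor_map f g (c \<otimes> d))"
      by (rule cbounded_linear_mult_left[OF F])
  qed (simp add: Ft tensor_mult_tensor star_homD[OF f] star_homD[OF g])
  have 2: "tensor_map f g (\<xi> * \<eta>) = tensor_map f g \<xi> * tensor_map f g \<eta>" for \<xi> \<eta>
  proof (rule tensor_eqI[of "\<lambda>\<eta>. tensor_map f g (\<xi> * \<eta>)"])
    show "cbounded_linear (\<lambda>\<eta>. tensor_map f g (\<xi> * \<eta>))"
      by (rule cbounded_linear_compose[OF F]) (simp add: cbounded_linear_mult_right)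
    show "cbounded_linear (\<lambda>\<eta>. tensor_map f g \<xi> * tensor_map f g \<eta>)"
      by (rule cbounded_linear_mult_right[OF F])
  qed (rule 1)
  have "(tensor_map f g (\<xi>\<^sup>\<star>))\<^sup>\<star> = tensor_map f g \<xi>" for \<xi>
    by (rule tensor_eqI[of "\<lambda>\<xi>. (tensor_map f g (\<xi>\<^sup>\<star>))\<^sup>\<star>"])
      (simp_all add: cbounded_linear_star_conj F Ft tensor_star star_homD[OF f] star_homD[OF g] star_star)
  then have 3: "tensor_map f g (\<xi>\<^sup>\<star>) = (tensor_map f g \<xi>)\<^sup>\<star>" for \<xi> by (metis star_star)
  show ?thesis using F 2 3 by (simp add: star_hom_def)
qed

lemma tensor_map_compose:
  assumes "star_hom f" "star_hom g" "star_hom f'" "star_hom g'"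
  shows "tensor_map f g (tensor_map f' g' \<xi>) = tensor_map (\<lambda>a. f (f' a)) (\<lambda>b. g (g' b)) \<xi>"
  by (rule tensor_eqI[of "\<lambda>\<xi>. tensor_map f g (tensor_map f' g' \<xi>)"])
    (simp_all add: assms star_hom_compose tensor_map_tensor cbounded_linear_tensor_map
      cbounded_linear_compose[of "tensor_map f g"])

lemma tensor_map_id: "tensor_map (\<lambda>a. a) (\<lambda>b. b) \<xi> = \<xi>"
  by (rule tensor_eqI[of "tensor_map (\<lambda>a. a) (\<lambda>b. b)"]) (simp_all add: tensor_map_tensor cbounded_linear_tensor_map)

lemma star_hom_zero: "star_hom (\<lambda>a. 0)"
proof -
  have "(0::'b)\<^sup>\<star> = 0" using star_scaleC[of 0 "0::'b"] by simp
  then show ?thesis by (simp add: star_hom_def)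
qed

lemma tensor_map_zero:
  "star_hom g \<Longrightarrow> tensor_map (\<lambda>a. 0) g \<xi> = 0" "star_hom f \<Longrightarrow> tensor_map f (\<lambda>b. 0) \<xi> = 0"
  by (rule tensor_eqI; simp add: tensor_map_tensor cbounded_linear_tensor_map star_hom_zero)+

lemma tensor_map_one: "star_hom f \<Longrightarrow> star_hom g \<Longrightarrow> f 1 = 1 \<Longrightarrow> g 1 = 1 \<Longrightarrow> tensor_map f g 1 = 1"
  using tensor_map_tensor[of f g 1 1] by (simp add: tensor_one)

lemma tensor_flip:
  fixes a :: "'a::cstar_algebra" and b :: "'b::cstar_algebra"
  shows cbounded_linear_tensor_flip: "cbounded_linear (tensor_flip :: ('a, 'b) spatial_tensor \<Rightarrow> _)"
    and tensor_flip_tensor: "tensor_flip (a \<otimes> b) = b \<otimes> a"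
proof -
  have bd: "norm (tsum (\<lambda>a b. b \<otimes> a) x) \<le> 1 * spatial_norm x" for x :: "('a \<times> 'b) list"
  proof -
    have "tsum (\<lambda>a b. b \<otimes> a) x = tsum (\<otimes>) (map prod.swap x)" by (induction x) auto
    then show ?thesis by (simp add: norm_tsum_tensor spatial_norm_swap)
  qed
  show "cbounded_linear (tensor_flip :: ('a, 'b) spatial_tensor \<Rightarrow> _)"
    "tensor_flip (a \<otimes> b) = b \<otimes> a"
    unfolding tensor_flip_def using tensor_extend[OF tensor_scaleC_right bd] by auto
qed

lemma tensor_flip_map:
  assumes "star_hom f" "star_hom g"
  shows "tensor_flip (tensor_map f g \<xi>) = tensor_map g f (tensor_flip \<xi>)"
  by (rule tensor_eqI)
    (simp_all add: assms cbounded_linear_compose[of tensor_flip] cbounded_linear_compose[of "tensor_map _ _"]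
      cbounded_linear_tensor_flip cbounded_linear_tensor_map tensor_map_tensor tensor_flip_tensor)

lemma tensor_flip_scaleR: "tensor_flip (r *\<^sub>R \<xi>) = r *\<^sub>R tensor_flip \<xi>"
  by (simp add: scaleR_scaleC cbounded_linearD(2)[OF cbounded_linear_tensor_flip])

lemma tensor_flip_one: "tensor_flip 1 = 1"
  using tensor_flip_tensor[of 1 1] by (simp only: tensor_one)

lemma tensor_mult:
  assumes "spatially_continuous_multiplication TYPE('a::cstar_algebra)"
  shows cbounded_linear_tensor_mult: "cbounded_linear (tensor_mult :: ('a, 'a) spatial_tensor \<Rightarrow> 'a)"
    and tensor_mult_elementary: "tensor_mult (a \<otimes> b) = a * (b :: 'a)"
proof -
  obtain C where C: "\<And>x :: ('a \<times> 'a) list. norm (tsum (*) x) \<le> C * spatial_norm x"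
    using assms by (auto simp: spatially_continuous_multiplication_def)
  show "cbounded_linear (tensor_mult :: ('a, 'a) spatial_tensor \<Rightarrow> 'a)" "tensor_mult (a \<otimes> b) = a * b"
    unfolding tensor_mult_def using tensor_extend[OF mult_scaleC_left C] by auto
qed

lemma tensor_mult_map:
  fixes f :: "'a::cstar_algebra \<Rightarrow> 'b::cstar_algebra"
  assumes "spatially_continuous_multiplication TYPE('a)" "spatially_continuous_multiplication TYPE('b)"
    and f: "star_hom f"
  shows "tensor_mult (tensor_map f f \<xi>) = f (tensor_mult \<xi>)"
  by (rule tensor_eqI)
    (simp_all add: assms cbounded_linear_compose[of tensor_mult] cbounded_linear_compose[of f]
      cbounded_linear_tensor_mult cbounded_linear_tensor_map tensor_map_tensor tensor_mult_elementary star_homD[OF f])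

section \<open>Positive elements\<close>

lemma cstar_invertible_uminus: "cstar_invertible (- x) \<longleftrightarrow> cstar_invertible x"
proof -
  have "cstar_invertible (- x)" if "cstar_invertible x" for x :: 'a
  proof -
    from that obtain y where "x * y = 1" "y * x = 1" by (auto simp: cstar_invertible_def)
    then show ?thesis unfolding cstar_invertible_def by (intro exI[of _ "- y"]) simp
  qed
  from this[of x] this[of "- x"] show ?thesis by auto
qed

lemma scaleC_diff_left: "(c - d) *\<^sub>C x = c *\<^sub>C x - d *\<^sub>C (x::'a::pre_cstar_algebra)"
  using scaleC_add_left[of "c - d" d x] by (simp add: algebra_simps)

lemma cstar_invertible_scaleC_one: "c \<noteq> 0 \<Longrightarrow> cstar_invertible (c *\<^sub>C 1)"
  unfolding cstar_invertible_def
  by (intro exI[of _ "(1 / c) *\<^sub>C 1"]) (simp add: mult_scaleC_left scaleC_scaleC)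

lemma star_scaleR_one: "(r *\<^sub>R (1::'a::pre_cstar_algebra))\<^sup>\<star> = r *\<^sub>R 1"
  by (simp add: scaleR_scaleC star_scaleC)

lemma cstar_positive_scaleR_one:
  assumes "0 \<le> r" shows "cstar_positive (r *\<^sub>R (1::'a::cstar_algebra))"
  unfolding cstar_positive_def
proof
  show "cstar_spectrum (r *\<^sub>R (1::'a)) \<subseteq> \<real>\<^sub>\<ge>\<^sub>0"
  proof
    fix c assume "c \<in> cstar_spectrum (r *\<^sub>R (1::'a))"
    then have "\<not> cstar_invertible ((c - complex_of_real r) *\<^sub>C (1::'a))"
      by (simp add: cstar_spectrum_def scaleR_scaleC scaleC_diff_left)
    then have "c = complex_of_real r" using cstar_invertible_scaleC_one[of "c - complex_of_real r"] by auto
    then show "c \<in> \<real>\<^sub>\<ge>\<^sub>0" using assms by simp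
  qed
qed (rule star_scaleR_one)

text \<open>
  The Neumann series in disguise: right and left inverses are the fixed points of the contractions
  \<open>y \<mapsto> 1 + x y\<close> and \<open>z \<mapsto> 1 + z x\<close>.
\<close>

lemma cstar_invertible_one_minus:
  fixes x :: "'a::cstar_algebra"
  assumes "norm x < 1" shows "cstar_invertible (1 - x)"
proof -
  have "\<forall>y z. dist (1 + x * y) (1 + x * z) \<le> norm x * dist y z"
    by (simp add: dist_norm norm_mult_ineq flip: right_diff_distrib)
  from banach_fix_type[OF norm_ge_zero assms this] obtain y where y: "1 + x * y = y" by blast
  have "\<forall>y z. dist (1 + y * x) (1 + z * x) \<le> norm x * dist y z"
    using norm_mult_ineq[of _ x] by (simp add: dist_norm mult.commute[of "norm x"] flip: left_diff_distrib)
  from banach_fix_type[OF norm_ge_zero assms this] obtain z where z: "1 + z * x = z" by blast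
  have a: "(1 - x) * y = 1" using y by (simp add: algebra_simps)
  have b: "z * (1 - x) = 1" using z by (simp add: algebra_simps)
  have "z = z * ((1 - x) * y)" by (simp add: a)
  also have "\<dots> = y" by (simp only: mult.assoc[symmetric] b mult_1)
  finally show ?thesis using a b by (auto simp: cstar_invertible_def)
qed

lemma cstar_spectrum_bounded:
  fixes x :: "'a::cstar_algebra"
  assumes "c \<in> cstar_spectrum x" shows "cmod c \<le> norm x"
proof (rule ccontr)
  assume "\<not> cmod c \<le> norm x"
  then have lt: "norm x < cmod c" by simp
  then have c: "c \<noteq> 0" by auto
  have "norm ((1 / c) *\<^sub>C x) < 1" using lt c by (simp add: norm_scaleC norm_divide divide_simps)
  then have "cstar_invertible (1 - (1 / c) *\<^sub>C x)" by (rule cstar_invertible_one_minus)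
  then obtain y where y: "(1 - (1 / c) *\<^sub>C x) * y = 1" "y * (1 - (1 / c) *\<^sub>C x) = 1"
    by (auto simp: cstar_invertible_def)
  have e: "c *\<^sub>C 1 - x = c *\<^sub>C (1 - (1 / c) *\<^sub>C x)"
    using c bounded_linear.linear[OF bounded_linear_scaleC[of c], THEN linear_diff, of 1 "(1 / c) *\<^sub>C x"] by (simp add: scaleC_scaleC)
  have "(c *\<^sub>C 1 - x) * ((1 / c) *\<^sub>C y) = 1" "((1 / c) *\<^sub>C y) * (c *\<^sub>C 1 - x) = 1"
    using y c unfolding e by (simp_all add: mult_scaleC_left mult_scaleC_right scaleC_scaleC)
  then have "cstar_invertible (c *\<^sub>C 1 - x)" by (auto simp: cstar_invertible_def)
  then show False using assms by (simp add: cstar_spectrum_def)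
qed

text \<open>
  The spectrum of \<open>x\<close> lies in \<open>[0, \<parallel>x\<parallel>]\<close>, and \<open>t \<mapsto> s - t\<close> maps it onto the spectrum of \<open>s - x\<close>.
\<close>

lemma cstar_positive_norm_complement:
  assumes x: "cstar_positive x" and s: "norm x \<le> s"
  shows "cstar_positive (s *\<^sub>R 1 - x)"
  unfolding cstar_positive_def
proof
  have "(s *\<^sub>R 1 - x)\<^sup>\<star> = (s *\<^sub>R 1)\<^sup>\<star> + (- x)\<^sup>\<star>" by (simp flip: star_add)
  then show "(s *\<^sub>R 1 - x)\<^sup>\<star> = s *\<^sub>R 1 - x"
    using x by (simp only: star_scaleR_one star_minus) (simp add: cstar_positive_def)
  show "cstar_spectrum (s *\<^sub>R 1 - x) \<subseteq> \<real>\<^sub>\<ge>\<^sub>0"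
  proof
    fix c assume "c \<in> cstar_spectrum (s *\<^sub>R 1 - x)"
    moreover have "c *\<^sub>C 1 - (s *\<^sub>R 1 - x) = - ((complex_of_real s - c) *\<^sub>C 1 - x)"
      by (simp add: scaleR_scaleC scaleC_diff_left)
    ultimately have d: "complex_of_real s - c \<in> cstar_spectrum x"
      unfolding cstar_spectrum_def mem_Collect_eq by (metis cstar_invertible_uminus)
    then have "complex_of_real s - c \<in> \<real>\<^sub>\<ge>\<^sub>0" using x by (auto simp: cstar_positive_def)
    moreover have "cmod (complex_of_real s - c) \<le> s" using cstar_spectrum_bounded[OF d] s by simp
    ultimately show "c \<in> \<real>\<^sub>\<ge>\<^sub>0"
      using complex_Re_le_cmod[of "complex_of_real s - c"] by (auto simp: complex_nonneg_Reals_iff)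
  qed
qed

lemma cstar_invertible_hom:
  assumes f: "star_hom f" "f 1 = 1" and x: "cstar_invertible x" shows "cstar_invertible (f x)"
proof -
  from x obtain y where "x * y = 1" "y * x = 1" by (auto simp: cstar_invertible_def)
  then have "f x * f y = 1" "f y * f x = 1" by (simp_all add: f flip: star_homD(2)[OF f(1)])
  then show ?thesis by (auto simp: cstar_invertible_def)
qed

text \<open>
  A unital homomorphism maps inverses to inverses and so shrinks the spectrum.
\<close>

lemma cstar_positive_hom:
  assumes f: "star_hom f" "f 1 = 1" and x: "cstar_positive x" shows "cstar_positive (f x)"
proof -
  have "cstar_spectrum (f x) \<subseteq> cstar_spectrum x"
  proof
    fix c assume "c \<in> cstar_spectrum (f x)"
    then have "\<not> cstar_invertible (f (c *\<^sub>C 1 - x))" by (simp add: cstar_spectrum_def star_homD[OF f(1)] f(2))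
    then show "c \<in> cstar_spectrum x" using cstar_invertible_hom[OF f] by (auto simp: cstar_spectrum_def)
  qed
  then show ?thesis using x by (auto simp: cstar_positive_def simp flip: star_homD(3)[OF f(1)])
qed

lemma cstar_invertible_scalar_plus_positive:
  assumes x: "cstar_positive x" and r: "0 < r" shows "cstar_invertible (r *\<^sub>R 1 + x)"
proof -
  have "- complex_of_real r \<notin> cstar_spectrum x"
    using x r by (auto simp: cstar_positive_def complex_nonneg_Reals_iff subset_iff)
  moreover have "(- complex_of_real r) *\<^sub>C 1 - x = - (r *\<^sub>R 1 + x)"
    using scaleC_diff_left[of 0 "complex_of_real r" "1::'a"] by (simp add: scaleR_scaleC)
  ultimately show ?thesis
    unfolding cstar_spectrum_def mem_Collect_eq by (metis cstar_invertible_uminus)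
qed

section \<open>Internal direct sums\<close>

text \<open>
  An algebra is presented as a direct sum by the projections \<open>p\<close>, \<open>q\<close> and the inclusions \<open>i\<close>, \<open>j\<close>, not
  by an isomorphism with a type of pairs. In this form the notion passes to tensor products by applying
  \<open>tensor_map\<close> to the four maps, and it can be iterated in the threefold tensor product.
\<close>

definition internal_direct_sum ::
  "('x::cstar_algebra \<Rightarrow> 'y::cstar_algebra) \<Rightarrow> ('y \<Rightarrow> 'x) \<Rightarrow> ('x \<Rightarrow> 'z::cstar_algebra) \<Rightarrow> ('z \<Rightarrow> 'x) \<Rightarrow> bool" where
  "internal_direct_sum p i q j \<longleftrightarrow> star_hom p \<and> star_hom i \<and> star_hom q \<and> star_hom j \<and>
     (\<forall>y. p (i y) = y) \<and> (\<forall>z. q (j z) = z) \<and> (\<forall>z. p (j z) = 0) \<and> (\<forall>y. q (i y) = 0) \<and>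
     (\<forall>x. i (p x) + j (q x) = x)"

lemma internal_direct_sum_hom_one:
  assumes "internal_direct_sum p i q j" shows "p 1 = 1" "q 1 = 1"
proof -
  have h: "star_hom p" "star_hom q" "\<And>y. p (i y) = y" "\<And>z. q (j z) = z"
    using assms by (auto simp: internal_direct_sum_def)
  show "p 1 = 1" using star_homD(2)[OF h(1), of "i 1" 1] h(3) by simp
  show "q 1 = 1" using star_homD(2)[OF h(2), of "j 1" 1] h(4) by simp
qed

lemma internal_direct_sum_eq_iff:
  assumes "internal_direct_sum p i q j" shows "x = y \<longleftrightarrow> p x = p y \<and> q x = q y"
  using assms unfolding internal_direct_sum_def by metis

lemma internal_direct_sum_invertible:
  assumes d: "internal_direct_sum p i q j"
  shows "cstar_invertible x \<longleftrightarrow> cstar_invertible (p x) \<and> cstar_invertible (q x)"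
proof
  note one = internal_direct_sum_hom_one[OF d]
  have h: "star_hom p" "star_hom q" "\<And>y. p (i y) = y" "\<And>z. q (j z) = z" "\<And>z. p (j z) = 0" "\<And>y. q (i y) = 0"
    using d by (auto simp: internal_direct_sum_def)
  {
    assume "cstar_invertible x"
    then show "cstar_invertible (p x) \<and> cstar_invertible (q x)"
      using cstar_invertible_hom[OF h(1) one(1)] cstar_invertible_hom[OF h(2) one(2)] by simp
  next
    assume "cstar_invertible (p x) \<and> cstar_invertible (q x)"
    then obtain u v where uv: "p x * u = 1" "u * p x = 1" "q x * v = 1" "v * q x = 1"
      by (auto simp: cstar_invertible_def)
    have "x * (i u + j v) = 1" "(i u + j v) * x = 1"
      unfolding internal_direct_sum_eq_iff[OF d] by (simp_all add: star_homD[OF h(1)] star_homD[OF h(2)] h one uv)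
    then show "cstar_invertible x" by (auto simp: cstar_invertible_def)
  }
qed

lemma internal_direct_sum_positive:
  assumes d: "internal_direct_sum p i q j"
  shows "cstar_positive x \<longleftrightarrow> cstar_positive (p x) \<and> cstar_positive (q x)"
proof -
  have h: "star_hom p" "star_hom q" using d by (auto simp: internal_direct_sum_def)
  have "cstar_spectrum x = cstar_spectrum (p x) \<union> cstar_spectrum (q x)"
    unfolding cstar_spectrum_def internal_direct_sum_invertible[OF d]
    by (auto simp: star_homD[OF h(1)] star_homD[OF h(2)] internal_direct_sum_hom_one[OF d])
  moreover have "x\<^sup>\<star> = x \<longleftrightarrow> (p x)\<^sup>\<star> = p x \<and> (q x)\<^sup>\<star> = q x"
    unfolding internal_direct_sum_eq_iff[OF d] by (simp add: star_homD[OF h(1)] star_homD[OF h(2)])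
  ultimately show ?thesis by (auto simp: cstar_positive_def)
qed

lemma internal_direct_sum_tensor_left:
  assumes d: "internal_direct_sum p i q j"
  shows "internal_direct_sum (tensor_map p (\<lambda>b. b)) (tensor_map i (\<lambda>b. b)) (tensor_map q (\<lambda>b. b)) (tensor_map j (\<lambda>b. b))"
proof -
  have h: "star_hom p" "star_hom i" "star_hom q" "star_hom j" "\<And>y. p (i y) = y" "\<And>z. q (j z) = z"
    "\<And>z. p (j z) = 0" "\<And>y. q (i y) = 0" "\<And>x. i (p x) + j (q x) = x"
    using d by (auto simp: internal_direct_sum_def)
  have "tensor_map (\<lambda>x. i (p x)) (\<lambda>b. b) \<xi> + tensor_map (\<lambda>x. j (q x)) (\<lambda>b. b) \<xi> = \<xi>" for \<xi> :: "('a, 'd) spatial_tensor"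
    by (rule tensor_eqI[of "\<lambda>\<xi>. tensor_map (\<lambda>x. i (p x)) (\<lambda>b. b) \<xi> + tensor_map (\<lambda>x. j (q x)) (\<lambda>b. b) \<xi>"])
      (simp_all add: cbounded_linear_add cbounded_linear_tensor_map tensor_map_tensor star_hom_compose h
        flip: tensor_add_left)
  then show ?thesis
    by (simp add: internal_direct_sum_def h star_hom_tensor_map tensor_map_compose tensor_map_id tensor_map_zero)
qed

lemma internal_direct_sum_tensor_right:
  assumes d: "internal_direct_sum p i q j"
  shows "internal_direct_sum (tensor_map (\<lambda>b. b) p) (tensor_map (\<lambda>b. b) i) (tensor_map (\<lambda>b. b) q) (tensor_map (\<lambda>b. b) j)"
proof -
  have h: "star_hom p" "star_hom i" "star_hom q" "star_hom j" "\<And>y. p (i y) = y" "\<And>z. q (j z) = z"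
    "\<And>z. p (j z) = 0" "\<And>y. q (i y) = 0" "\<And>x. i (p x) + j (q x) = x"
    using d by (auto simp: internal_direct_sum_def)
  have "tensor_map (\<lambda>b. b) (\<lambda>x. i (p x)) \<xi> + tensor_map (\<lambda>b. b) (\<lambda>x. j (q x)) \<xi> = \<xi>" for \<xi> :: "('d, 'a) spatial_tensor"
    by (rule tensor_eqI[of "\<lambda>\<xi>. tensor_map (\<lambda>b. b) (\<lambda>x. i (p x)) \<xi> + tensor_map (\<lambda>b. b) (\<lambda>x. j (q x)) \<xi>"])
      (simp_all add: cbounded_linear_add cbounded_linear_tensor_map tensor_map_tensor star_hom_compose h
        flip: tensor_add_right)
  then show ?thesis
    by (simp add: internal_direct_sum_def h star_hom_tensor_map tensor_map_compose tensor_map_id tensor_map_zero)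
qed

lemma star_hom_direct_sum:
  "star_hom (dfst :: ('a::cstar_algebra, 'b::cstar_algebra) direct_sum \<Rightarrow> 'a)"
  "star_hom (dsnd :: ('a, 'b) direct_sum \<Rightarrow> 'b)"
  "star_hom (inj_fst :: 'a \<Rightarrow> ('a, 'b) direct_sum)"
  "star_hom (inj_snd :: 'b \<Rightarrow> ('a, 'b) direct_sum)"
proof -
  have z: "(0::'c::pre_cstar_algebra)\<^sup>\<star> = 0" using star_scaleC[of 0 "0::'c"] by simp
  note defs = star_hom_def cbounded_linear_def inj_fst_def inj_snd_def plus_direct_sum_def scaleR_direct_sum_def
    scaleC_direct_sum_def times_direct_sum_def inv_star_direct_sum_def norm_direct_sum_def
  show "star_hom (dfst :: ('a, 'b) direct_sum \<Rightarrow> 'a)" "star_hom (dsnd :: ('a, 'b) direct_sum \<Rightarrow> 'b)"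
    "star_hom (inj_fst :: 'a \<Rightarrow> ('a, 'b) direct_sum)" "star_hom (inj_snd :: 'b \<Rightarrow> ('a, 'b) direct_sum)"
    by (auto simp: defs z intro!: bounded_linear_intro[where K = 1])
qed

lemma direct_sum_proj_inj:
  "dfst (inj_fst a) = a" "dsnd (inj_snd b) = b" "dfst (inj_snd b) = 0" "dsnd (inj_fst a) = 0" "dfst 1 = 1" "dsnd 1 = 1"
  by (simp_all add: inj_fst_def inj_snd_def one_direct_sum_def)

lemma internal_direct_sum_direct_sum: "internal_direct_sum dfst inj_fst dsnd inj_snd"
  by (simp add: internal_direct_sum_def star_hom_direct_sum direct_sum_proj_inj)
    (simp add: inj_fst_def inj_snd_def plus_direct_sum_def)


lemma tensor_direct_sum_positive:
  fixes \<xi> :: "(('a::cstar_algebra, 'b::cstar_algebra) direct_sum, ('c::cstar_algebra, 'd::cstar_algebra) direct_sum) spatial_tensor"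
  shows "cstar_positive \<xi> \<longleftrightarrow> cstar_positive (tensor_map dfst dfst \<xi>) \<and> cstar_positive (tensor_map dfst dsnd \<xi>) \<and>
    cstar_positive (tensor_map dsnd dfst \<xi>) \<and> cstar_positive (tensor_map dsnd dsnd \<xi>)"
  unfolding internal_direct_sum_positive[OF internal_direct_sum_tensor_left[OF internal_direct_sum_direct_sum], of \<xi>]
    internal_direct_sum_positive[OF internal_direct_sum_tensor_right[OF internal_direct_sum_direct_sum], of "tensor_map _ _ \<xi>"]
  by (simp add: tensor_map_compose star_hom_direct_sum)

lemma tensor_direct_sum_invertible:
  fixes \<xi> :: "(('a::cstar_algebra, 'b::cstar_algebra) direct_sum, ('c::cstar_algebra, 'd::cstar_algebra) direct_sum) spatial_tensor"
  shows "cstar_invertible \<xi> \<longleftrightarrow> cstar_invertible (tensor_map dfst dfst \<xi>) \<and> cstar_invertible (tensor_map dfst dsnd \<xi>) \<and>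
    cstar_invertible (tensor_map dsnd dfst \<xi>) \<and> cstar_invertible (tensor_map dsnd dsnd \<xi>)"
  unfolding internal_direct_sum_invertible[OF internal_direct_sum_tensor_left[OF internal_direct_sum_direct_sum], of \<xi>]
    internal_direct_sum_invertible[OF internal_direct_sum_tensor_right[OF internal_direct_sum_direct_sum], of "tensor_map _ _ \<xi>"]
  by (simp add: tensor_map_compose star_hom_direct_sum)

text \<open>
  The factors are split from right to left: the third one directly, the second and the first one through
  the decompositions that they induce on the twofold tensor product.
\<close>

lemma triple_tensor_direct_sum_positive:
  fixes \<xi> :: "((('a::cstar_algebra, 'b::cstar_algebra) direct_sum, ('a, 'b) direct_sum) spatial_tensor, ('a, 'b) direct_sum) spatial_tensor"
  assumes
    "cstar_positive (tensor_map (tensor_map dfst dfst) dfst \<xi>)" "cstar_positive (tensor_map (tensor_map dfst dfst) dsnd \<xi>)"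
    "cstar_positive (tensor_map (tensor_map dfst dsnd) dfst \<xi>)" "cstar_positive (tensor_map (tensor_map dfst dsnd) dsnd \<xi>)"
    "cstar_positive (tensor_map (tensor_map dsnd dfst) dfst \<xi>)" "cstar_positive (tensor_map (tensor_map dsnd dfst) dsnd \<xi>)"
    "cstar_positive (tensor_map (tensor_map dsnd dsnd) dfst \<xi>)" "cstar_positive (tensor_map (tensor_map dsnd dsnd) dsnd \<xi>)"
  shows "cstar_positive \<xi>"
proof -
  note d = internal_direct_sum_direct_sum
  note r = internal_direct_sum_positive[OF internal_direct_sum_tensor_right[OF d]]
  note lr = internal_direct_sum_positive[OF internal_direct_sum_tensor_left[OF internal_direct_sum_tensor_right[OF d]]]
  note ll = internal_direct_sum_positive[OF internal_direct_sum_tensor_left[OF internal_direct_sum_tensor_left[OF d]]]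
  have 1: "cstar_positive \<eta>"
    if "cstar_positive (tensor_map (tensor_map dfst dfst) (\<lambda>c. c) \<eta>)" "cstar_positive (tensor_map (tensor_map dfst dsnd) (\<lambda>c. c) \<eta>)"
      "cstar_positive (tensor_map (tensor_map dsnd dfst) (\<lambda>c. c) \<eta>)" "cstar_positive (tensor_map (tensor_map dsnd dsnd) (\<lambda>c. c) \<eta>)"
    for \<eta> :: "((('a, 'b) direct_sum, ('a, 'b) direct_sum) spatial_tensor, 'c::cstar_algebra) spatial_tensor"
    using that unfolding lr[of \<eta>] ll[of "tensor_map _ _ \<eta>"]
    by (simp add: tensor_map_compose star_hom_direct_sum star_hom_tensor_map)
  show ?thesis
    unfolding r[of \<xi>] by (intro conjI 1; simp add: tensor_map_compose star_hom_direct_sum star_hom_tensor_map assms)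
qed

section \<open>Insertion of units\<close>

lemma insert_unit_middle_map: "insert_unit_middle = tensor_map (\<lambda>a. a \<otimes> 1) (\<lambda>b. b)"
  and insert_unit_left_map: "insert_unit_left = tensor_map (\<lambda>a. 1 \<otimes> a) (\<lambda>b. b)"
  by (simp_all add: insert_unit_middle_def insert_unit_left_def tensor_map_def)

text \<open>
  With coordinate projections for \<open>f\<close>, \<open>g\<close>, \<open>h\<close>, this says that the block \<open>(i, j, k)\<close> of the three
  terms of the triangle inequality depends only on the blocks \<open>(i, k)\<close>, \<open>(j, k)\<close> and \<open>(i, j)\<close> of
  \<open>\<xi>\<close>, respectively.
\<close>

lemma insert_unit_component:
  assumes "star_hom f" "star_hom g" "star_hom h" "f 1 = 1" "g 1 = 1" "h 1 = 1"
  shows "tensor_map (tensor_map f g) h (insert_unit_middle \<xi>) = tensor_map (\<lambda>a. a \<otimes> 1) (\<lambda>b. b) (tensor_map f h \<xi>)"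
    "tensor_map (tensor_map f g) h (insert_unit_left \<xi>) = tensor_map (\<lambda>a. 1 \<otimes> a) (\<lambda>b. b) (tensor_map g h \<xi>)"
    "tensor_map (tensor_map f g) h (\<xi> \<otimes> 1) = tensor_map f g \<xi> \<otimes> 1"
  by (simp_all add: insert_unit_middle_map insert_unit_left_map assms tensor_map_compose star_hom_tensor_map
      star_hom_tensor_unit tensor_map_tensor)

lemma star_hom_insert_unit:
  "star_hom (tensor_map (\<lambda>a. a \<otimes> 1) (\<lambda>b. b))" "star_hom (tensor_map (\<lambda>a. 1 \<otimes> a) (\<lambda>b. b))"
  "tensor_map (\<lambda>a. a \<otimes> 1) (\<lambda>b. b) 1 = 1" "tensor_map (\<lambda>a. 1 \<otimes> a) (\<lambda>b. b) 1 = 1"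
  by (simp_all add: star_hom_tensor_map star_hom_tensor_unit tensor_map_one tensor_one)

lemma star_hom_scaleR: "star_hom f \<Longrightarrow> f (r *\<^sub>R x) = r *\<^sub>R f x"
  by (simp add: scaleR_scaleC star_homD)

section \<open>The metric on a direct sum\<close>

lemma spatially_continuous_multiplication_direct_sum:
  assumes "spatially_continuous_multiplication TYPE('a::cstar_algebra)"
    "spatially_continuous_multiplication TYPE('b::cstar_algebra)"
  shows "spatially_continuous_multiplication TYPE(('a, 'b) direct_sum)"
proof -
  obtain C where C: "\<And>x :: ('a \<times> 'a) list. norm (tsum (*) x) \<le> C * spatial_norm x"
    using assms(1) by (auto simp: spatially_continuous_multiplication_def)
  obtain D where D: "\<And>x :: ('b \<times> 'b) list. norm (tsum (*) x) \<le> D * spatial_norm x"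
    using assms(2) by (auto simp: spatially_continuous_multiplication_def)
  have "norm (tsum (*) x) \<le> max \<bar>C\<bar> \<bar>D\<bar> * spatial_norm x" for x :: "(('a, 'b) direct_sum \<times> ('a, 'b) direct_sum) list"
  proof -
    have h: "f (tsum (*) x) = tsum (*) (map (map_prod f f) x)" if "star_hom f" for f :: "('a, 'b) direct_sum \<Rightarrow> 'c::cstar_algebra"
      by (induction x) (auto simp: star_homD[OF that])
    have le: "k * spatial_norm (map (map_prod f f) x) \<le> max \<bar>C\<bar> \<bar>D\<bar> * spatial_norm x"
      if "star_hom f" "k \<le> max \<bar>C\<bar> \<bar>D\<bar>" for f :: "('a, 'b) direct_sum \<Rightarrow> 'c::cstar_algebra" and k
      using that by (intro mult_mono spatial_norm_map_prod) auto
    have "norm (dfst (tsum (*) x)) \<le> max \<bar>C\<bar> \<bar>D\<bar> * spatial_norm x"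
      unfolding h[OF star_hom_direct_sum(1)] by (rule order_trans[OF C le[OF star_hom_direct_sum(1)]]) auto
    moreover have "norm (dsnd (tsum (*) x)) \<le> max \<bar>C\<bar> \<bar>D\<bar> * spatial_norm x"
      unfolding h[OF star_hom_direct_sum(2)] by (rule order_trans[OF D le[OF star_hom_direct_sum(2)]]) auto
    ultimately show ?thesis by (simp add: norm_direct_sum_def)
  qed
  then show ?thesis by (auto simp: spatially_continuous_multiplication_def)
qed

definition direct_sum_metric ::
  "real \<Rightarrow> ('a::cstar_algebra, 'a) spatial_tensor \<Rightarrow> ('b::cstar_algebra, 'b) spatial_tensor \<Rightarrow>
    (('a, 'b) direct_sum, ('a, 'b) direct_sum) spatial_tensor" where
  "direct_sum_metric r \<rho>1 \<rho>2 = tensor_map inj_fst inj_fst \<rho>1 + tensor_map inj_snd inj_snd \<rho>2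
      + r *\<^sub>R tensor_map inj_fst inj_snd 1 + r *\<^sub>R tensor_map inj_snd inj_fst 1"

lemma direct_sum_metric_component:
  "tensor_map dfst dfst (direct_sum_metric r \<rho>1 \<rho>2) = \<rho>1"
  "tensor_map dfst dsnd (direct_sum_metric r \<rho>1 \<rho>2) = r *\<^sub>R 1"
  "tensor_map dsnd dfst (direct_sum_metric r \<rho>1 \<rho>2) = r *\<^sub>R 1"
  "tensor_map dsnd dsnd (direct_sum_metric r \<rho>1 \<rho>2) = \<rho>2"
  by (simp_all add: direct_sum_metric_def star_homD(4)[OF star_hom_tensor_map] star_hom_scaleR[OF star_hom_tensor_map]
      star_hom_direct_sum tensor_map_compose direct_sum_proj_inj tensor_map_id tensor_map_zero star_hom_zero)

text \<open>
  The eight blocks are of three kinds: the two with equal indices are the hypotheses \<open>t1\<close> and \<open>t2\<close>; in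
  those with different outer indices an \<open>r\<close> cancels and \<open>right\<close> or \<open>left\<close> remains; those with equal outer
  and different middle index are instances of \<open>far\<close>.
\<close>

lemma direct_sum_metric_triangle:
  assumes t1: "cstar_le (insert_unit_middle \<rho>1) (\<rho>1 \<otimes> 1 + insert_unit_left \<rho>1)"
    and t2: "cstar_le (insert_unit_middle \<rho>2) (\<rho>2 \<otimes> 1 + insert_unit_left \<rho>2)"
    and pos: "cstar_positive \<rho>1" "cstar_positive \<rho>2"
    and r: "norm \<rho>1 \<le> 2 * r" "norm \<rho>2 \<le> 2 * r"
  shows "cstar_le (insert_unit_middle (direct_sum_metric r \<rho>1 \<rho>2))
    (direct_sum_metric r \<rho>1 \<rho>2 \<otimes> 1 + insert_unit_left (direct_sum_metric r \<rho>1 \<rho>2))"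
proof -
  note hom = star_hom_direct_sum direct_sum_proj_inj star_hom_tensor_map
  note comp = insert_unit_component direct_sum_metric_component star_hom_scaleR[OF star_hom_insert_unit(1)]
    star_hom_scaleR[OF star_hom_insert_unit(2)] star_hom_insert_unit(3,4) tensor_scaleR tensor_one
  have far: "cstar_positive (r *\<^sub>R 1 + r *\<^sub>R 1 - tensor_map (\<lambda>a. a \<otimes> 1) (\<lambda>b. b) \<rho>)"
    if "cstar_positive \<rho>" "norm \<rho> \<le> 2 * r" for \<rho> :: "('c::cstar_algebra, 'c) spatial_tensor"
  proof -
    have "cstar_positive (tensor_map (\<lambda>a. a \<otimes> 1) (\<lambda>b. b) ((2 * r) *\<^sub>R 1 - \<rho>))"
      by (rule cstar_positive_hom[OF star_hom_insert_unit(1,3) cstar_positive_norm_complement[OF that]])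
    then show ?thesis
      by (simp add: star_homD(8)[OF star_hom_insert_unit(1)] comp flip: scaleR_left_distrib)
  qed
  have right: "cstar_positive (\<rho> \<otimes> 1)" and left: "cstar_positive (tensor_map (\<lambda>a. 1 \<otimes> a) (\<lambda>b. b) \<rho>)"
    if "cstar_positive \<rho>" for \<rho> :: "('c::cstar_algebra, 'c) spatial_tensor"
    by (rule cstar_positive_hom[OF star_hom_tensor_unit(1) tensor_one that]
        cstar_positive_hom[OF star_hom_insert_unit(2,4) that])+
  note same = t1[unfolded cstar_le_def insert_unit_middle_map insert_unit_left_map]
    t2[unfolded cstar_le_def insert_unit_middle_map insert_unit_left_map]
  show ?thesis
    unfolding cstar_le_def
    by (rule triple_tensor_direct_sum_positive)
      (simp_all add: star_homD(4,8)[OF star_hom_tensor_map] hom comp same far right left pos r)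
qed

text \<open>
  The diagonal blocks of \<open>\<nu>\<close> satisfy the conditions imposed on \<open>\<nu>\<close>, because the coordinate projections
  are unital homomorphisms compatible with multiplication and flip. Off the diagonal, \<open>-r\<close> is not in the
  spectrum of the positive block of \<open>\<nu>\<close>.
\<close>

lemma direct_sum_metric_invertible:
  fixes \<rho>1 :: "('a::cstar_algebra, 'a) spatial_tensor" and \<rho>2 :: "('b::cstar_algebra, 'b) spatial_tensor"
    and \<nu> :: "(('a, 'b) direct_sum, ('a, 'b) direct_sum) spatial_tensor"
  assumes scm: "spatially_continuous_multiplication TYPE('a)" "spatially_continuous_multiplication TYPE('b)"
    and inv1: "\<And>\<nu>. cstar_positive \<nu> \<Longrightarrow> tensor_mult \<nu> = 1 \<Longrightarrow> tensor_flip \<nu> = \<nu> \<Longrightarrow> cstar_invertible (\<rho>1 + \<nu>)"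
    and inv2: "\<And>\<nu>. cstar_positive \<nu> \<Longrightarrow> tensor_mult \<nu> = 1 \<Longrightarrow> tensor_flip \<nu> = \<nu> \<Longrightarrow> cstar_invertible (\<rho>2 + \<nu>)"
    and r: "0 < r" and \<nu>: "cstar_positive \<nu>" "tensor_mult \<nu> = 1" "tensor_flip \<nu> = \<nu>"
  shows "cstar_invertible (direct_sum_metric r \<rho>1 \<rho>2 + \<nu>)"
proof -
  note scm_sum = spatially_continuous_multiplication_direct_sum[OF scm]
  note pos = \<nu>(1)[unfolded tensor_direct_sum_positive[of \<nu>]]
  have "cstar_invertible (\<rho>1 + tensor_map dfst dfst \<nu>)"
    using pos by (intro inv1) (simp_all add: tensor_mult_map[OF scm_sum scm(1)] tensor_flip_map star_hom_direct_sum \<nu>(2,3) direct_sum_proj_inj)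
  moreover have "cstar_invertible (\<rho>2 + tensor_map dsnd dsnd \<nu>)"
    using pos by (intro inv2) (simp_all add: tensor_mult_map[OF scm_sum scm(2)] tensor_flip_map star_hom_direct_sum \<nu>(2,3) direct_sum_proj_inj)
  ultimately show ?thesis
    unfolding tensor_direct_sum_invertible[of "direct_sum_metric r \<rho>1 \<rho>2 + \<nu>"]
    using pos r by (simp add: star_homD(4)[OF star_hom_tensor_map] star_hom_direct_sum direct_sum_metric_component
        cstar_invertible_scalar_plus_positive)
qed

theorem theorem4:
  fixes \<rho>1 :: "('a::cstar_algebra, 'a) spatial_tensor"
    and \<rho>2 :: "('b::cstar_algebra, 'b) spatial_tensor"
    and r :: real
  assumes "algebraic_compact_quantum_metric_space \<rho>1"
    and "algebraic_compact_quantum_metric_space \<rho>2"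
    and "r \<ge> 1 / 2 * max (norm \<rho>1) (norm \<rho>2)"
    and "r > 0"
  shows "algebraic_compact_quantum_metric_space
    (tensor_map inj_fst inj_fst \<rho>1 + tensor_map inj_snd inj_snd \<rho>2
      + r *\<^sub>R tensor_map inj_fst inj_snd (1 :: ('a, 'b) spatial_tensor)
      + r *\<^sub>R tensor_map inj_snd inj_fst (1 :: ('b, 'a) spatial_tensor)
      :: (('a, 'b) direct_sum, ('a, 'b) direct_sum) spatial_tensor)"
proof -
  let ?\<rho> = "direct_sum_metric r \<rho>1 \<rho>2"
  note m1 = assms(1)[unfolded algebraic_compact_quantum_metric_space_def]
    and m2 = assms(2)[unfolded algebraic_compact_quantum_metric_space_def]
  have scm: "spatially_continuous_multiplication TYPE('a)" "spatially_continuous_multiplication TYPE('b)"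
    using m1 m2 by auto
  note scm_sum = spatially_continuous_multiplication_direct_sum[OF scm]
  have "cstar_positive ?\<rho>"
    unfolding tensor_direct_sum_positive[of ?\<rho>]
    using m1 m2 assms(4) by (simp add: direct_sum_metric_component cstar_positive_scaleR_one)
  moreover have "tensor_mult ?\<rho> = 0"
  proof (rule direct_sum.expand, intro conjI)
    show "dfst (tensor_mult ?\<rho>) = dfst 0"
      using m1 by (simp add: direct_sum_metric_component zero_direct_sum_def
          flip: tensor_mult_map[OF scm_sum scm(1) star_hom_direct_sum(1)])
    show "dsnd (tensor_mult ?\<rho>) = dsnd 0"
      using m2 by (simp add: direct_sum_metric_component zero_direct_sum_def
          flip: tensor_mult_map[OF scm_sum scm(2) star_hom_direct_sum(2)])
  qed
  moreover have "tensor_flip ?\<rho> = ?\<rho>"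
    using m1 m2 by (simp add: direct_sum_metric_def cbounded_linearD(1)[OF cbounded_linear_tensor_flip]
        tensor_flip_scaleR tensor_flip_map tensor_flip_one star_hom_direct_sum add_ac)
  moreover have "cstar_invertible (?\<rho> + \<nu>)"
    if "cstar_positive \<nu>" "tensor_mult \<nu> = 1" "tensor_flip \<nu> = \<nu>" for \<nu>
    by (rule direct_sum_metric_invertible[OF scm _ _ assms(4) that]) (use m1 m2 in auto)
  moreover have "cstar_le (insert_unit_middle ?\<rho>) (?\<rho> \<otimes> 1 + insert_unit_left ?\<rho>)"
    using m1 m2 assms(3) by (intro direct_sum_metric_triangle) auto
  ultimately have "algebraic_compact_quantum_metric_space ?\<rho>"
    using scm_sum by (simp add: algebraic_compact_quantum_metric_space_def)
  then show ?thesis by (simp only: direct_sum_metric_def)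
qed

end
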